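(* Let $L>0$, $T>0$, and let $\rho_{0,L}\in L^\infty(\mathbb T_L)$ be nonnegative with $c_L:=\int_{\mathbb T_L}\rho_{0,L}\,dx\in(0,1]$. Then there exists a constant $\bar C=\bar C(\mathcal F^v_L(\rho_{0,L}),K,\|\rho_{0,L}\|_{L^\infty},\|v\|_{L^\infty},T)$ such that the following holds: there exists $\bar N=\bar N(L,T,\mathcal F^v_L(\rho_{0,L}),\|v\|_{L^\infty})$ such that the deterministic particle approximations $\{\rho^N_L\}_{N\ge\bar N}$ starting from $\rho_{0,L}$ are well defined on $[0,T]$ and $$\sup_{N\ge\bar N}\ \sup_{t\in[0,T)}\|\rho^N_L(t)\|_{L^\infty(\mathbb T_L)}\le\bar C .$$
   Context: Kernel: $K:\mathbb R\to\mathbb R$ is fixed and satisfies $K(z)=K(|z|)$; $K\in C^0(\mathbb R)\cap C^2(\mathbb R\setminus\{0\})$; $K,K'\in L^\infty(\mathbb R)$; $K''|_{\mathbb R\setminus\{0\}}\in L^\infty(\mathbb R\setminus\{0\})$; and $\|K'\|_{L^1(\mathbb R)}<\infty$. Mobility: $v:[0,\infty)\to[0,\infty)$ is a fixed Lipschitz function with $v'\le 0$ and $\|v\|_\infty=v(0)<\infty$. Diffusion: either $W(\rho)=\rho\log\rho$ or $W(\rho)=\rho^m/(m-1)$ with $m>1$. Set $\phi_v(s)=\int_0^s\xi W''(\xi)v(\xi)\,d\xi$, and let $W_v$ be a function with $\phi_v(s)=sW_v'(s)-W_v(s)$. Torus: $\mathbb T_L=\mathbb R/L\mathbb Z$, identified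 with $[-L/2,L/2)$; for $x,y\in\mathbb T_L$, $K(x-y)$ and $K'(x-y)$ are evaluated at the representative of $x-y$ in $[-L/2,L/2)$. Energy: $$\mathcal F^v_L(\rho)=\frac12\int_{\mathbb T_L}\int_{\mathbb T_L}K(x-y)\rho(x)\rho(y)\,dx\,dy+\int_{\mathbb T_L}W_v(\rho(x))\,dx .$$ Deterministic particle approximation starting from $\rho_{0,L}$ with $N$ particles: put $x_0=-L/2$, $x_k=\sup\{x:\int_{x_{k-1}}^x\rho_{0,L}(y)\,dy<c_L/N\}$ for $k=1,\dots,N-1$, and $x_N=x_0+L$ (so $x_N=x_0$ on $\mathbb T_L$). Indices are understood modulo $N$. The particles $x_k(t)$ solve $$\dot x_k(t)=-\frac{c_L}{N}v_k(t)\sum_{j\ne k}K'(x_k(t)-x_j(t))-\frac{N}{c_L}G_k(t),\qquad x_k(0)=x_k,$$ as long as $x_0(t)<\dots<x_{N-1}(t)$, where $\rho_k(t)=\frac{c_L}{N(x_{k+1}(t)-x_k(t))}$, $G_k(t)=\phi_v(\rho_k(t))-\phi_v(\rho_{k-1}(t))$, $v_k(t)=v(\max(\rho_k(t),\rho_{k-1}(t)))$. Then $\rho^N_L(t,x)=\sum_{k=0}^{N-1}\rho_k(t)\chi_{[x_k(t),x_{k+1}(t))}(x)$, and $\rho^N_L(t)=\rho^N_L(t,\cdot)$. The approximation is well defined on a time interval if $x_0(t)<\dots<x_{N-1}(t)$ (in the cyclic order of the torus) for all $t$ in that interval.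
   Formalization: At antipodal particle pairs K' jumps and the particle ODE can have no solution; there K'(x_k-x_j) may take any value between K'(-L/2) and K'(L/2), independently for each ordered pair, and the system is read in integrated form; the bound holds for every such solution. *)

theory Defs
  imports "HOL-Analysis.Analysis" "HOL-Probability.Essential_Supremum"
begin

definition Linf_norm :: "'a measure \<Rightarrow> ('a \<Rightarrow> real) \<Rightarrow> ereal" where
  "Linf_norm M f = esssup M (\<lambda>x. ereal \<bar>f x\<bar>)"

definition Linf :: "'a measure \<Rightarrow> ('a \<Rightarrow> real) \<Rightarrow> bool" where
  "Linf M f \<longleftrightarrow> f \<in> borel_measurable M \<and> Linf_norm M f < \<infinity>"


section \<open>Kernel, mobility, diffusion\<close>

text \<open>The value \<open>deriv K 0\<close> is arbitrary, but it only matters on a null set.\<close>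

definition admissible_kernel :: "(real \<Rightarrow> real) \<Rightarrow> bool" where
  "admissible_kernel K \<longleftrightarrow>
     (\<forall>z. K z = K \<bar>z\<bar>) \<and>
     continuous_on UNIV K \<and>
     (\<forall>z. z \<noteq> 0 \<longrightarrow> K differentiable (at z) \<and> deriv K differentiable (at z)) \<and>
     continuous_on (- {0}) (deriv (deriv K)) \<and>
     Linf lebesgue K \<and>
     Linf lebesgue (deriv K) \<and>
     Linf (lebesgue_on (- {0})) (deriv (deriv K)) \<and>
     integrable lebesgue (deriv K)"

text \<open>A Lipschitz function is differentiable almost everywhere, so the almost everywhere
  clause below says exactly that \<open>v' \<le> 0\<close>.\<close>

definition admissible_mobility :: "(real \<Rightarrow> real) \<Rightarrow> bool" where
  "admissible_mobility v \<longleftrightarrow>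
     (\<forall>s\<ge>0. v s \<ge> 0) \<and>
     (\<exists>B. B-lipschitz_on {0..} v) \<and>
     (AE s in lebesgue_on {0..}. \<exists>d\<le>0. (v has_real_derivative d) (at s)) \<and>
     Linf_norm (lebesgue_on {0..}) v = ereal (v 0)"

definition admissible_diffusion :: "(real \<Rightarrow> real) \<Rightarrow> bool" where
  "admissible_diffusion W \<longleftrightarrow>
     (\<forall>r\<ge>0. W r = r * ln r) \<or> (\<exists>m>1. \<forall>r\<ge>0. W r = r powr m / (m - 1))"

definition phi :: "(real \<Rightarrow> real) \<Rightarrow> (real \<Rightarrow> real) \<Rightarrow> real \<Rightarrow> real" where
  "phi W v s = integral {0..s} (\<lambda>\<xi>. \<xi> * deriv (deriv W) \<xi> * v \<xi>)"

text \<open>\<open>Wv\<close> need not be differentiable at \<open>0\<close> (e.g. \<open>Wv s = s * ln s\<close>); the equation at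
  \<open>s = 0\<close> just says \<open>Wv 0 = 0\<close>, the continuous extension.\<close>

definition is_Wv :: "(real \<Rightarrow> real) \<Rightarrow> (real \<Rightarrow> real) \<Rightarrow> (real \<Rightarrow> real) \<Rightarrow> bool" where
  "is_Wv W v Wv \<longleftrightarrow>
     (\<forall>s>0. Wv differentiable (at s)) \<and>
     (\<forall>s\<ge>0. phi W v s = s * deriv Wv s - Wv s)"


section \<open>Torus and energy\<close>

text \<open>Functions on the torus are functions on the fundamental domain; their values elsewhere
  are never used.\<close>

definition torus :: "real \<Rightarrow> real measure" where
  "torus L = lebesgue_on {-L/2..<L/2}"

text \<open>The representative of \<open>z\<close> modulo \<open>L\<close> in \<open>[-L/2, L/2)\<close>.\<close>

definition torus_rep :: "real \<Rightarrow> real \<Rightarrow> real" where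
  "torus_rep L z = z - L * of_int \<lfloor>z / L + 1/2\<rfloor>"

definition mass :: "real \<Rightarrow> (real \<Rightarrow> real) \<Rightarrow> real" where
  "mass L \<rho> = (\<integral>x. \<rho> x \<partial>torus L)"

definition energy :: "(real \<Rightarrow> real) \<Rightarrow> (real \<Rightarrow> real) \<Rightarrow> real \<Rightarrow> (real \<Rightarrow> real) \<Rightarrow> real" where
  "energy K Wv L \<rho> =
     1/2 * (\<integral>x. (\<integral>y. K (torus_rep L (x - y)) * \<rho> x * \<rho> y \<partial>torus L) \<partial>torus L)
     + (\<integral>x. Wv (\<rho> x) \<partial>torus L)"


section \<open>Deterministic particle approximation\<close>

primrec init_pos :: "real \<Rightarrow> (real \<Rightarrow> real) \<Rightarrow> nat \<Rightarrow> nat \<Rightarrow> real" where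
  "init_pos L \<rho>0 N 0 = - L / 2"
| "init_pos L \<rho>0 N (Suc k) =
     Sup {x \<in> {init_pos L \<rho>0 N k..L/2}.
            set_lebesgue_integral lebesgue {init_pos L \<rho>0 N k..<x} \<rho>0 < mass L \<rho>0 / real N}"

text \<open>Particles on the torus are followed through continuous lifts to the real line, so the
  right neighbour of particle \<open>N - 1\<close> sits at \<open>x 0 + L\<close>, and the cyclic order reads
  \<open>x 0 < \<dots> < x (N - 1) < x 0 + L\<close>.\<close>

definition next_pos :: "real \<Rightarrow> nat \<Rightarrow> (nat \<Rightarrow> real) \<Rightarrow> nat \<Rightarrow> real" where
  "next_pos L N x k = (if Suc k < N then x (Suc k) else x 0 + L)"

definition ordered :: "real \<Rightarrow> nat \<Rightarrow> (nat \<Rightarrow> real) \<Rightarrow> bool" where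
  "ordered L N x \<longleftrightarrow> (\<forall>k<N. x k < next_pos L N x k)"

definition dpa_density :: "real \<Rightarrow> real \<Rightarrow> nat \<Rightarrow> (nat \<Rightarrow> real) \<Rightarrow> nat \<Rightarrow> real" where
  "dpa_density c L N x k = c / (real N * (next_pos L N x k - x k))"

definition prev_index :: "nat \<Rightarrow> nat \<Rightarrow> nat" where
  "prev_index N k = (k + N - 1) mod N"

definition dpa_G ::
    "(real \<Rightarrow> real) \<Rightarrow> (real \<Rightarrow> real) \<Rightarrow> real \<Rightarrow> real \<Rightarrow> nat \<Rightarrow> (nat \<Rightarrow> real) \<Rightarrow> nat \<Rightarrow> real" where
  "dpa_G W v c L N x k =
     phi W v (dpa_density c L N x k) - phi W v (dpa_density c L N x (prev_index N k))"

definition dpa_v :: "(real \<Rightarrow> real) \<Rightarrow> real \<Rightarrow> real \<Rightarrow> nat \<Rightarrow> (nat \<Rightarrow> real) \<Rightarrow> nat \<Rightarrow> real" where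
  "dpa_v v c L N x k =
     v (max (dpa_density c L N x k) (dpa_density c L N x (prev_index N k)))"

text \<open>The periodized \<open>K'\<close> jumps at the antipodal point, from \<open>K' (L/2)\<close> to
  \<open>K' (-L/2) = - K' (L/2)\<close>, so the particle system is an ODE with a discontinuous right-hand
  side. In general (for instance for repulsive \<open>K\<close>, where antipodal pairs slide along the
  discontinuity) it has no solution, not even an absolutely continuous one, if \<open>K'\<close> is given
  the single value \<open>K' (-L/2)\<close> there. As usual for such equations, \<open>K'\<close> is
  replaced at the jump by the segment between its one-sided limits. The segment contains the value
  \<open>K' (-L/2)\<close> of the half-open convention, and nothing changes away from the jump, nor
  anywhere if \<open>K' (L/2) = 0\<close>.\<close>

definition dK_set :: "real \<Rightarrow> (real \<Rightarrow> real) \<Rightarrow> real \<Rightarrow> real set" where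
  "dK_set L K z =
     (if torus_rep L z = - L / 2 then closed_segment (deriv K (- L / 2)) (deriv K (L / 2))
      else {deriv K (torus_rep L z)})"

text \<open>\<open>\<kappa> k j\<close> stands for \<open>K' (x k - x j)\<close>.\<close>

definition dpa_rhs ::
    "(real \<Rightarrow> real) \<Rightarrow> (real \<Rightarrow> real) \<Rightarrow> real \<Rightarrow> real \<Rightarrow> nat
      \<Rightarrow> (nat \<Rightarrow> nat \<Rightarrow> real) \<Rightarrow> (nat \<Rightarrow> real) \<Rightarrow> nat \<Rightarrow> real" where
  "dpa_rhs W v c L N \<kappa> x k =
     - (c / real N) * dpa_v v c L N x k * (\<Sum>j\<in>{..<N} - {k}. \<kappa> k j)
     - (real N / c) * dpa_G W v c L N x k"

text \<open>\<open>X k t\<close> is the position of particle \<open>k\<close> at time \<open>t\<close>, for \<open>t\<close> in a time interval \<open>I\<close> with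
  left end point \<open>0\<close>. The system is required in integrated form (trajectories have corners
  when a pair becomes antipodal).\<close>

definition dpa_solution ::
    "(real \<Rightarrow> real) \<Rightarrow> (real \<Rightarrow> real) \<Rightarrow> (real \<Rightarrow> real) \<Rightarrow> real \<Rightarrow> (real \<Rightarrow> real) \<Rightarrow> nat
      \<Rightarrow> real set \<Rightarrow> (nat \<Rightarrow> real \<Rightarrow> real) \<Rightarrow> bool" where
  "dpa_solution K v W L \<rho>0 N I X \<longleftrightarrow>
     (\<forall>k<N. X k 0 = init_pos L \<rho>0 N k) \<and>
     (\<forall>t\<in>I. ordered L N (\<lambda>k. X k t)) \<and>
     (\<exists>\<kappa> :: nat \<Rightarrow> nat \<Rightarrow> real \<Rightarrow> real.
        (\<forall>t\<in>I. \<forall>k<N. \<forall>j<N. j \<noteq> k \<longrightarrow> \<kappa> k j t \<in> dK_set L K (X k t - X j t)) \<and>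
        (\<forall>t\<in>I. \<forall>k<N.
           ((\<lambda>s. dpa_rhs W v (mass L \<rho>0) L N (\<lambda>k j. \<kappa> k j s) (\<lambda>i. X i s) k)
              has_integral (X k t - X k 0)) {0..t}))"

text \<open>Solutions exist on \<open>[0,T]\<close>, and no solution breaks down before: since solutions need
  not be unique, this is required of each of them.\<close>

definition dpa_well_defined ::
    "(real \<Rightarrow> real) \<Rightarrow> (real \<Rightarrow> real) \<Rightarrow> (real \<Rightarrow> real) \<Rightarrow> real \<Rightarrow> (real \<Rightarrow> real) \<Rightarrow> nat
      \<Rightarrow> real \<Rightarrow> bool" where
  "dpa_well_defined K v W L \<rho>0 N T \<longleftrightarrow>
     (\<exists>X. dpa_solution K v W L \<rho>0 N {0..T} X) \<and>
     (\<forall>\<tau>\<in>{0<..T}. \<forall>X. dpa_solution K v W L \<rho>0 N {0..<\<tau>} X \<longrightarrow>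
        (\<exists>Y. dpa_solution K v W L \<rho>0 N {0..T} Y \<and> (\<forall>k<N. \<forall>t\<in>{0..<\<tau>}. Y k t = X k t)))"

definition dpa_profile ::
    "real \<Rightarrow> real \<Rightarrow> nat \<Rightarrow> (nat \<Rightarrow> real) \<Rightarrow> real \<Rightarrow> real" where
  "dpa_profile c L N x y =
     (\<Sum>k<N. dpa_density c L N x k *
        indicator {z. \<exists>n::int. z + of_int n * L \<in> {x k..<next_pos L N x k}} y)"

end

theory Submission
  imports Defs
begin

text \<open>
  Write \<open>d\<^sub>k\<close> for the gap between particle \<open>k\<close> and its right neighbour and
  \<open>\<rho>\<^sub>k = c / (N d\<^sub>k)\<close>. At an index where \<open>\<rho>\<^sub>k\<close> is maximal the diffusion pushes the two
  neighbours apart, so only the interaction can compress the gap. It does so for three reasons: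
  the bounded second derivative of \<open>K\<close>, the jump of \<open>K'\<close> at the origin (felt by the pair
  itself) and the jump of the periodized \<open>K'\<close> at the antipode (felt through at most two
  particles, because all gaps are at least \<open>d\<^sub>k\<close>). The result is
  \<open>(- ln d\<^sub>k)' \<le> C + C \<rho>\<^sub>k v(\<rho>\<^sub>k)\<close> (\<open>compression_at_min_gap\<close>), which by itself would allow
  blow-up in finite time.

  The missing control comes from a truncated entropy. Let \<open>M = max 1 \<parallel>\<rho>\<^sub>0\<parallel>\<close> and let
  \<open>\<psi>(s) = (\<phi>(s) - \<phi>(M))\<^sup>+\<close>. Since \<open>\<phi>' = w v\<close> with \<open>w \<ge> 1\<close> on \<open>[1, \<infinity>)\<close>
  and \<open>v\<close> does not increase, \<open>s v(s) \<le> \<psi>(s) + M v(0)\<close>. Let \<open>E\<close> be the sum over \<open>k\<close> of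
  the integral of \<open>\<psi>(c / (N s))\<close> over \<open>s \<ge> d\<^sub>k\<close>. The diffusion dissipates \<open>E\<close> at a rate that
  dominates the squared variation of \<open>\<psi>\<close> along the circle. As the mean density is at most \<open>M\<close>,
  \<open>\<psi>\<close> vanishes at some particle, so this variation bounds the maximum of \<open>\<psi>\<close>, and
  \<open>E' \<le> C - (max \<psi>)\<^sup>2 / 2\<close> (\<open>dissipation\<close>). The square absorbs the dangerous term: where
  \<open>\<rho>\<^sub>k\<close> is maximal, \<open>- ln d\<^sub>k + E\<close> grows at most at a rate that depends only on \<open>M\<close>, \<open>K\<close> and
  \<open>v(0)\<close>. As \<open>E\<close> is nonnegative and vanishes initially, \<open>\<rho>\<^sub>k \<le> M exp(C t)\<close>
  (\<open>gap_lower_bound\<close>). Truncating at the level \<open>M\<close> keeps the constants free of the length of the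
  torus and of the diffusion exponent.

  The particle system is a differential inclusion. Solutions are described by a condition on
  right difference quotients at every time (\<open>follows\<close>): asymptotically they lie between the
  extreme admissible velocities. This condition is inherited by limits of Euler schemes, it is
  local to the right, so trajectories can be glued at any time, and it suffices for the maximum
  principle. It is equivalent to the integrated system: averaging gives one direction
  (\<open>integral_solution_follows\<close>); for the other (\<open>follows_integral_solution\<close>) the trajectories
  are Lipschitz, hence differentiable from the right almost everywhere, the derivative
  lies in the interval of admissible velocities, and so it is realised by admissible values of
  \<open>K'\<close>. Existence and continuation follow from an Euler scheme for the field switched off at small
  gaps, because the lower bound on the gaps prevents the trajectory from getting there
  (\<open>extend_following\<close>).
\<close>

section \<open>Lipschitz functions and right difference quotients\<close>

text \<open>Adding a multiple of the identity turns \<open>u\<close> into an increasing bi-Lipschitz homeomorphism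
  \<open>F\<close>. The measure \<open>A \<mapsto> \<bar>F ` A\<bar>\<close> is the image of Lebesgue measure under the inverse of \<open>F\<close>, and it is
  absolutely continuous because Lipschitz maps preserve null sets. Its Radon-Nikodym density, minus
  the slope that was added, is \<open>f\<close>; the Lebesgue differentiation theorem gives the last
  conclusion.\<close>

lemma lipschitz_density:
  fixes u :: "real \<Rightarrow> real"
  assumes lip: "\<And>s t. \<bar>u s - u t\<bar> \<le> B * \<bar>s - t\<bar>"
  obtains f Z where "negligible Z"
    "\<And>a b. a \<le> b \<Longrightarrow> (f has_integral (u b - u a)) {a..b}"
    "\<And>t. t \<notin> Z \<Longrightarrow> ((\<lambda>s. (u s - u t) / (s - t)) \<longlongrightarrow> f t) (at_right t)"
proof -
  have B0: "0 \<le> B" using lip[of 1 0] by simp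
  \<comment> \<open>the slope \<open>B + 1\<close> makes \<open>F\<close> expanding: its increments are at least those of the identity\<close>
  define F where "F t = u t + (B + 1) * t" for t
  have F_low: "y - x \<le> F y - F x" if "x \<le> y" for x y
    using lip[of y x] that by (auto simp: F_def algebra_simps abs_le_iff)
  have F_lip: "\<bar>F y - F x\<bar> \<le> (2 * B + 1) * \<bar>y - x\<bar>" for x y
  proof -
    have "F y - F x = (u y - u x) + (B + 1) * (y - x)" by (simp add: F_def algebra_simps)
    then have "\<bar>F y - F x\<bar> \<le> \<bar>u y - u x\<bar> + (B + 1) * \<bar>y - x\<bar>"
      using B0 abs_triangle_ineq[of "u y - u x" "(B + 1) * (y - x)"] by (simp add: abs_mult)
    then show ?thesis using lip[of y x] by (simp add: algebra_simps)
  qed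
  have F_cont: "continuous_on A F" for A
  proof (rule lipschitz_on_continuous_on)
    show "(2 * B + 1)-lipschitz_on A F"
      using F_lip B0 by (intro lipschitz_onI) (auto simp: dist_real_def)
  qed
  have F_inj: "inj F"
  proof (rule injI)
    fix x y assume "F x = F y"
    then show "x = y" using F_low[of x y] F_low[of y x] by linarith
  qed
  have F_surj: "surj F"
  proof (unfold surj_def, intro allI)
    fix y
    let ?r = "\<bar>y - F 0\<bar>"
    have "F (- ?r) \<le> y" "y \<le> F ?r" using F_low[of "-?r" 0] F_low[of 0 "?r"] by auto
    then obtain x where "F x = y" using IVT'[of F "- ?r" y ?r] F_cont by auto
    then show "\<exists>x. y = F x" by blast
  qed
  define G where "G = inv F"
  have FG: "F (G y) = y" for y using F_surj by (simp add: G_def surj_f_inv_f)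
  have GF: "G (F y) = y" for y using F_inj by (simp add: G_def)
  have G_lip: "\<bar>G y - G x\<bar> \<le> \<bar>y - x\<bar>" for x y
    using F_low[of "G x" "G y"] F_low[of "G y" "G x"] by (cases "G x \<le> G y") (simp_all add: FG)
  have "continuous_on UNIV G"
  proof (rule lipschitz_on_continuous_on)
    show "1-lipschitz_on UNIV G" using G_lip by (intro lipschitz_onI) (auto simp: dist_real_def)
  qed
  then have G_meas [measurable]: "G \<in> borel_measurable borel"
    by (rule borel_measurable_continuous_onI)
  have G_vimage: "G -` A = F ` A" for A
  proof (intro set_eqI iffI)
    fix z assume "z \<in> G -` A"
    then show "z \<in> F ` A" by (intro image_eqI[of _ _ "G z"]) (simp_all add: FG)
  next
    fix z assume "z \<in> F ` A"
    then show "z \<in> G -` A" by (auto simp: GF)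
  qed
  define \<nu> where "\<nu> = distr lborel borel G"
  have \<nu>: "emeasure \<nu> A = emeasure lborel (F ` A)" if "A \<in> sets borel" for A
    using that by (simp add: \<nu>_def emeasure_distr G_vimage)
  have "absolutely_continuous lborel \<nu>"
    unfolding absolutely_continuous_def
  proof
    fix A :: "real set" assume A: "A \<in> null_sets lborel"
    then have Ab: "A \<in> sets borel" by auto
    have "negligible A"
      using A null_sets_completionI by (auto simp: negligible_iff_null_sets)
    then have "negligible (F ` A)"
    proof (rule negligible_locally_Lipschitz_image[rotated])
      show "\<exists>T C. open T \<and> x \<in> T \<and> (\<forall>y\<in>A \<inter> T. norm (F y - F x) \<le> C * norm (y - x))" for x
        by (intro exI[of _ UNIV] exI[of _ "2 * B + 1"]) (simp add: F_lip)
    qed simp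
    moreover have "F ` A \<in> sets borel"
      using measurable_sets[OF G_meas Ab] by (simp add: G_vimage)
    ultimately have "emeasure lborel (F ` A) = 0"
      by (simp add: negligible_iff_null_sets null_sets_completion_iff null_setsD1)
    then show "A \<in> null_sets \<nu>"
      using Ab \<nu>[OF Ab] by (auto simp: null_sets_def \<nu>_def)
  qed
  then obtain h where h [measurable]: "h \<in> borel_measurable lborel" and dens: "density lborel h = \<nu>"
    using sigma_finite_measure.Radon_Nikodym[OF sigma_finite_lborel, of \<nu>] by (auto simp: \<nu>_def)
  define g where "g x = enn2real (h x)" for x
  have g_meas [measurable]: "g \<in> borel_measurable borel" unfolding g_def using h by measurable
  have F_img: "F ` {a..b} = {F a..F b}" if "a \<le> b" for a b
  proof -
    have mono: "F x \<le> F y \<longleftrightarrow> x \<le> y" for x y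
      using F_low[of x y] F_low[of y x] by linarith
    show ?thesis
    proof (intro set_eqI iffI)
      fix z assume "z \<in> F ` {a..b}"
      then show "z \<in> {F a..F b}" by (auto simp: mono)
    next
      fix z assume "z \<in> {F a..F b}"
      then have "G z \<in> {a..b}" using mono[of a "G z"] mono[of "G z" b] by (simp add: FG)
      then show "z \<in> F ` {a..b}" by (intro image_eqI[of _ _ "G z"]) (simp_all add: FG)
    qed
  qed
  have g_int: "(g has_integral (F b - F a)) {a..b}" if ab: "a \<le> b" for a b
  proof -
    have nn: "(\<integral>\<^sup>+x. h x * indicator {a..b} x \<partial>lborel) = ennreal (F b - F a)"
      using \<nu>[of "{a..b}"] ab F_low[OF ab]
      by (simp add: dens[symmetric] emeasure_density F_img)
    then have "AE x in lborel. h x * indicator {a..b} x \<noteq> \<infinity>"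
      by (intro nn_integral_PInf_AE) auto
    then have "(\<integral>\<^sup>+x. ennreal (g x * indicator {a..b} x) \<partial>lborel) = (\<integral>\<^sup>+x. h x * indicator {a..b} x \<partial>lborel)"
      by (intro nn_integral_cong_AE) (auto simp: g_def indicator_def less_top elim!: eventually_mono)
    with nn have "((\<lambda>x. g x * indicator {a..b} x) has_integral (F b - F a)) UNIV"
      using F_low[OF ab] ab by (intro nn_integral_has_integral) (auto simp: g_def)
    also have "(\<lambda>x. g x * indicator {a..b} x) = (\<lambda>x. if x \<in> {a..b} then g x else 0)"
      by (auto simp: fun_eq_iff)
    finally show ?thesis by (simp only: has_integral_restrict_UNIV)
  qed
  define f where "f x = g x - (B + 1)" for x
  have f_int: "(f has_integral (u b - u a)) {a..b}" if ab: "a \<le> b" for a b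
  proof -
    have "((\<lambda>x. g x - (B + 1)) has_integral (F b - F a - (B + 1) * (b - a))) {a..b}"
      using has_integral_diff[OF g_int[OF ab] has_integral_const_real[of "B + 1" a b]] ab
      by (simp add: mult.commute)
    then show ?thesis by (simp add: F_def f_def[abs_def] algebra_simps)
  qed
  have f_on: "f integrable_on cbox a b" for a b
    by (cases "a \<le> b") (use f_int in \<open>auto simp: integrable_on_def\<close>)
  obtain Z where Z: "negligible Z"
    "\<And>x e. \<lbrakk>x \<notin> Z; 0 < e\<rbrakk> \<Longrightarrow> \<exists>d>0. \<forall>h. 0 < h \<and> h < d \<longrightarrow>
        norm (integral (cbox x (x + h *\<^sub>R One)) f /\<^sub>R h ^ DIM(real) - f x) < e"
    by (rule integrable_ccontinuous_explicit[OF f_on]) (rule that)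
  show thesis
  proof (rule that[OF Z(1) f_int])
    fix t assume "t \<notin> Z"
    show "((\<lambda>s. (u s - u t) / (s - t)) \<longlongrightarrow> f t) (at_right t)"
    proof (rule tendstoI)
      fix e :: real assume "0 < e"
      from Z(2)[OF \<open>t \<notin> Z\<close> this] obtain d where d: "d > 0"
        "\<And>h. 0 < h \<Longrightarrow> h < d \<Longrightarrow> norm (integral (cbox t (t + h *\<^sub>R One)) f /\<^sub>R h ^ DIM(real) - f t) < e"
        by blast
      have "dist ((u s - u t) / (s - t)) (f t) < e" if "t < s" "s < t + d" for s
      proof -
        have "integral {t..s} f = u s - u t" using f_int[of t s] that by (simp add: integral_unique)
        then show ?thesis using d(2)[of "s - t"] that
          by (simp add: dist_real_def divide_inverse mult.commute)
      qed
      then show "\<forall>\<^sub>F s in at_right t. dist ((u s - u t) / (s - t)) (f t) < e"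
        using d(1) by (auto simp: eventually_at_right[of t "t + d"] intro!: exI[of _ "t + d"])
    qed
  qed
qed

lemma lipschitz_density_on:
  fixes u :: "real \<Rightarrow> real"
  assumes lip: "\<And>s t. s \<in> {a..b} \<Longrightarrow> t \<in> {a..b} \<Longrightarrow> \<bar>u s - u t\<bar> \<le> B * \<bar>s - t\<bar>" and "a < b"
  obtains f Z where "negligible Z"
    "\<And>t. t \<in> {a..b} \<Longrightarrow> (f has_integral (u t - u a)) {a..t}"
    "\<And>t. t \<in> {a..<b} - Z \<Longrightarrow> ((\<lambda>s. (u s - u t) / (s - t)) \<longlongrightarrow> f t) (at_right t)"
proof -
  have "0 \<le> B" using lip[of b a] \<open>a < b\<close>
    by (auto dest: order_trans[OF abs_ge_zero] simp: zero_le_mult_iff)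
  let ?p = "\<lambda>t. max a (min b t)"
  have lip': "\<bar>u (?p s) - u (?p t)\<bar> \<le> B * \<bar>s - t\<bar>" for s t
  proof -
    have "\<bar>u (?p s) - u (?p t)\<bar> \<le> B * \<bar>?p s - ?p t\<bar>" using \<open>a < b\<close> by (intro lip) auto
    also have "\<dots> \<le> B * \<bar>s - t\<bar>" using \<open>0 \<le> B\<close> by (intro mult_left_mono) auto
    finally show ?thesis .
  qed
  obtain f Z where Z: "negligible Z"
    and fi: "\<And>c d. c \<le> d \<Longrightarrow> (f has_integral (u (?p d) - u (?p c))) {c..d}"
    and fd: "\<And>t. t \<notin> Z \<Longrightarrow> ((\<lambda>s. (u (?p s) - u (?p t)) / (s - t)) \<longlongrightarrow> f t) (at_right t)"
    by (rule lipschitz_density[of "\<lambda>t. u (?p t)" B, OF lip']) (rule that)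
  show thesis
  proof (rule that[OF Z])
    show "(f has_integral (u t - u a)) {a..t}" if "t \<in> {a..b}" for t
      using fi[of a t] that by (simp add: min_absorb2)
    fix t assume t: "t \<in> {a..<b} - Z"
    have "\<forall>\<^sub>F s in at_right t. (u (?p s) - u (?p t)) / (s - t) = (u s - u t) / (s - t)"
      using t by (auto simp: eventually_at_right[of t b] intro!: exI[of _ b])
    then show "((\<lambda>s. (u s - u t) / (s - t)) \<longlongrightarrow> f t) (at_right t)"
      using fd[of t] t by (auto intro: Lim_transform_eventually)
  qed
qed

lemma continuous_ge_on_Icc:
  fixes f :: "real \<Rightarrow> real"
  assumes cont: "continuous_on {a..b} f" and "a < b"
    and ge: "\<And>t. t \<in> {a..<b} \<Longrightarrow> m \<le> f t" and t: "t \<in> {a..b}"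
  shows "m \<le> f t"
proof -
  let ?S = "{t \<in> {a..b}. m \<le> f t}"
  have "closed ?S"
    by (rule continuous_on_closed_Collect_le[OF continuous_on_const cont closed_atLeastAtMost])
  moreover have "{a..<b} \<subseteq> ?S" using ge by auto
  ultimately have "closure {a..<b} \<subseteq> ?S" by (simp add: closure_minimal)
  then show ?thesis using \<open>a < b\<close> t by auto
qed

text \<open>The maximum principle in the form used below: an upper bound \<open>C\<close> on the right Dini derivative
  is needed only for those members of the family that are maximal at the time in question. A member
  that touches the barrier \<open>m + (C + e) t\<close> for the first time is maximal at that time.\<close>

lemma dini_growth_family:
  fixes a :: "'i \<Rightarrow> real \<Rightarrow> real"
  assumes fin: "finite A"
    and cont: "\<And>k. k \<in> A \<Longrightarrow> continuous_on {0..\<tau>} (a k)"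
    and init: "\<And>k. k \<in> A \<Longrightarrow> a k 0 \<le> m"
    and dini: "\<And>k t e. \<lbrakk>k \<in> A; t \<in> {0..<\<tau>}; \<And>j. j \<in> A \<Longrightarrow> a j t \<le> a k t; 0 < e\<rbrakk>
       \<Longrightarrow> \<forall>\<^sub>F s in at_right t. a k s - a k t \<le> (C + e) * (s - t)"
    and "k \<in> A" "t \<in> {0..\<tau>}"
  shows "a k t \<le> m + C * t"
proof -
  have eps: "a k t \<le> m + (C + e) * t" if e: "0 < e" for e
  proof (rule ccontr)
    assume contr: "\<not> a k t \<le> m + (C + e) * t"
    define bad where "bad = {t \<in> {0..\<tau>}. \<exists>k\<in>A. m + (C + e) * t < a k t}"
    define t1 where "t1 = Inf bad"
    have "t \<in> bad" using contr assms(5,6) by (auto simp: bad_def not_le)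
    have bdd: "bdd_below bad" by (auto simp: bad_def bdd_below_def)
    have "t1 \<le> t" unfolding t1_def by (rule cInf_lower[OF \<open>t \<in> bad\<close> bdd])
    moreover have "0 \<le> t1" unfolding t1_def
      by (rule cInf_greatest) (use \<open>t \<in> bad\<close> in \<open>auto simp: bad_def\<close>)
    ultimately have t1: "0 \<le> t1" "t1 \<le> t" "t1 \<le> \<tau>" using assms(6) by auto
    have below: "a k r \<le> m + (C + e) * r" if "k \<in> A" "0 \<le> r" "r < t1" for k r
    proof (rule ccontr)
      assume "\<not> a k r \<le> m + (C + e) * r"
      then have "r \<in> bad" using that t1 by (auto simp: bad_def not_le)
      then have "t1 \<le> r" unfolding t1_def by (rule cInf_lower[OF _ bdd])
      then show False using that by simp
    qed
    have good: "a k t1 \<le> m + (C + e) * t1" if k: "k \<in> A" for k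
    proof (cases "t1 = 0")
      case True then show ?thesis using init[OF k] by simp
    next
      case False
      have "continuous_on {0..t1} (\<lambda>r. m + (C + e) * r - a k r)"
        using t1 by (intro continuous_intros continuous_on_subset[OF cont[OF k]]) auto
      then have "0 \<le> m + (C + e) * t1 - a k t1"
        by (rule continuous_ge_on_Icc) (use below[OF k] False t1 in auto)
      then show ?thesis by simp
    qed
    have "t1 \<noteq> \<tau>"
    proof
      assume "t1 = \<tau>"
      then have "t = t1" using t1 assms(6) by auto
      then show False using good[OF assms(5)] contr by simp
    qed
    then have t1_less: "t1 < \<tau>" using t1 by simp
    have "\<forall>\<^sub>F s in at_right t1. \<forall>k\<in>A. a k s \<le> m + (C + e) * s"
    proof (rule eventually_ball_finite[OF fin], rule ballI)
      fix k assume k: "k \<in> A"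
      show "\<forall>\<^sub>F s in at_right t1. a k s \<le> m + (C + e) * s"
      proof (cases "a k t1 = m + (C + e) * t1")
        case True
        then have "\<forall>\<^sub>F s in at_right t1. a k s - a k t1 \<le> (C + e) * (s - t1)"
        proof (intro dini[OF k _ _ e])
          show "t1 \<in> {0..<\<tau>}" using t1 t1_less by simp
          show "a j t1 \<le> a k t1" if "j \<in> A" for j using good[OF that] True by simp
        qed
        then show ?thesis by (rule eventually_mono) (simp add: True algebra_simps)
      next
        case False
        have "continuous_on {t1..\<tau>} (\<lambda>s. m + (C + e) * s - a k s)"
          using t1 by (intro continuous_intros continuous_on_subset[OF cont[OF k]]) auto
        then have "((\<lambda>s. m + (C + e) * s - a k s) \<longlongrightarrow> m + (C + e) * t1 - a k t1) (at t1 within {t1..\<tau>})"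
          using t1_less by (auto simp: continuous_on_def)
        then have "((\<lambda>s. m + (C + e) * s - a k s) \<longlongrightarrow> m + (C + e) * t1 - a k t1) (at_right t1)"
          using t1_less by (simp add: at_within_Icc_at_right)
        moreover have "0 < m + (C + e) * t1 - a k t1" using good[OF k] False by simp
        ultimately have "\<forall>\<^sub>F s in at_right t1. 0 < m + (C + e) * s - a k s"
          by (rule order_tendstoD)
        then show ?thesis by (rule eventually_mono) simp
      qed
    qed
    then obtain b where b: "b > t1" "\<And>s. t1 < s \<Longrightarrow> s < b \<Longrightarrow> \<forall>k\<in>A. a k s \<le> m + (C + e) * s"
      unfolding eventually_at_right[OF t1_less] by blast
    have "r \<notin> bad" if "r < b" for r
    proof
      assume "r \<in> bad"
      then obtain k where k: "k \<in> A" "m + (C + e) * r < a k r" and "0 \<le> r" by (auto simp: bad_def)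
      then show False
        using below[of k r] good[of k] b(2)[of r] \<open>r < b\<close>
        by (cases r t1 rule: linorder_cases) auto
    qed
    then have "b \<le> t1" unfolding t1_def
      using \<open>t \<in> bad\<close> by (intro cInf_greatest) (auto simp: not_less[symmetric])
    then show False using b(1) by simp
  qed
  show ?thesis
  proof (rule field_le_epsilon)
    fix e :: real assume "0 < e"
    have t0: "0 \<le> t" using assms(6) by simp
    have "e / (t + 1) * t \<le> e" using \<open>0 < e\<close> t0 by (simp add: field_simps)
    then show "a k t \<le> m + C * t + e"
      using eps[of "e / (t + 1)"] \<open>0 < e\<close> t0 by (simp add: algebra_simps)
  qed
qed

lemma eventually_at_right_shift:
  "(\<forall>\<^sub>F s in at_right (t - d). P s) \<longleftrightarrow> (\<forall>\<^sub>F s in at_right (t::real). P (s - d))"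
  by (simp add: filtermap_at_right_shift[symmetric] eventually_filtermap)

lemma dini_increment_le:
  fixes u :: "real \<Rightarrow> real"
  assumes cont: "continuous_on {a..b} u"
    and dini: "\<And>t e. t \<in> {a..<b} \<Longrightarrow> 0 < e \<Longrightarrow> \<forall>\<^sub>F s in at_right t. u s - u t \<le> (C + e) * (s - t)"
    and st: "a \<le> s" "s \<le> t" "t \<le> b"
  shows "u t - u s \<le> C * (t - s)"
proof -
  have "u ((t - s) + s) \<le> u s + C * (t - s)"
  proof (rule dini_growth_family[of "{()}" "t - s" "\<lambda>_ r. u (r + s)"])
    show "continuous_on {0..t - s} (\<lambda>r. u (r + s))"
      using st by (intro continuous_on_compose2[OF cont] continuous_intros) auto
    fix r e :: real assume r: "r \<in> {0..<t - s}" and e: "0 < e"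
    have "\<forall>\<^sub>F q in at_right (r + s). u q - u (r + s) \<le> (C + e) * (q - (r + s))"
      using r st e by (intro dini) auto
    then have "\<forall>\<^sub>F q in at_right (r + s). u ((q - s) + s) - u (r + s) \<le> (C + e) * ((q - s) - r)"
      by (simp add: algebra_simps)
    then show "\<forall>\<^sub>F q in at_right r. u (q + s) - u (r + s) \<le> (C + e) * (q - r)"
      using eventually_at_right_shift[where t = "r + s" and d = s
          and P = "\<lambda>q. u (q + s) - u (r + s) \<le> (C + e) * (q - r)"] by simp
  qed (use st in auto)
  then show ?thesis by simp
qed

lemma indefinite_integral_increment:
  fixes f :: "real \<Rightarrow> real"
  assumes int: "\<And>t. t \<in> {0..b} \<Longrightarrow> (f has_integral (u t - u 0)) {0..t}"
    and st: "0 \<le> s" "s \<le> t" "t \<le> b"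
  shows "(f has_integral (u t - u s)) {s..t}"
proof -
  have t: "(f has_integral (u t - u 0)) {0..t}" and s: "(f has_integral (u s - u 0)) {0..s}"
    using int st by auto
  have "f integrable_on {s..t}"
    using st by (intro integrable_subinterval_real[OF has_integral_integrable[OF t]]) auto
  then obtain i where i: "(f has_integral i) {s..t}" by (auto simp: integrable_on_def)
  have "(f has_integral (u s - u 0 + i)) {0..t}" using has_integral_combine[OF st(1,2) s i] .
  from has_integral_unique[OF t this] have "u t - u 0 = u s - u 0 + i" .
  then show ?thesis using i by simp
qed

text \<open>A chain rule for difference quotients: \<open>u\<close> need not be differentiable at \<open>t\<close>, but
  composing with \<open>F\<close> multiplies its increments by \<open>D\<close> up to \<open>o(s - t)\<close>.\<close>

lemma derivative_increment:
  fixes F u :: "real \<Rightarrow> real"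
  assumes F: "(F has_real_derivative D) (at (u t))"
    and u: "\<forall>\<^sub>F s in at_right t. \<bar>u s - u t\<bar> \<le> R * (s - t)" and e: "0 < e"
  shows "\<forall>\<^sub>F s in at_right t. \<bar>F (u s) - F (u t) - D * (u s - u t)\<bar> \<le> e * (s - t)"
proof -
  define R' where "R' = max 1 R"
  define r where "r = e / R'"
  have R': "0 < R'" "R \<le> R'" and r: "0 < r" "r * R' = e"
    using e by (simp_all add: R'_def r_def)
  have "(F has_derivative (*) D) (at (u t))" using F by (simp add: has_field_derivative_def)
  then obtain d where d: "0 < d"
    "\<And>y. \<bar>y - u t\<bar> < d \<Longrightarrow> \<bar>F y - F (u t) - D * (y - u t)\<bar> \<le> r * \<bar>y - u t\<bar>"
    using r(1) unfolding has_derivative_at_alt by (auto simp: real_norm_def)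
  have "\<forall>\<^sub>F s in at_right t. s < t + d / R'"
    using d(1) R'(1) by (auto simp: eventually_at_right[of t "t + d / R'"] intro!: exI[of _ "t + d / R'"])
  moreover have "\<forall>\<^sub>F s in at_right t. t < s" by (simp add: eventually_at_right_less)
  ultimately show ?thesis using u
  proof eventually_elim
    case (elim s)
    have "R * (s - t) \<le> R' * (s - t)" using elim R' by (intro mult_right_mono) auto
    then have *: "\<bar>u s - u t\<bar> \<le> R' * (s - t)" using elim by linarith
    also have "\<dots> < d" using elim R' by (simp add: field_simps)
    finally have "\<bar>F (u s) - F (u t) - D * (u s - u t)\<bar> \<le> r * \<bar>u s - u t\<bar>" by (rule d(2))
    also have "\<dots> \<le> r * (R' * (s - t))" using * r by (intro mult_left_mono) auto
    finally show ?case using r(2) by (simp add: mult.assoc[symmetric])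
  qed
qed

section \<open>Euler schemes for bounded discontinuous fields\<close>

text \<open>Only the first \<open>N\<close> coordinates of a configuration matter, so neighbourhoods in the product
  topology of all sequences would be too small.\<close>

definition near :: "nat \<Rightarrow> (nat \<Rightarrow> real) \<Rightarrow> (nat \<Rightarrow> real) filter" where
  "near N x = (INF d\<in>{0<..}. principal {y. \<forall>i<N. \<bar>y i - x i\<bar> < d})"

lemma eventually_near:
  "eventually P (near N x) \<longleftrightarrow> (\<exists>d>0. \<forall>y. (\<forall>i<N. \<bar>y i - x i\<bar> < d) \<longrightarrow> P y)"
proof -
  have "eventually P (near N x) \<longleftrightarrow>
     (\<exists>d\<in>{0<..}. eventually P (principal {y. \<forall>i<N. \<bar>y i - x i\<bar> < d}))"
    unfolding near_def
  proof (rule eventually_INF_base)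
    show "\<exists>c\<in>{0<..}. principal {y. \<forall>i<N. \<bar>y i - x i\<bar> < c}
          \<le> inf (principal {y. \<forall>i<N. \<bar>y i - x i\<bar> < a}) (principal {y. \<forall>i<N. \<bar>y i - x i\<bar> < b})"
      if "a \<in> {0<..}" "b \<in> {0<..}" for a b :: real
      using that by (intro bexI[of _ "min a b"]) auto
  qed auto
  then show ?thesis by (auto simp: eventually_principal)
qed

lemma tendsto_near: "i < N \<Longrightarrow> ((\<lambda>y. y i) \<longlongrightarrow> x i) (near N x)"
  by (auto simp: tendsto_iff eventually_near dist_real_def)

lemma filterlim_near:
  assumes "\<And>i. i < N \<Longrightarrow> ((\<lambda>s. X s i) \<longlongrightarrow> x i) F"
  shows "filterlim X (near N x) F"
  unfolding filterlim_iff
proof (intro allI impI)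
  fix P assume "eventually P (near N x)"
  then obtain d where d: "d > 0" "\<And>y. (\<forall>i<N. \<bar>y i - x i\<bar> < d) \<Longrightarrow> P y"
    by (auto simp: eventually_near)
  have "\<forall>\<^sub>F s in F. \<forall>i\<in>{..<N}. \<bar>X s i - x i\<bar> < d"
    using assms d(1) by (intro eventually_ball_finite) (auto simp: tendsto_iff dist_real_def)
  then show "\<forall>\<^sub>F s in F. P (X s)"
    by (rule eventually_mono) (auto intro: d(2))
qed

text \<open>By Tychonoff's theorem; a filter replaces the subsequence, which need not exist on an
  uncountable index set.\<close>

lemma pointwise_cluster:
  fixes g :: "nat \<Rightarrow> 'a \<Rightarrow> real"
  assumes bd: "\<And>n p. \<bar>g n p\<bar> \<le> b p"
  obtains F x where "F \<noteq> bot" "F \<le> sequentially" "\<And>p. ((\<lambda>n. g n p) \<longlongrightarrow> x p) F"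
proof -
  let ?S = "PiE UNIV (\<lambda>p. {- b p..b p})"
  have "compactin (product_topology (\<lambda>i. euclidean) UNIV) ?S"
    by (subst compactin_PiE) auto
  then have "compact ?S" by (simp add: euclidean_product_topology)
  moreover have "eventually (\<lambda>y. y \<in> ?S) (filtermap g sequentially)"
    using bd by (auto simp: eventually_filtermap abs_le_iff minus_le_iff intro!: always_eventually)
  moreover have "filtermap g sequentially \<noteq> bot" by (simp add: filtermap_bot_iff)
  ultimately obtain x where x: "inf (nhds x) (filtermap g sequentially) \<noteq> bot"
    unfolding compact_filter by blast
  define F where "F = inf sequentially (filtercomap g (nhds x))"
  have lim: "filterlim g (nhds x) F"
    by (simp add: F_def filterlim_iff eventually_inf)
       (metis eventually_filtercomapI eventually_True)
  have "F \<noteq> bot"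
  proof
    assume "F = bot"
    then have "eventually (\<lambda>_. False) F" by simp
    then obtain P Q R where "eventually P sequentially" "eventually R (nhds x)"
      "\<And>n. R (g n) \<Longrightarrow> Q n" "\<And>n. \<not> (P n \<and> Q n)"
      by (auto simp: F_def eventually_inf eventually_filtercomap)
    then have "eventually (\<lambda>y. R y) (nhds x)" "eventually (\<lambda>y. \<not> R y) (filtermap g sequentially)"
      by (auto simp: eventually_filtermap elim!: eventually_mono)
    then have "eventually (\<lambda>_. False) (inf (nhds x) (filtermap g sequentially))"
      unfolding eventually_inf by blast
    then show False using x by (simp add: trivial_limit_def)
  qed
  moreover have "F \<le> sequentially" by (simp add: F_def)
  moreover have "((\<lambda>n. g n p) \<longlongrightarrow> x p) F" for p
  proof -
    have "\<forall>\<^sub>F y in nhds x. y p \<in> U" if "open U" "x p \<in> U" for U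
      using open_vimage[OF that(1) continuous_on_product_coordinates[of p]] that(2)
      by (auto simp: eventually_nhds intro!: exI[of _ "(\<lambda>y. y p) -` U"])
    then show ?thesis
      unfolding tendsto_def using eventually_compose_filterlim[OF _ lim] by blast
  qed
  ultimately show thesis by (rule that)
qed

text \<open>Without any continuity of \<open>f\<close>, a limit of Euler schemes still inherits every bound \<open>a \<le> f \<le> b\<close>
  that holds near the current position: each scheme stays near it for a short time, and
  over that time its increment is a sum of steps between \<open>a h\<close> and \<open>b h\<close>. The schemes are kept
  piecewise constant in time, which costs only an error of one step.\<close>

lemma euler_limit:
  fixes f :: "(nat \<Rightarrow> real) \<Rightarrow> nat \<Rightarrow> real"
  assumes B: "\<And>y k. \<bar>f y k\<bar> \<le> B"
  obtains X :: "nat \<Rightarrow> real \<Rightarrow> real" where "\<And>k. X k 0 = x0 k"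
    "\<And>k s t. 0 \<le> s \<Longrightarrow> 0 \<le> t \<Longrightarrow> \<bar>X k s - X k t\<bar> \<le> B * \<bar>s - t\<bar>"
    "\<And>k t a b. \<lbrakk>0 \<le> t; \<forall>\<^sub>F y in near N (\<lambda>i. X i t). a \<le> f y k \<and> f y k \<le> b\<rbrakk> \<Longrightarrow>
       \<forall>\<^sub>F s in at_right t. a * (s - t) \<le> X k s - X k t \<and> X k s - X k t \<le> b * (s - t)"
proof -
  have B0: "0 \<le> B" using B[of undefined undefined] by linarith
  define h :: "nat \<Rightarrow> real" where "h n = 1 / real (Suc n)" for n
  have h0: "0 < h n" "h n \<le> 1" for n by (simp_all add: h_def)
  define y where "y n = rec_nat x0 (\<lambda>_ z k. z k + h n * f z k)" for n
  have y0: "y n 0 = x0" and ySuc: "y n (Suc i) k = y n i k + h n * f (y n i) k" for n i k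
    by (simp_all add: y_def)
  define idx where "idx n t = nat \<lfloor>t / h n\<rfloor>" for n t
  define g where "g n = (\<lambda>(k, t). y n (idx n t) k)" for n
  have y_diff: "y n (i + m) k - y n i k = h n * (\<Sum>l<m. f (y n (i + l)) k)" for n i m k
    by (induction m) (simp_all add: ySuc algebra_simps)
  have y_lip: "\<bar>y n (i + m) k - y n i k\<bar> \<le> B * (real m * h n)" for n i m k
  proof -
    have "\<bar>\<Sum>l<m. f (y n (i + l)) k\<bar> \<le> (\<Sum>l<m. B)"
      using B by (intro order_trans[OF sum_abs] sum_mono)
    then have "h n * \<bar>\<Sum>l<m. f (y n (i + l)) k\<bar> \<le> h n * (\<Sum>l<m. B)"
      using h0(1)[of n] by (intro mult_left_mono) auto
    then show ?thesis using h0(1)[of n] by (simp add: y_diff abs_mult mult_ac)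
  qed
  have idx: "idx n t \<le> idx n s" "\<bar>real (idx n s - idx n t) * h n - (s - t)\<bar> \<le> h n"
    if "0 \<le> t" "t \<le> s" for n s t
  proof -
    have fl: "\<lfloor>t / h n\<rfloor> \<le> \<lfloor>s / h n\<rfloor>" "0 \<le> \<lfloor>t / h n\<rfloor>"
      using that h0[of n] by (auto intro!: floor_mono divide_right_mono)
    then show le: "idx n t \<le> idx n s" by (auto simp: idx_def)
    have e: "real (idx n s - idx n t) = of_int \<lfloor>s / h n\<rfloor> - of_int \<lfloor>t / h n\<rfloor>"
      using fl le by (simp add: of_nat_diff idx_def del: zero_le_floor)
    have "\<bar>real (idx n s - idx n t) - (s / h n - t / h n)\<bar> \<le> 1"
      unfolding e by linarith
    then have "\<bar>real (idx n s - idx n t) - (s / h n - t / h n)\<bar> * h n \<le> 1 * h n"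
      using h0[of n] by (intro mult_right_mono) auto
    also have "\<bar>real (idx n s - idx n t) - (s / h n - t / h n)\<bar> * h n
       = \<bar>(real (idx n s - idx n t) - (s / h n - t / h n)) * h n\<bar>"
      using h0[of n] by (simp add: abs_mult)
    also have "(real (idx n s - idx n t) - (s / h n - t / h n)) * h n
       = real (idx n s - idx n t) * h n - (s - t)"
      using h0[of n] by (simp add: field_simps)
    finally show "\<bar>real (idx n s - idx n t) * h n - (s - t)\<bar> \<le> h n" by simp
  qed
  have g_lip: "\<bar>g n (k, s) - g n (k, t)\<bar> \<le> B * (s - t + h n)" if "0 \<le> t" "t \<le> s" for n k s t
  proof -
    have "\<bar>y n (idx n t + (idx n s - idx n t)) k - y n (idx n t) k\<bar>
        \<le> B * (real (idx n s - idx n t) * h n)" by (rule y_lip)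
    also have "\<dots> \<le> B * (s - t + h n)"
      using idx(2)[OF that, of n] B0 by (intro mult_left_mono) auto
    finally show ?thesis using idx(1)[OF that, of n] by (simp add: g_def)
  qed
  have g0: "g n (k, t) = x0 k" if "t \<le> 0" for n k t
  proof -
    have "t / h n \<le> 0" using that h0[of n] by (simp add: divide_nonpos_pos)
    then show ?thesis by (simp add: g_def idx_def y0)
  qed
  have "\<bar>g n p\<bar> \<le> \<bar>x0 (fst p)\<bar> + B * (\<bar>snd p\<bar> + 1)" for n p
  proof (cases p)
    case (Pair k t)
    show ?thesis
    proof (cases "0 \<le> t")
      case True
      have "B * (t + h n) \<le> B * (t + 1)" using B0 h0[of n] by (intro mult_left_mono) auto
      then show ?thesis using g_lip[of 0 t n k] True g0[of 0 n k] Pair by simp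
    next
      case False
      then show ?thesis using g0[of t n k] B0 Pair by simp
    qed
  qed
  then obtain F x where F: "F \<noteq> bot" "F \<le> sequentially" "\<And>p. ((\<lambda>n. g n p) \<longlongrightarrow> x p) F"
    using pointwise_cluster[of g "\<lambda>p. \<bar>x0 (fst p)\<bar> + B * (\<bar>snd p\<bar> + 1)"] by blast
  define X where "X k t = x (k, t)" for k t
  have gX: "((\<lambda>n. g n (k, t)) \<longlongrightarrow> X k t) F" for k t using F(3) by (simp add: X_def)
  have "h \<longlonglongrightarrow> 0" unfolding h_def using LIMSEQ_inverse_real_of_nat by (simp add: inverse_eq_divide)
  then have hF: "(h \<longlongrightarrow> 0) F" by (rule tendsto_mono[OF F(2)])
  show thesis
  proof (rule that[of X])
    show "X k 0 = x0 k" for k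
    proof -
      have "((\<lambda>n. x0 k) \<longlongrightarrow> X k 0) F" using gX[of k 0] by (simp add: g0)
      then show ?thesis using tendsto_unique[OF F(1) _ tendsto_const] by blast
    qed
    have lip: "\<bar>X k s - X k t\<bar> \<le> B * (s - t)" if "0 \<le> t" "t \<le> s" for k s t
    proof (rule tendsto_le[OF F(1)])
      show "((\<lambda>n. B * (s - t + h n)) \<longlongrightarrow> B * (s - t)) F"
        by (rule tendsto_eq_intros hF refl | simp)+
      show "((\<lambda>n. \<bar>g n (k, s) - g n (k, t)\<bar>) \<longlongrightarrow> \<bar>X k s - X k t\<bar>) F"
        by (intro tendsto_intros gX)
      show "\<forall>\<^sub>F n in F. \<bar>g n (k, s) - g n (k, t)\<bar> \<le> B * (s - t + h n)"
        using g_lip[OF that] by (intro always_eventually) auto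
    qed
    show "\<bar>X k s - X k t\<bar> \<le> B * \<bar>s - t\<bar>" if "0 \<le> s" "0 \<le> t" for k s t
      using lip[of t s k] lip[of s t k] that by (cases "t \<le> s") (auto simp: abs_minus_commute)
    fix k t a b
    assume t: "0 \<le> t" and ev: "\<forall>\<^sub>F y in near N (\<lambda>i. X i t). a \<le> f y k \<and> f y k \<le> b"
    then obtain d where d: "d > 0" "\<And>y. (\<forall>i<N. \<bar>y i - X i t\<bar> < d) \<Longrightarrow> a \<le> f y k \<and> f y k \<le> b"
      by (auto simp: eventually_near)
    define r where "r = d / (4 * (B + 1))"
    have r: "0 < r" "B * (2 * r) < d / 2 + 0" using d(1) B0 by (simp_all add: r_def field_simps)
    have "a * (s - t) \<le> X k s - X k t \<and> X k s - X k t \<le> b * (s - t)" if s: "t < s" "s < t + r" for s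
    proof -
      have "\<forall>\<^sub>F n in F. (\<forall>i\<in>{..<N}. \<bar>g n (i, t) - X i t\<bar> < d / 2) \<and> h n < r"
        using d(1) r(1) tendstoD[OF gX, of "d / 2"] order_tendstoD(2)[OF hF]
        by (intro eventually_conj eventually_ball_finite) (auto simp: dist_real_def)
      then have ev: "\<forall>\<^sub>F n in F. a * (s - t) - \<bar>a\<bar> * h n \<le> g n (k, s) - g n (k, t) \<and>
          g n (k, s) - g n (k, t) \<le> b * (s - t) + \<bar>b\<bar> * h n"
      proof (rule eventually_mono)
        fix n assume n: "(\<forall>i\<in>{..<N}. \<bar>g n (i, t) - X i t\<bar> < d / 2) \<and> h n < r"
        define m where "m = idx n s - idx n t"
        have m: "idx n s = idx n t + m" "\<bar>real m * h n - (s - t)\<bar> \<le> h n"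
          using idx[of t s n] t s by (auto simp: m_def)
        have f_bd: "a \<le> f (y n (idx n t + l)) k \<and> f (y n (idx n t + l)) k \<le> b" if "l < m" for l
        proof (rule d(2), intro allI impI)
          fix i assume i: "i < N"
          have "\<bar>y n (idx n t + l) i - y n (idx n t) i\<bar> \<le> B * (real l * h n)" by (rule y_lip)
          also have "\<dots> \<le> B * (2 * r)"
          proof (rule mult_left_mono[OF _ B0])
            have "real l * h n \<le> real m * h n" using that h0[of n] by (intro mult_right_mono) auto
            then show "real l * h n \<le> 2 * r" using m(2) s n by linarith
          qed
          finally have "\<bar>y n (idx n t + l) i - y n (idx n t) i\<bar> < d / 2" using r(2) by simp
          moreover have "\<bar>y n (idx n t) i - X i t\<bar> < d / 2" using n i by (auto simp: g_def)
          ultimately show "\<bar>y n (idx n t + l) i - X i t\<bar> < d" by linarith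
        qed
        have e: "g n (k, s) - g n (k, t) = h n * (\<Sum>l<m. f (y n (idx n t + l)) k)"
          using y_diff[of n "idx n t" m k] m(1) by (simp add: g_def)
        have "(\<Sum>l<m. a) \<le> (\<Sum>l<m. f (y n (idx n t + l)) k)" "(\<Sum>l<m. f (y n (idx n t + l)) k) \<le> (\<Sum>l<m. b)"
          using f_bd by (blast intro: sum_mono)+
        then have le: "h n * (real m * a) \<le> g n (k, s) - g n (k, t)" "g n (k, s) - g n (k, t) \<le> h n * (real m * b)"
          unfolding e using h0(1)[of n] by (auto intro!: mult_left_mono)
        have "\<bar>c * (real m * h n - (s - t))\<bar> \<le> \<bar>c\<bar> * h n" for c
          using m(2) by (simp add: abs_mult mult_left_mono)
        from this[of a] this[of b]
        show "a * (s - t) - \<bar>a\<bar> * h n \<le> g n (k, s) - g n (k, t) \<and>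
          g n (k, s) - g n (k, t) \<le> b * (s - t) + \<bar>b\<bar> * h n"
          using le by (auto simp: abs_le_iff algebra_simps)
      qed
      have lims: "((\<lambda>n. a * (s - t) - \<bar>a\<bar> * h n) \<longlongrightarrow> a * (s - t)) F"
        "((\<lambda>n. b * (s - t) + \<bar>b\<bar> * h n) \<longlongrightarrow> b * (s - t)) F"
        "((\<lambda>n. g n (k, s) - g n (k, t)) \<longlongrightarrow> X k s - X k t) F"
        by (rule tendsto_eq_intros hF gX refl | simp)+
      show ?thesis
      proof
        show "a * (s - t) \<le> X k s - X k t"
          by (rule tendsto_le[OF F(1) lims(3,1)]) (use ev in \<open>auto elim: eventually_mono\<close>)
        show "X k s - X k t \<le> b * (s - t)"
          by (rule tendsto_le[OF F(1) lims(2,3)]) (use ev in \<open>auto elim: eventually_mono\<close>)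
      qed
    qed
    then show "\<forall>\<^sub>F s in at_right t. a * (s - t) \<le> X k s - X k t \<and> X k s - X k t \<le> b * (s - t)"
      using r(1) by (auto simp: eventually_at_right[of t "t + r"] intro!: exI[of _ "t + r"])
  qed
qed

section \<open>Kernel, mobility and diffusion\<close>

text \<open>An open set on which a continuous function exceeds its essential bound has measure zero, hence
  is empty.\<close>

lemma bounded_of_Linf_off_zero:
  fixes f :: "real \<Rightarrow> real"
  assumes cont: "continuous_on (- {0}) f"
    and ae: "AE x in lebesgue. x \<noteq> 0 \<longrightarrow> \<bar>f x\<bar> \<le> b" and "z \<noteq> 0"
  shows "\<bar>f z\<bar> \<le> b"
proof (rule ccontr)
  assume "\<not> \<bar>f z\<bar> \<le> b"
  define U where "U = {x \<in> - {0}. b < \<bar>f x\<bar>}"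
  have "continuous_on (- {0}) (\<lambda>x. \<bar>f x\<bar>)" by (intro continuous_intros cont)
  then have "open ((- {0}) \<inter> (\<lambda>x. \<bar>f x\<bar>) -` {b<..})"
    by (intro continuous_open_preimage) auto
  also have "(- {0}) \<inter> (\<lambda>x. \<bar>f x\<bar>) -` {b<..} = U" by (auto simp: U_def)
  finally have "open U" .
  moreover have "z \<in> U" using \<open>z \<noteq> 0\<close> \<open>\<not> \<bar>f z\<bar> \<le> b\<close> by (auto simp: U_def)
  ultimately have "\<not> negligible U" using open_not_negligible by blast
  moreover have "negligible U"
  proof -
    from ae obtain N where N: "{x \<in> space lebesgue. \<not> (x \<noteq> 0 \<longrightarrow> \<bar>f x\<bar> \<le> b)} \<subseteq> N" "N \<in> null_sets lebesgue"
      by (auto simp: eventually_ae_filter)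
    then have "U \<subseteq> N" by (auto simp: U_def)
    then show ?thesis using N(2) negligible_iff_null_sets negligible_subset by blast
  qed
  ultimately show False by simp
qed

lemma Linf_bound_AE:
  assumes "Linf M f"
  obtains b where "0 \<le> b" "AE x in M. \<bar>f x\<bar> \<le> b"
proof -
  have ae: "AE x in M. ereal \<bar>f x\<bar> \<le> Linf_norm M f" unfolding Linf_norm_def by (rule esssup_AE)
  have "Linf_norm M f < \<infinity>" using assms by (simp add: Linf_def)
  then obtain b where "Linf_norm M f \<le> ereal b" by (cases "Linf_norm M f") auto
  then have "AE x in M. \<bar>f x\<bar> \<le> max 0 b"
    using ae by (elim eventually_mono) (metis ereal_less_eq(3) max.coboundedI2 order_trans)
  then show thesis by (rule that[of "max 0 b", rotated]) simp
qed

text \<open>Any bound for \<open>K'\<close> and \<open>K''\<close> away from the origin; it must be a function of \<open>K\<close> alone since the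
  final constant is.\<close>

definition kernel_bound :: "(real \<Rightarrow> real) \<Rightarrow> real" where
  "kernel_bound K =
     (SOME B. 0 \<le> B \<and> (\<forall>z. z \<noteq> 0 \<longrightarrow> \<bar>deriv K z\<bar> \<le> B \<and> \<bar>deriv (deriv K) z\<bar> \<le> B))"

lemma kernel_bound:
  assumes K: "admissible_kernel K"
  shows "0 \<le> kernel_bound K" "z \<noteq> 0 \<Longrightarrow> \<bar>deriv K z\<bar> \<le> kernel_bound K"
    "z \<noteq> 0 \<Longrightarrow> \<bar>deriv (deriv K) z\<bar> \<le> kernel_bound K"
proof -
  have diff: "deriv K differentiable (at z)" if "z \<noteq> 0" for z
    using K that by (auto simp: admissible_kernel_def)
  have c1: "continuous_on (- {0}) (deriv K)"
    using diff by (intro continuous_at_imp_continuous_on) (auto intro: differentiable_imp_continuous_within)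
  have c2: "continuous_on (- {0}) (deriv (deriv K))"
    and l1: "Linf lebesgue (deriv K)" and l2: "Linf (lebesgue_on (- {0})) (deriv (deriv K))"
    using K by (auto simp: admissible_kernel_def)
  from l1 obtain b1 where b1: "0 \<le> b1" "AE x in lebesgue. \<bar>deriv K x\<bar> \<le> b1" by (rule Linf_bound_AE)
  from l2 obtain b2 where b2: "0 \<le> b2" "AE x in lebesgue_on (- {0}). \<bar>deriv (deriv K) x\<bar> \<le> b2"
    by (rule Linf_bound_AE)
  have "\<bar>deriv K z\<bar> \<le> b1" if "z \<noteq> 0" for z
    by (rule bounded_of_Linf_off_zero[OF c1 _ that]) (use b1(2) in \<open>auto elim: eventually_mono\<close>)
  moreover have "\<bar>deriv (deriv K) z\<bar> \<le> b2" if "z \<noteq> 0" for z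
    by (rule bounded_of_Linf_off_zero[OF c2 _ that])
       (use b2(2) in \<open>simp add: AE_restrict_space_iff\<close>)
  ultimately have "\<exists>B. 0 \<le> B \<and> (\<forall>z. z \<noteq> 0 \<longrightarrow> \<bar>deriv K z\<bar> \<le> B \<and> \<bar>deriv (deriv K) z\<bar> \<le> B)"
    using b1(1) by (intro exI[of _ "max b1 b2"]) (auto simp: le_max_iff_disj)
  then have "0 \<le> kernel_bound K \<and> (\<forall>z. z \<noteq> 0 \<longrightarrow> \<bar>deriv K z\<bar> \<le> kernel_bound K \<and> \<bar>deriv (deriv K) z\<bar> \<le> kernel_bound K)"
    unfolding kernel_bound_def by (rule someI_ex)
  then show "0 \<le> kernel_bound K" "z \<noteq> 0 \<Longrightarrow> \<bar>deriv K z\<bar> \<le> kernel_bound K"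
    "z \<noteq> 0 \<Longrightarrow> \<bar>deriv (deriv K) z\<bar> \<le> kernel_bound K" by auto
qed

lemma deriv_kernel_continuous:
  assumes "admissible_kernel K" "z \<noteq> 0"
  shows "isCont (deriv K) z"
  using assms by (auto simp: admissible_kernel_def intro: differentiable_imp_continuous_within)

lemma deriv_kernel_lipschitz:
  assumes K: "admissible_kernel K" and ab: "0 < a \<or> b < 0" "a \<le> b"
  shows "\<bar>deriv K b - deriv K a\<bar> \<le> kernel_bound K * (b - a)"
proof (cases "a = b")
  case False
  then have "a < b" using ab by simp
  then obtain z where z: "a < z" "z < b" "deriv K b - deriv K a = (b - a) * deriv (deriv K) z"
  proof (rule MVT2[of a b "deriv K" "deriv (deriv K)", THEN exE])
    fix x assume "a \<le> x" "x \<le> b"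
    then have "x \<noteq> 0" using ab by auto
    then have "deriv K differentiable (at x)" using K by (auto simp: admissible_kernel_def)
    then show "(deriv K has_real_derivative deriv (deriv K) x) (at x)"
      by (simp add: DERIV_deriv_iff_real_differentiable)
  qed auto
  have "\<bar>deriv (deriv K) z\<bar> \<le> kernel_bound K" using kernel_bound(3)[OF K] z ab by auto
  then show ?thesis using z ab by (simp add: abs_mult mult.commute mult_left_mono)
qed simp

lemma torus_rep_range: "L > 0 \<Longrightarrow> - L / 2 \<le> torus_rep L z" "L > 0 \<Longrightarrow> torus_rep L z < L / 2"
proof -
  assume L: "L > 0"
  have "of_int \<lfloor>z / L + 1/2\<rfloor> \<le> z / L + 1/2" "z / L + 1/2 < of_int \<lfloor>z / L + 1/2\<rfloor> + 1" by linarith+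
  then have "of_int \<lfloor>z / L + 1/2\<rfloor> * L \<le> (z / L + 1/2) * L" "(z / L + 1/2) * L < (of_int \<lfloor>z / L + 1/2\<rfloor> + 1) * L"
    using L by simp_all
  moreover have "(z / L + 1/2) * L = z + L / 2" using L by (simp add: distrib_right)
  ultimately show "- L / 2 \<le> torus_rep L z" "torus_rep L z < L / 2"
    unfolding torus_rep_def using L by (simp_all add: algebra_simps)
qed

lemma torus_rep_eqI:
  assumes "L > 0" "z - r = L * of_int n" "- L / 2 \<le> r" "r < L / 2"
  shows "torus_rep L z = r"
proof -
  have "z / L + 1 / 2 = of_int n + (r / L + 1/2)" using assms by (simp add: field_simps)
  moreover have "0 \<le> r / L + 1/2" "r / L + 1/2 < 1" using assms by (simp_all add: field_simps)
  ultimately have "\<lfloor>z / L + 1/2\<rfloor> = n" by (simp add: floor_eq_iff)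
  then show ?thesis using assms by (simp add: torus_rep_def)
qed

lemma torus_rep_shift: "L > 0 \<Longrightarrow> torus_rep L (z + L) = torus_rep L z"
proof (rule torus_rep_eqI[of L _ _ "\<lfloor>z / L + 1/2\<rfloor> + 1"])
  show "L > 0 \<Longrightarrow> z + L - torus_rep L z = L * of_int (\<lfloor>z / L + 1/2\<rfloor> + 1)"
    by (simp add: torus_rep_def algebra_simps)
qed (use torus_rep_range[of L z] in auto)

definition dK_lo :: "real \<Rightarrow> (real \<Rightarrow> real) \<Rightarrow> real \<Rightarrow> real" where
  "dK_lo L K z = Inf (dK_set L K z)"

definition dK_hi :: "real \<Rightarrow> (real \<Rightarrow> real) \<Rightarrow> real \<Rightarrow> real" where
  "dK_hi L K z = Sup (dK_set L K z)"

lemma dK_set_eq: "dK_set L K z = {dK_lo L K z..dK_hi L K z}" and dK_lo_le_hi: "dK_lo L K z \<le> dK_hi L K z"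
proof -
  have "\<exists>a b. a \<le> b \<and> dK_set L K z = {a..b}"
  proof (cases "torus_rep L z = - L / 2")
    case True
    then show ?thesis
      by (intro exI[of _ "min (deriv K (- L / 2)) (deriv K (L / 2))"]
            exI[of _ "max (deriv K (- L / 2)) (deriv K (L / 2))"])
         (auto simp: dK_set_def closed_segment_eq_real_ivl)
  next
    case False
    then show ?thesis
      by (intro exI[of _ "deriv K (torus_rep L z)"]) (simp add: dK_set_def)
  qed
  then obtain a b where "a \<le> b" "dK_set L K z = {a..b}" by blast
  then show "dK_set L K z = {dK_lo L K z..dK_hi L K z}" "dK_lo L K z \<le> dK_hi L K z"
    by (simp_all add: dK_lo_def dK_hi_def)
qed

lemma dK_set_shift: "L > 0 \<Longrightarrow> dK_set L K (z + L) = dK_set L K z"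
  by (simp add: dK_set_def torus_rep_shift)

lemma deriv_in_dK_set: "deriv K (torus_rep L z) \<in> dK_set L K z"
  by (auto simp: dK_set_def)

lemma dK_set_bound:
  assumes K: "admissible_kernel K" and "L > 0" "torus_rep L z \<noteq> 0" "x \<in> dK_set L K z"
  shows "\<bar>x\<bar> \<le> kernel_bound K"
proof (cases "torus_rep L z = - L / 2")
  case True
  have "\<bar>deriv K (- L / 2)\<bar> \<le> kernel_bound K" "\<bar>deriv K (L / 2)\<bar> \<le> kernel_bound K"
    using kernel_bound(2)[OF K] \<open>L > 0\<close> by auto
  then show ?thesis using assms(4) True
    by (auto simp: dK_set_def closed_segment_eq_real_ivl split: if_splits)
next
  case False
  then show ?thesis using assms(3,4) kernel_bound(2)[OF K] by (simp add: dK_set_def)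
qed

text \<open>Upper semicontinuity of the set-valued \<open>K'\<close>. At the antipode the two one-sided limits are
  the end points of the segment; everywhere else except at the origin \<open>K'\<close> is single-valued and
  continuous.\<close>

lemma dK_set_usc:
  assumes K: "admissible_kernel K" and L: "L > 0" and r0: "torus_rep L z \<noteq> 0" and e: "0 < e"
  shows "\<forall>\<^sub>F y in nhds z. torus_rep L y \<noteq> 0 \<and> dK_lo L K z - e \<le> dK_lo L K y \<and> dK_hi L K y \<le> dK_hi L K z + e"
proof -
  define n where "n = \<lfloor>z / L + 1/2\<rfloor>"
  define r where "r = torus_rep L z"
  have r: "z - r = L * of_int n" "- L / 2 \<le> r" "r < L / 2"
    using torus_rep_range[OF L, of z] by (simp_all add: n_def r_def torus_rep_def)
  have "\<forall>\<^sub>F y in nhds z. torus_rep L y \<noteq> 0 \<and> dK_set L K y \<subseteq> {dK_lo L K z - e..dK_hi L K z + e}"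
  proof (cases "r = - L / 2")
    case False
    have c: "isCont (deriv K) r" using deriv_kernel_continuous[OF K] r0 by (simp add: r_def)
    have lim: "((\<lambda>y. r + (y - z)) \<longlongrightarrow> r) (nhds z)" by (rule tendsto_eq_intros filterlim_ident refl | simp)+
    have ends: "- L / 2 < r" "r < L / 2" "r \<noteq> 0" using r False r0 by (auto simp: r_def)
    have "((\<lambda>y. deriv K (r + (y - z))) \<longlongrightarrow> deriv K r) (nhds z)"
      by (rule isCont_tendsto_compose[OF c lim])
    then have "\<forall>\<^sub>F y in nhds z. dist (deriv K (r + (y - z))) (deriv K r) < e"
      using e by (rule tendstoD)
    moreover have "\<forall>\<^sub>F y in nhds z. - L / 2 < r + (y - z)" "\<forall>\<^sub>F y in nhds z. r + (y - z) < L / 2"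
      "\<forall>\<^sub>F y in nhds z. r + (y - z) \<noteq> 0"
      using order_tendstoD(1)[OF lim ends(1)] order_tendstoD(2)[OF lim ends(2)]
        tendsto_imp_eventually_ne[OF lim ends(3)] by blast+
    ultimately show ?thesis
    proof eventually_elim
      case (elim y)
      have "torus_rep L y = r + (y - z)"
        using elim r by (intro torus_rep_eqI[OF L, of _ _ n]) auto
      moreover have "dK_set L K z = {deriv K r}" using False by (simp add: dK_set_def r_def)
      then have "dK_lo L K z = deriv K r" "dK_hi L K z = deriv K r" by (simp_all add: dK_lo_def dK_hi_def)
      ultimately show ?case using elim by (auto simp: dK_set_def dist_real_def)
    qed
  next
    case True
    have c: "isCont (deriv K) (- L / 2)" "isCont (deriv K) (L / 2)"
      using deriv_kernel_continuous[OF K] L by auto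
    have lim: "((\<lambda>y. - L / 2 + (y - z)) \<longlongrightarrow> - L / 2) (nhds z)" "((\<lambda>y. L / 2 + (y - z)) \<longlongrightarrow> L / 2) (nhds z)"
      by (rule tendsto_eq_intros filterlim_ident refl | simp)+
    have "\<forall>\<^sub>F y in nhds z. dist (deriv K (- L / 2 + (y - z))) (deriv K (- L / 2)) < e"
      "\<forall>\<^sub>F y in nhds z. dist (deriv K (L / 2 + (y - z))) (deriv K (L / 2)) < e"
      using isCont_tendsto_compose[OF c(1) lim(1)] isCont_tendsto_compose[OF c(2) lim(2)] e
      by (auto intro: tendstoD)
    moreover have "\<forall>\<^sub>F y in nhds z. - L / 2 + (y - z) < 0" "\<forall>\<^sub>F y in nhds z. 0 < L / 2 + (y - z)"
      using L by (intro order_tendstoD(2)[OF lim(1)] order_tendstoD(1)[OF lim(2)]; simp)+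
    ultimately show ?thesis
    proof eventually_elim
      case (elim y)
      have ends: "deriv K (- L / 2) \<in> {dK_lo L K z..dK_hi L K z}" "deriv K (L / 2) \<in> {dK_lo L K z..dK_hi L K z}"
        using True by (simp_all add: dK_set_eq[symmetric] dK_set_def r_def)
      consider "y = z" | "z < y" | "y < z" by linarith
      then show ?case
      proof cases
        case 1
        then show ?thesis using e r0 dK_set_eq[of L K z] by auto
      next
        case 2
        have "torus_rep L y = - L / 2 + (y - z)"
          using elim r True 2 L by (intro torus_rep_eqI[OF L, of _ _ n]) auto
        then show ?thesis using elim ends 2 by (auto simp: dK_set_def dist_real_def)
      next
        case 3
        have "torus_rep L y = L / 2 + (y - z)"
          using elim r True 3 L by (intro torus_rep_eqI[OF L, of _ _ "n - 1"]) (auto simp: algebra_simps)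
        then show ?thesis using elim ends 3 by (auto simp: dK_set_def dist_real_def)
      qed
    qed
  qed
  then show ?thesis
    by (rule eventually_mono) (use dK_lo_le_hi in \<open>auto simp: dK_set_eq\<close>)
qed

text \<open>A nonpositive derivative almost everywhere gives monotonicity only together with the Lipschitz
  property: \<open>v\<close> is the integral of its derivative.\<close>

lemma mobility_antimono:
  assumes v: "admissible_mobility v" and ab: "0 \<le> a" "a \<le> b"
  shows "v b \<le> v a"
proof (cases "a = b")
  case False
  then have "a < b" using ab by simp
  obtain B where B: "B-lipschitz_on {0..} v" using v by (auto simp: admissible_mobility_def)
  have lip: "\<bar>v s - v t\<bar> \<le> B * \<bar>s - t\<bar>" if "s \<in> {a..b}" "t \<in> {a..b}" for s t
    using lipschitz_onD[OF B, of s t] that ab by (simp add: dist_real_def)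
  obtain f Z where Z: "negligible Z"
    and fi: "\<And>t. t \<in> {a..b} \<Longrightarrow> (f has_integral (v t - v a)) {a..t}"
    and fd: "\<And>t. t \<in> {a..<b} - Z \<Longrightarrow> ((\<lambda>s. (v s - v t) / (s - t)) \<longlongrightarrow> f t) (at_right t)"
    by (rule lipschitz_density_on[OF lip \<open>a < b\<close>]) (assumption | rule that)+
  have "AE s in lebesgue. s \<in> {0..} \<longrightarrow> (\<exists>d\<le>0. (v has_real_derivative d) (at s))"
    using v by (simp add: admissible_mobility_def AE_restrict_space_iff)
  then obtain N where N: "{s \<in> space lebesgue. \<not> (s \<in> {0..} \<longrightarrow> (\<exists>d\<le>0. (v has_real_derivative d) (at s)))} \<subseteq> N"
    "N \<in> null_sets lebesgue"
    by (auto simp: eventually_ae_filter)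
  have neg: "negligible (Z \<union> N \<union> {b})" using Z N(2) by (simp add: negligible_iff_null_sets[of N])
  have "v b - v a \<le> 0"
  proof (rule has_integral_le[OF has_integral_spike[OF neg _ fi]])
    show "((\<lambda>t. 0) has_integral 0) {a..b}" by simp
    fix t assume t: "t \<in> {a..b}"
    show "(if t \<in> Z \<union> N \<union> {b} then 0 else f t) \<le> 0"
    proof (cases "t \<in> Z \<union> N \<union> {b}")
      case False
      then have "t \<notin> N" by simp
      then have "t \<in> {0..} \<longrightarrow> (\<exists>d\<le>0. (v has_real_derivative d) (at t))"
        using N(1) by auto
      then obtain d where d: "d \<le> 0" "(v has_real_derivative d) (at t)" using t ab by auto
      then have "((\<lambda>s. (v s - v t) / (s - t)) \<longlongrightarrow> d) (at t)" by (simp add: has_field_derivative_iff)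
      then have "((\<lambda>s. (v s - v t) / (s - t)) \<longlongrightarrow> d) (at_right t)"
        by (rule tendsto_mono[rotated]) (simp add: at_le)
      then have "f t = d" using fd[of t] False t by (intro tendsto_unique[of "at_right t"]) auto
      then show ?thesis using d by simp
    qed simp
  qed (use ab in auto)
  then show ?thesis by simp
qed simp

lemma mobility_continuous:
  "admissible_mobility v \<Longrightarrow> continuous_on {0..} v"
  by (auto simp: admissible_mobility_def intro: lipschitz_on_continuous_on)

lemma mobility_nonneg: "admissible_mobility v \<Longrightarrow> 0 \<le> s \<Longrightarrow> 0 \<le> v s"
  by (simp add: admissible_mobility_def)

text \<open>Both diffusions have \<open>\<xi> W''(\<xi>) = w(\<xi>)\<close> with \<open>w = 1\<close> or \<open>w = m \<xi>\<^bsup>m-1\<^esup>\<close>. The bound \<open>1 \<le> w\<close> on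
  \<open>[1, \<infinity>)\<close> does not involve \<open>m\<close>, which is why the final constant does not depend on \<open>W\<close>.\<close>

lemma phi_density:
  assumes W: "admissible_diffusion W" and v: "admissible_mobility v"
  obtains w where "continuous_on {0..} w" "\<And>s. 0 \<le> s \<Longrightarrow> 0 \<le> w s" "\<And>s. 1 \<le> s \<Longrightarrow> 1 \<le> w s"
    "\<And>s. 0 \<le> s \<Longrightarrow> ((\<lambda>x. w x * v x) has_integral phi W v s) {0..s}"
proof -
  have key: "\<exists>w. continuous_on {0..} w \<and> (\<forall>s\<ge>0. 0 \<le> w s) \<and> (\<forall>s\<ge>1. 1 \<le> w s) \<and>
     (\<forall>s>0. s * deriv (deriv W) s = w s)"
    using W unfolding admissible_diffusion_def
  proof (elim disjE exE conjE)
    assume W: "\<forall>r\<ge>0. W r = r * ln r"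
    have d1: "deriv W s = ln s + 1" if "0 < s" for s
    proof (rule DERIV_imp_deriv)
      have "((\<lambda>r. r * ln r) has_real_derivative ln s + 1) (at s)"
        using that by (auto intro!: derivative_eq_intros)
      then show "(W has_real_derivative ln s + 1) (at s)"
        by (rule has_field_derivative_transform_within_open[of _ _ _ "{0<..}"]) (use W that in auto)
    qed
    have "deriv (deriv W) s = 1 / s" if "0 < s" for s
    proof (rule DERIV_imp_deriv)
      have "((\<lambda>r. ln r + 1) has_real_derivative 1 / s) (at s)"
        using that by (auto intro!: derivative_eq_intros)
      then show "(deriv W has_real_derivative 1 / s) (at s)"
        by (rule has_field_derivative_transform_within_open[of _ _ _ "{0<..}"]) (use d1 that in auto)
    qed
    then show ?thesis by (intro exI[of _ "\<lambda>_. 1"]) auto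
  next
    fix m :: real assume m: "1 < m" and W: "\<forall>r\<ge>0. W r = r powr m / (m - 1)"
    have d1: "deriv W s = m * s powr (m - 1) / (m - 1)" if "0 < s" for s
    proof (rule DERIV_imp_deriv)
      have "((\<lambda>r. r powr m / (m - 1)) has_real_derivative m * s powr (m - 1) / (m - 1)) (at s)"
        using that m by (auto intro!: derivative_eq_intros)
      then show "(W has_real_derivative m * s powr (m - 1) / (m - 1)) (at s)"
        by (rule has_field_derivative_transform_within_open[of _ _ _ "{0<..}"]) (use W that in auto)
    qed
    have d2: "deriv (deriv W) s = m * s powr (m - 2)" if "0 < s" for s
    proof (rule DERIV_imp_deriv)
      have "((\<lambda>r. m * r powr (m - 1) / (m - 1)) has_real_derivative m * ((m - 1) * s powr (m - 1 - 1)) / (m - 1)) (at s)"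
        using that m by (auto intro!: derivative_eq_intros)
      then have "((\<lambda>r. m * r powr (m - 1) / (m - 1)) has_real_derivative m * s powr (m - 2)) (at s)"
        using m by simp
      then show "(deriv W has_real_derivative m * s powr (m - 2)) (at s)"
        by (rule has_field_derivative_transform_within_open[of _ _ _ "{0<..}"]) (use d1 that in auto)
    qed
    have "s * deriv (deriv W) s = m * s powr (m - 1)" if "0 < s" for s
      using that powr_add[of s 1 "m - 2"] by (simp add: d2 mult.left_commute)
    moreover have "1 \<le> m * s powr (m - 1)" if "1 \<le> s" for s
      using mult_mono[of 1 m 1 "s powr (m - 1)"] that m by (simp add: ge_one_powr_ge_zero)
    moreover have "continuous_on {0..} (\<lambda>s. m * s powr (m - 1))"
      using m by (intro continuous_on_mult continuous_on_const continuous_on_powr' continuous_on_id) auto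
    ultimately show ?thesis using m by (intro exI[of _ "\<lambda>s. m * s powr (m - 1)"]) auto
  qed
  then obtain w where w: "continuous_on {0..} w" "\<And>s. 0 \<le> s \<Longrightarrow> 0 \<le> w s" "\<And>s. 1 \<le> s \<Longrightarrow> 1 \<le> w s"
    "\<And>s. 0 < s \<Longrightarrow> s * deriv (deriv W) s = w s" by blast
  show thesis
  proof (rule that[OF w(1-3)])
    fix s :: real assume "0 \<le> s"
    have "continuous_on {0..s} (\<lambda>x. w x * v x)"
      using w(1) mobility_continuous[OF v] by (intro continuous_intros) (auto elim: continuous_on_subset)
    then have "((\<lambda>x. w x * v x) has_integral integral {0..s} (\<lambda>x. w x * v x)) {0..s}"
      by (intro integrable_integral integrable_continuous_real)
    moreover have "integral {0..s} (\<lambda>x. w x * v x) = phi W v s"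
      unfolding phi_def
      by (rule integral_spike[of "{0}"]) (auto simp: w(4))
    ultimately show "((\<lambda>x. w x * v x) has_integral phi W v s) {0..s}" by simp
  qed
qed

lemma
  assumes W: "admissible_diffusion W" and v: "admissible_mobility v"
  shows phi_continuous: "continuous_on {0..} (phi W v)"
    and phi_mono: "\<And>a b. 0 \<le> a \<Longrightarrow> a \<le> b \<Longrightarrow> phi W v a \<le> phi W v b"
    and phi_growth: "\<And>a b. 1 \<le> a \<Longrightarrow> a \<le> b \<Longrightarrow> v b * (b - a) \<le> phi W v b - phi W v a"
proof -
  obtain w where w: "continuous_on {0..} w" "\<And>s. 0 \<le> s \<Longrightarrow> 0 \<le> w s" "\<And>s. 1 \<le> s \<Longrightarrow> 1 \<le> w s"
    "\<And>s. 0 \<le> s \<Longrightarrow> ((\<lambda>x. w x * v x) has_integral phi W v s) {0..s}"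
    using phi_density[OF W v] by metis
  have wv: "continuous_on {0..} (\<lambda>x. w x * v x)"
    using w(1) mobility_continuous[OF v] by (intro continuous_intros)
  have diff: "((\<lambda>x. w x * v x) has_integral (phi W v b - phi W v a)) {a..b}" if "0 \<le> a" "a \<le> b" for a b
  proof -
    have "(\<lambda>x. w x * v x) integrable_on {a..b}"
      using that by (intro integrable_continuous_real continuous_on_subset[OF wv]) auto
    then obtain i where i: "((\<lambda>x. w x * v x) has_integral i) {a..b}" by (auto simp: integrable_on_def)
    have "((\<lambda>x. w x * v x) has_integral (phi W v a + i)) {0..b}"
      using that by (intro has_integral_combine[OF _ _ w(4) i]) auto
    then have "phi W v b = phi W v a + i" using w(4)[of b] that by (auto intro: has_integral_unique)
    then show ?thesis using i by simp
  qed
  show "phi W v a \<le> phi W v b" if "0 \<le> a" "a \<le> b" for a b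
    using has_integral_nonneg[OF diff[OF that]] that w(2) mobility_nonneg[OF v] by auto
  show "v b * (b - a) \<le> phi W v b - phi W v a" if ab: "1 \<le> a" "a \<le> b" for a b
  proof (rule has_integral_le)
    show "((\<lambda>x. v b) has_integral v b * (b - a)) {a..b}"
      using has_integral_const_real[of "v b" a b] ab by (simp add: mult.commute)
    show "((\<lambda>x. w x * v x) has_integral (phi W v b - phi W v a)) {a..b}" using diff ab by auto
    fix x assume x: "x \<in> {a..b}"
    have "1 * v b \<le> w x * v x"
      using x ab w(3)[of x] mobility_antimono[OF v, of x b] mobility_nonneg[OF v, of b]
      by (intro mult_mono) auto
    then show "v b \<le> w x * v x" by simp
  qed
  show "continuous_on {0..} (phi W v)"
    unfolding continuous_on_eq_continuous_within
  proof
    fix x :: real assume x: "x \<in> {0..}"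
    have "continuous_on {0..x + 1} (\<lambda>s. integral {0..s} (\<lambda>x. w x * v x))"
      using x by (intro indefinite_integral_continuous_1 integrable_continuous_real
          continuous_on_subset[OF wv]) auto
    then have "continuous_on {0..x + 1} (phi W v)"
      by (rule continuous_on_eq) (use w(4) in \<open>auto intro: integral_unique\<close>)
    then have "continuous (at x within {0..x + 1}) (phi W v)"
      using x by (simp add: continuous_on_eq_continuous_within)
    moreover have "at x within {0..x + 1} = at x within {0..}"
      by (rule at_within_nhd[of x "{..<x + 1}"]) auto
    ultimately show "continuous (at x within {0..}) (phi W v)" by simp
  qed
qed

section \<open>Cyclic configurations\<close>

definition spacing :: "real \<Rightarrow> nat \<Rightarrow> (nat \<Rightarrow> real) \<Rightarrow> nat \<Rightarrow> real" where
  "spacing L N x k = next_pos L N x k - x k"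

definition next_index :: "nat \<Rightarrow> nat \<Rightarrow> nat" where
  "next_index N k = (if Suc k < N then Suc k else 0)"

lemma ordered_iff_spacing: "ordered L N x \<longleftrightarrow> (\<forall>k<N. 0 < spacing L N x k)"
  by (simp add: ordered_def spacing_def)

lemma dpa_density_spacing: "dpa_density c L N x k = c / (real N * spacing L N x k)"
  by (simp add: dpa_density_def spacing_def)

lemma next_index_less: "k < N \<Longrightarrow> next_index N k < N"
  by (simp add: next_index_def)

lemma prev_index_less: "k < N \<Longrightarrow> prev_index N k < N"
  by (simp add: prev_index_def)

lemma prev_index_Suc: "Suc k < N \<Longrightarrow> prev_index N (Suc k) = k"
  by (simp add: prev_index_def)

lemma prev_index_0: "0 < N \<Longrightarrow> prev_index N 0 = N - 1"
  by (simp add: prev_index_def)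

lemma prev_next_index: "k < N \<Longrightarrow> prev_index N (next_index N k) = k"
  by (auto simp: next_index_def prev_index_Suc prev_index_0)

lemma next_prev_index: "k < N \<Longrightarrow> next_index N (prev_index N k) = k"
  by (cases k) (auto simp: next_index_def prev_index_Suc prev_index_0)

lemma next_index_neq: "2 \<le> N \<Longrightarrow> k < N \<Longrightarrow> next_index N k \<noteq> k"
  by (auto simp: next_index_def)

lemma next_pos_eq: "k < N \<Longrightarrow> next_pos L N x k = x (next_index N k) + (if Suc k < N then 0 else L)"
  by (simp add: next_pos_def next_index_def)

lemma spacing_increment:
  "k < N \<Longrightarrow> spacing L N y k - spacing L N x k
     = (y (next_index N k) - x (next_index N k)) - (y k - x k)"
  by (simp add: spacing_def next_pos_eq)

lemma sum_spacing: "0 < N \<Longrightarrow> (\<Sum>k<N. spacing L N x k) = L"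
proof -
  assume "0 < N"
  then obtain n where n: "N = Suc n" by (cases N) auto
  have "(\<Sum>k<N. spacing L N x k) = (\<Sum>k<n. x (Suc k) - x k) + (x 0 + L - x n)"
    unfolding n sum.lessThan_Suc by (simp add: spacing_def next_pos_def)
  then show ?thesis by (simp add: sum_lessThan_telescope)
qed

text \<open>A particle whose density is at most the mean density \<open>c / L\<close>.\<close>

lemma exists_large_spacing:
  assumes "0 < N"
  obtains i where "i < N" "L / real N \<le> spacing L N x i"
proof -
  have "\<exists>i<N. L / real N \<le> spacing L N x i"
  proof (rule ccontr)
    assume "\<not> ?thesis"
    then have "(\<Sum>k<N. spacing L N x k) < (\<Sum>k<N. L / real N)"
      using assms by (intro sum_strict_mono) (auto simp: not_le)
    then show False using sum_spacing[OF assms, of L x] assms by simp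
  qed
  then show thesis using that by blast
qed

text \<open>Both inequalities: distances on the circle, measured in either direction, are at least the
  smallest gap.\<close>

lemma spacing_separates:
  assumes d: "\<And>k. k < N \<Longrightarrow> d \<le> spacing L N x k" "0 \<le> d" and ij: "i < j" "j < N"
  shows "x i + d \<le> x j" "x j + d \<le> x i + L"
proof -
  have step: "x k + d \<le> x (Suc k)" if "Suc k < N" for k
    using d(1)[of k] that by (simp add: spacing_def next_pos_def)
  have mono: "x k \<le> x l" if "k \<le> l" "l < N" for k l
    using that by (induction l rule: dec_induct) (use step d(2) in force)+
  show "x i + d \<le> x j" using step[of i] mono[of "Suc i" j] ij by simp
  have "x (N - 1) + d \<le> x 0 + L"
    using d(1)[of "N - 1"] ij by (simp add: spacing_def next_pos_def)
  then show "x j + d \<le> x i + L" 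
  proof -
    have "x j \<le> x (N - 1)" using ij by (intro mono) auto
    moreover have "x 0 \<le> x i" using ij by (intro mono) auto
    ultimately show ?thesis using \<open>x (N - 1) + d \<le> x 0 + L\<close> by linarith
  qed
qed

lemma spacing_pos_bound:
  assumes "ordered L N x"
  obtains d where "0 < d" "\<And>k. k < N \<Longrightarrow> d \<le> spacing L N x k"
proof (cases "N = 0")
  case False
  have fin: "finite (spacing L N x ` {..<N})" "spacing L N x ` {..<N} \<noteq> {}" using False by auto
  show thesis
  proof (rule that[of "Min (spacing L N x ` {..<N})"])
    show "0 < Min (spacing L N x ` {..<N})"
      using fin assms by (subst Min_gr_iff) (auto simp: ordered_iff_spacing)
  qed (use fin in auto)
qed (use that[of 1] in auto)

lemma ordered_less:
  assumes "ordered L N x" "i < j" "j < N"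
  shows "x i < x j" "x j < x i + L"
proof -
  obtain d where d: "0 < d" "\<And>k. k < N \<Longrightarrow> d \<le> spacing L N x k" 
    using spacing_pos_bound[OF assms(1)] by blast
  show "x i < x j" "x j < x i + L"
    using spacing_separates[OF d(2) less_imp_le[OF d(1)] assms(2,3)] d(1) by auto
qed

lemma spacing_le_period:
  assumes "ordered L N x" "k < N"
  shows "spacing L N x k \<le> L"
proof (cases "Suc k < N")
  case True
  then show ?thesis using ordered_less(2)[OF assms(1), of k "Suc k"] by (simp add: spacing_def next_pos_def)
next
  case False
  then show ?thesis using ordered_less(1)[OF assms(1), of 0 k] assms(2)
    by (cases "k = 0") (auto simp: spacing_def next_pos_def)
qed

lemma torus_rep_nonzero:
  assumes L: "0 < L" and "ordered L N x" "i < N" "j < N" "i \<noteq> j"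
  shows "torus_rep L (x i - x j) \<noteq> 0"
proof
  assume 0: "torus_rep L (x i - x j) = 0"
  define n where "n = \<lfloor>(x i - x j) / L + 1/2\<rfloor>"
  have n: "x i - x j = L * of_int n" using 0 by (simp add: torus_rep_def n_def)
  have b: "\<bar>x i - x j\<bar> < L" "x i \<noteq> x j"
    using ordered_less[OF assms(2), of i j] ordered_less[OF assms(2), of j i] assms(3-5)
    by (cases i j rule: linorder_cases; simp)+
  then have "L * \<bar>of_int n\<bar> < L * 1" using n L by (simp add: abs_mult)
  then have "n = 0" using L by simp
  then show False using n b(2) by simp
qed

lemma tendsto_spacing:
  assumes "k < N"
  shows "((\<lambda>y. spacing L N y k) \<longlongrightarrow> spacing L N x k) (near N x)"
  unfolding spacing_def next_pos_eq[OF assms]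
  by (intro tendsto_intros tendsto_near assms next_index_less)

lemma eventually_spacing_ge:
  assumes "\<And>k. k < N \<Longrightarrow> d < spacing L N x k"
  shows "\<forall>\<^sub>F y in near N x. \<forall>k<N. d < spacing L N y k"
proof -
  have "\<forall>\<^sub>F y in near N x. \<forall>k\<in>{..<N}. d < spacing L N y k"
    using assms order_tendstoD(1)[OF tendsto_spacing]
    by (intro eventually_ball_finite) auto
  then show ?thesis by (rule eventually_mono) simp
qed

lemma eventually_ordered: "ordered L N x \<Longrightarrow> \<forall>\<^sub>F y in near N x. ordered L N y"
  using eventually_spacing_ge[of N 0 L x] by (simp add: ordered_iff_spacing)

lemma cyclic_variation:
  fixes f :: "nat \<Rightarrow> real"
  assumes "i < N" "m < N"
  shows "f m - f i \<le> (\<Sum>l<N. \<bar>f l - f (prev_index N l)\<bar>)"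
proof -
  have "\<bar>f (i + n) - f i\<bar> \<le> (\<Sum>l\<in>{i<..i + n}. \<bar>f l - f (prev_index N l)\<bar>)" if "i + n < N" for i n
    using that
  proof (induction n)
    case (Suc n)
    have "{i<..i + Suc n} = insert (Suc (i + n)) {i<..i + n}" by auto
    moreover have "prev_index N (Suc (i + n)) = i + n" using Suc.prems by (simp add: prev_index_Suc)
    ultimately show ?case using Suc by simp
  qed simp
  moreover have "(\<Sum>l\<in>{i<..i + n}. \<bar>f l - f (prev_index N l)\<bar>) \<le> (\<Sum>l<N. \<bar>f l - f (prev_index N l)\<bar>)"
    if "i + n < N" for i n using that by (intro sum_mono2) auto
  ultimately have *: "\<bar>f (i + n) - f i\<bar> \<le> (\<Sum>l<N. \<bar>f l - f (prev_index N l)\<bar>)" if "i + n < N" for i n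
    using that order_trans by blast
  show ?thesis
    using *[of i "m - i"] *[of m "i - m"] assms by (cases "i \<le> m") auto
qed

text \<open>Applied to the particles antipodal to a point of the smallest gap.\<close>

lemma card_separated_le_2:
  fixes f :: "'i \<Rightarrow> real"
  assumes "finite A" "0 < d" "\<And>i j. i \<in> A \<Longrightarrow> j \<in> A \<Longrightarrow> i \<noteq> j \<Longrightarrow> d \<le> \<bar>f i - f j\<bar>"
    and "\<And>i. i \<in> A \<Longrightarrow> a \<le> f i \<and> f i \<le> a + d"
  shows "card A \<le> 2"
proof (rule ccontr)
  assume "\<not> card A \<le> 2"
  then obtain S where "S \<subseteq> A" "card S = 3" using obtain_subset_with_card_n[of 3 A] by auto
  then obtain i j k where "i \<in> A" "j \<in> A" "k \<in> A" "i \<noteq> j" "j \<noteq> k" "i \<noteq> k"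
    by (auto simp: card_3_iff)
  then show False
    using assms(2) assms(3)[of i j] assms(3)[of i k] assms(3)[of j k] assms(4)[of i] assms(4)[of j] assms(4)[of k]
    by (auto simp: abs_if split: if_splits)
qed

section \<open>Admissible velocities\<close>

text \<open>\<open>c\<close> stands for the mass of the initial density. With at least two particles, a particle and
  its right neighbour are distinct.\<close>

locale dpa =
  fixes K v W :: "real \<Rightarrow> real" and L c :: real and N :: nat
  assumes kernel: "admissible_kernel K" and mobility: "admissible_mobility v"
    and diffusion: "admissible_diffusion W"
    and L_pos: "0 < L" and c_pos: "0 < c" and c_le_1: "c \<le> 1" and N_ge: "2 \<le> N"
begin

abbreviation "B \<equiv> kernel_bound K"
abbreviation "\<phi> \<equiv> phi W v"
abbreviation "gap \<equiv> spacing L N"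
abbreviation "dens \<equiv> dpa_density c L N"
abbreviation "nxt \<equiv> next_index N"
abbreviation "prv \<equiv> prev_index N"

text \<open>The smallest and the largest velocity that admissible values of \<open>K'\<close> can give to
  particle \<open>k\<close>. The interaction enters the velocity with a nonpositive coefficient, hence the exchange
  of \<open>dK_hi\<close> and \<open>dK_lo\<close>.\<close>

definition vel_lo :: "(nat \<Rightarrow> real) \<Rightarrow> nat \<Rightarrow> real" where
  "vel_lo x k = dpa_rhs W v c L N (\<lambda>k j. dK_hi L K (x k - x j)) x k"

definition vel_hi :: "(nat \<Rightarrow> real) \<Rightarrow> nat \<Rightarrow> real" where
  "vel_hi x k = dpa_rhs W v c L N (\<lambda>k j. dK_lo L K (x k - x j)) x k"

lemma N_pos: "0 < N" "0 < real N"
  using N_ge by auto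

lemma dens_pos: "ordered L N x \<Longrightarrow> k < N \<Longrightarrow> 0 < dens x k"
  using c_pos N_pos by (simp add: dpa_density_spacing ordered_iff_spacing)

lemma dpa_v_bounds:
  assumes "ordered L N x" "k < N"
  shows "0 \<le> dpa_v v c L N x k" "dpa_v v c L N x k \<le> v 0"
proof -
  have "0 \<le> max (dens x k) (dens x (prv k))" using dens_pos[OF assms] by simp
  then show "0 \<le> dpa_v v c L N x k" "dpa_v v c L N x k \<le> v 0"
    using mobility_nonneg[OF mobility] mobility_antimono[OF mobility, of 0] by (simp_all add: dpa_v_def)
qed

lemma rhs_between:
  assumes ord: "ordered L N x" and k: "k < N"
    and \<kappa>: "\<And>j. j < N \<Longrightarrow> j \<noteq> k \<Longrightarrow> \<kappa> k j \<in> dK_set L K (x k - x j)"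
  shows "vel_lo x k \<le> dpa_rhs W v c L N \<kappa> x k" "dpa_rhs W v c L N \<kappa> x k \<le> vel_hi x k"
proof -
  have f: "0 \<le> c / real N * dpa_v v c L N x k"
    using c_pos dpa_v_bounds[OF ord k] by simp
  have "(\<Sum>j\<in>{..<N} - {k}. \<kappa> k j) \<le> (\<Sum>j\<in>{..<N} - {k}. dK_hi L K (x k - x j))"
    "(\<Sum>j\<in>{..<N} - {k}. dK_lo L K (x k - x j)) \<le> (\<Sum>j\<in>{..<N} - {k}. \<kappa> k j)"
    using \<kappa> by (auto intro!: sum_mono simp: dK_set_eq)
  from mult_left_mono[OF this(1) f] mult_left_mono[OF this(2) f]
  show "vel_lo x k \<le> dpa_rhs W v c L N \<kappa> x k" "dpa_rhs W v c L N \<kappa> x k \<le> vel_hi x k"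
    by (simp_all add: vel_lo_def vel_hi_def dpa_rhs_def)
qed

text \<open>The velocity is affine in the forces, so one convex combination of the extreme forces, the same
  for all \<open>j\<close>, yields any velocity in between.\<close>

lemma between_rhs:
  assumes a: "vel_lo x k \<le> a" "a \<le> vel_hi x k"
  obtains \<kappa> where "\<And>j. \<kappa> j \<in> dK_set L K (x k - x j)" "dpa_rhs W v c L N (\<lambda>_. \<kappa>) x k = a"
proof -
  let ?r = "\<lambda>\<theta>. dpa_rhs W v c L N (\<lambda>k j. (1 - \<theta>) * dK_hi L K (x k - x j) + \<theta> * dK_lo L K (x k - x j)) x k"
  have aff: "?r \<theta> = (1 - \<theta>) * vel_lo x k + \<theta> * vel_hi x k" for \<theta>
  proof -
    have S: "(\<Sum>j\<in>{..<N} - {k}. (1 - \<theta>) * dK_hi L K (x k - x j) + \<theta> * dK_lo L K (x k - x j))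
      = (1 - \<theta>) * (\<Sum>j\<in>{..<N} - {k}. dK_hi L K (x k - x j)) + \<theta> * (\<Sum>j\<in>{..<N} - {k}. dK_lo L K (x k - x j))"
      by (simp add: sum.distrib sum_distrib_left)
    have gen: "p * ((1 - \<theta>) * h + \<theta> * l) - g = (1 - \<theta>) * (p * h - g) + \<theta> * (p * l - g)" for p h l g :: real
      by (simp add: algebra_simps)
    show ?thesis unfolding vel_lo_def vel_hi_def dpa_rhs_def S by (rule gen)
  qed
  have "\<exists>\<theta>. 0 \<le> \<theta> \<and> \<theta> \<le> 1 \<and> a = (1 - \<theta>) * vel_lo x k + \<theta> * vel_hi x k"
  proof -
    have "a \<in> closed_segment (vel_lo x k) (vel_hi x k)" using a by (simp add: closed_segment_eq_real_ivl)
    then show ?thesis by (auto simp: closed_segment_def)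
  qed
  then obtain \<theta> where \<theta>: "0 \<le> \<theta>" "\<theta> \<le> 1" "a = ?r \<theta>" unfolding aff by blast
  show thesis
  proof (rule that)
    show "dpa_rhs W v c L N (\<lambda>_ j. (1 - \<theta>) * dK_hi L K (x k - x j) + \<theta> * dK_lo L K (x k - x j)) x k = a"
      using \<theta>(3) by (simp add: dpa_rhs_def)
    show "(1 - \<theta>) * dK_hi L K (x k - x j) + \<theta> * dK_lo L K (x k - x j) \<in> dK_set L K (x k - x j)" for j
    proof -
      have "(1 - \<theta>) * dK_hi L K (x k - x j) + \<theta> * dK_lo L K (x k - x j)
          \<in> closed_segment (dK_hi L K (x k - x j)) (dK_lo L K (x k - x j))"
        using \<theta> by (auto simp: closed_segment_def)
      then show ?thesis using dK_lo_le_hi[of L K "x k - x j"]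
        by (auto simp: dK_set_eq closed_segment_eq_real_ivl split: if_splits)
    qed
  qed
qed

lemma isCont_phi: "0 < s \<Longrightarrow> isCont \<phi> s"
  using phi_continuous[OF diffusion mobility] by (rule continuous_on_interior) simp

lemma isCont_v: "0 < s \<Longrightarrow> isCont v s"
  using mobility_continuous[OF mobility] by (rule continuous_on_interior) simp

lemma tendsto_dens:
  assumes "ordered L N x" "k < N"
  shows "((\<lambda>y. dens y k) \<longlongrightarrow> dens x k) (near N x)"
  unfolding dpa_density_spacing
  using assms N_pos by (intro tendsto_intros tendsto_spacing) (auto simp: ordered_iff_spacing)

text \<open>The mobility and the diffusion depend continuously on the configuration; only the
  interaction is discontinuous, and it is upper semicontinuous.\<close>

lemma vel_usc:
  assumes ord: "ordered L N x" and k: "k < N" and e: "0 < e"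
  shows "\<forall>\<^sub>F y in near N x. vel_lo x k - e \<le> vel_lo y k \<and> vel_hi y k \<le> vel_hi x k + e"
proof -
  note pk = prev_index_less[OF k]
  define V where "V y = c / real N * dpa_v v c L N y k" for y
  define G where "G y = real N / c * dpa_G W v c L N y k" for y
  have pos: "0 < dens x k" "0 < dens x (prv k)" using dens_pos[OF ord] k pk by auto
  have limG: "(G \<longlongrightarrow> G x) (near N x)"
    unfolding G_def dpa_G_def
    by (intro tendsto_intros isCont_tendsto_compose[OF isCont_phi] tendsto_dens ord k pk pos)
  have limV: "(V \<longlongrightarrow> V x) (near N x)"
    unfolding V_def dpa_v_def
    by (intro tendsto_intros isCont_tendsto_compose[OF isCont_v] tendsto_dens ord k pk)
       (use pos in auto)
  have V0: "0 \<le> V y" if "ordered L N y" for y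
    using dpa_v_bounds[OF that k] c_pos by (simp add: V_def)
  define S where "S D y = (\<Sum>j\<in>{..<N} - {k}. D L K (y k - y j))" for D :: "real \<Rightarrow> (real \<Rightarrow> real) \<Rightarrow> real \<Rightarrow> real" and y
  have lo: "vel_lo y k = - (V y * S dK_hi y) - G y" and hi: "vel_hi y k = - (V y * S dK_lo y) - G y" for y
    by (simp_all add: vel_lo_def vel_hi_def dpa_rhs_def V_def S_def G_def)
  define r where "r = e / (2 * (V x + 1))"
  have r: "0 < r" "V x * r < e" using V0[OF ord] e by (simp_all add: r_def field_simps add_nonneg_pos)
  define q where "q = r / real N"
  have q: "0 < q" "real N * q = r" using r N_pos by (simp_all add: q_def)
  have "\<forall>\<^sub>F y in near N x. \<forall>j\<in>{..<N} - {k}.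
      dK_lo L K (x k - x j) - q \<le> dK_lo L K (y k - y j) \<and> dK_hi L K (y k - y j) \<le> dK_hi L K (x k - x j) + q"
  proof (intro eventually_ball_finite ballI)
    fix j assume j: "j \<in> {..<N} - {k}"
    have "((\<lambda>y. y k - y j) \<longlongrightarrow> x k - x j) (near N x)"
      using j k by (intro tendsto_intros tendsto_near) auto
    from eventually_compose_filterlim[OF dK_set_usc[OF kernel L_pos torus_rep_nonzero[OF L_pos ord k, of j] q(1)] this]
    show "\<forall>\<^sub>F y in near N x. dK_lo L K (x k - x j) - q \<le> dK_lo L K (y k - y j) \<and>
        dK_hi L K (y k - y j) \<le> dK_hi L K (x k - x j) + q"
      using j by (auto elim: eventually_mono)
  qed simp
  moreover have "\<forall>\<^sub>F y in near N x. - (V x * (S dK_hi x + r)) - G x - (e - V x * r) < - (V y * (S dK_hi x + r)) - G y"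
    using r(2) by (intro order_tendstoD(1)[OF tendsto_diff[OF tendsto_minus[OF tendsto_mult_right[OF limV]] limG]]) simp
  moreover have "\<forall>\<^sub>F y in near N x. - (V y * (S dK_lo x - r)) - G y < - (V x * (S dK_lo x - r)) - G x + (e - V x * r)"
    using r(2) by (intro order_tendstoD(2)[OF tendsto_diff[OF tendsto_minus[OF tendsto_mult_right[OF limV]] limG]]) simp
  moreover note eventually_ordered[OF ord]
  ultimately show ?thesis
  proof eventually_elim
    case (elim y)
    have card: "real (card ({..<N} - {k})) * q \<le> r"
      unfolding q(2)[symmetric] using q(1) k by (intro mult_right_mono) auto
    have "S dK_hi y \<le> (\<Sum>j\<in>{..<N} - {k}. dK_hi L K (x k - x j) + q)"
      unfolding S_def using elim by (intro sum_mono) auto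
    also have "\<dots> \<le> S dK_hi x + r" using card by (simp add: S_def sum.distrib)
    finally have 1: "V y * S dK_hi y \<le> V y * (S dK_hi x + r)" using V0 elim by (intro mult_left_mono) auto
    have "S dK_lo x - r \<le> (\<Sum>j\<in>{..<N} - {k}. dK_lo L K (x k - x j) - q)"
      using card by (simp add: S_def sum_subtractf)
    also have "\<dots> \<le> S dK_lo y" unfolding S_def using elim by (intro sum_mono) auto
    finally have 2: "V y * (S dK_lo x - r) \<le> V y * S dK_lo y" using V0 elim by (intro mult_left_mono) auto
    show ?case unfolding lo hi using 1 2 elim by (simp add: algebra_simps)
  qed
qed

text \<open>Apart from the diffusion, velocities are bounded independently of \<open>N\<close> and of the
  configuration.\<close>

lemma vel_drift_bound:
  assumes ord: "ordered L N x" and k: "k < N" and w: "vel_lo x k \<le> w" "w \<le> vel_hi x k"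
  shows "\<bar>w + real N / c * dpa_G W v c L N x k\<bar> \<le> c * v 0 * B"
proof -
  from between_rhs[OF w] obtain \<kappa> where \<kappa>: "\<And>j. \<kappa> j \<in> dK_set L K (x k - x j)"
    "dpa_rhs W v c L N (\<lambda>_. \<kappa>) x k = w" by blast
  have "\<bar>\<Sum>j\<in>{..<N} - {k}. \<kappa> j\<bar> \<le> (\<Sum>j\<in>{..<N} - {k}. B)"
    using dK_set_bound[OF kernel L_pos torus_rep_nonzero[OF L_pos ord k] \<kappa>(1)]
    by (intro order_trans[OF sum_abs] sum_mono) auto
  also have "\<dots> \<le> real N * B" using kernel_bound(1)[OF kernel] k by (simp add: mult_right_mono)
  finally have s: "\<bar>\<Sum>j\<in>{..<N} - {k}. \<kappa> j\<bar> \<le> real N * B" .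
  have "w + real N / c * dpa_G W v c L N x k = - (c / real N * dpa_v v c L N x k * (\<Sum>j\<in>{..<N} - {k}. \<kappa> j))"
    using \<kappa>(2) by (simp add: dpa_rhs_def)
  also have "\<bar>\<dots>\<bar> = c / real N * dpa_v v c L N x k * \<bar>\<Sum>j\<in>{..<N} - {k}. \<kappa> j\<bar>"
    using dpa_v_bounds[OF ord k] c_pos by (simp add: abs_mult)
  also have "\<dots> \<le> c / real N * v 0 * (real N * B)"
    using dpa_v_bounds[OF ord k] c_pos s by (intro mult_mono) auto
  also have "\<dots> = c * v 0 * B" using N_pos by simp
  finally show ?thesis .
qed


section \<open>Entropy dissipation and compression\<close>

text \<open>The function \<open>\<psi>\<close> of the introduction.\<close>

definition excess :: "real \<Rightarrow> real \<Rightarrow> real" where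
  "excess M s = max 0 (\<phi> s - \<phi> M)"

lemma excess_nonneg: "0 \<le> excess M s"
  by (simp add: excess_def)

lemma excess_eq_0: "0 \<le> s \<Longrightarrow> s \<le> M \<Longrightarrow> excess M s = 0"
  using phi_mono[OF diffusion mobility, of s M] by (simp add: excess_def)

text \<open>The mobility cannot create a large flux \<open>s v(s)\<close> without diffusion of comparable strength; this
  lets the dissipation of the entropy control the compression.\<close>

lemma mobility_flux_le_excess:
  assumes "1 \<le> M" "0 < s"
  shows "s * v s \<le> excess M s + M * v 0"
proof (cases "s \<le> M")
  case True
  have "s * v s \<le> M * v 0"
    using assms True mobility_nonneg[OF mobility] mobility_antimono[OF mobility, of 0 s] by (intro mult_mono) auto
  then show ?thesis using excess_nonneg[of M s] by linarith
next
  case False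
  have "v s * (s - M) \<le> \<phi> s - \<phi> M"
    using False assms by (intro phi_growth[OF diffusion mobility]) auto
  moreover have "M * v s \<le> M * v 0"
    using assms mobility_antimono[OF mobility, of 0 s] by (intro mult_left_mono) auto
  ultimately show ?thesis unfolding excess_def by (simp add: algebra_simps)
qed

text \<open>The left-hand side is the time derivative of the entropy along velocities \<open>w\<close>, because the
  derivative of the entropy with respect to the gap \<open>k\<close> is \<open>- \<psi>\<^sub>k\<close>. Summation by parts turns it into
  \<open>\<Sum>\<^sub>k w\<^sub>k g\<^sub>k\<close> with \<open>g\<^sub>k = \<psi>\<^sub>k - \<psi>\<^sub>k\<^sub>-\<^sub>1\<close>. The diffusive part of \<open>w\<^sub>k\<close> contributes at most
  \<open>- (N / c) g\<^sub>k\<^sup>2\<close>, as \<open>\<psi>\<close> is a nondecreasing \<open>1\<close>-Lipschitz function of \<open>\<phi>\<close>, and half of this absorbs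
  the bounded interaction. The other half bounds \<open>\<psi>\<^sub>m\<^sup>2\<close> by the Cauchy-Schwarz inequality,
  since \<open>\<psi>\<close> vanishes somewhere.\<close>

lemma dissipation:
  assumes ord: "ordered L N x" and M: "c \<le> M * L"
    and w: "\<And>k. k < N \<Longrightarrow> vel_lo x k \<le> w k \<and> w k \<le> vel_hi x k" and m: "m < N"
  shows "- (\<Sum>k<N. excess M (dens x k) * (w (nxt k) - w k))
    \<le> (v 0)\<^sup>2 * B\<^sup>2 / 2 - (excess M (dens x m))\<^sup>2 / 2"
proof -
  define \<psi> where "\<psi> k = excess M (dens x k)" for k
  define g where "g k = \<psi> k - \<psi> (prv k)" for k
  define b where "b = c * v 0 * B"
  have "(\<Sum>k<N. \<psi> k * w (nxt k)) = (\<Sum>k<N. \<psi> (prv k) * w k)"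
    by (rule sum.reindex_bij_witness[of _ prv nxt])
       (auto simp: next_prev_index prev_next_index next_index_less prev_index_less)
  then have parts: "- (\<Sum>k<N. \<psi> k * (w (nxt k) - w k)) = (\<Sum>k<N. w k * g k)"
    by (simp add: g_def right_diff_distrib sum_subtractf mult.commute)
  have summand: "w k * g k \<le> b\<^sup>2 * c / (2 * real N) - real N / (2 * c) * (g k)\<^sup>2" if k: "k < N" for k
  proof -
    \<comment> \<open>\<open>g k\<close> and the increment of \<open>\<phi>\<close> have the same sign, and truncation only shrinks increments\<close>
    have G: "(g k)\<^sup>2 \<le> dpa_G W v c L N x k * g k"
    proof -
      have "0 \<le> g k \<and> g k \<le> dpa_G W v c L N x k \<or> g k \<le> 0 \<and> dpa_G W v c L N x k \<le> g k"
        by (auto simp: g_def \<psi>_def excess_def dpa_G_def max_def)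
      then show ?thesis
        unfolding power2_eq_square by (auto intro: mult_right_mono mult_right_mono_neg)
    qed
    have "w k * g k = (w k + real N / c * dpa_G W v c L N x k) * g k - real N / c * (dpa_G W v c L N x k * g k)"
      by (simp add: algebra_simps)
    also have "\<dots> \<le> b * \<bar>g k\<bar> - real N / c * (g k)\<^sup>2"
    proof (rule diff_mono)
      have "(w k + real N / c * dpa_G W v c L N x k) * g k \<le> \<bar>w k + real N / c * dpa_G W v c L N x k\<bar> * \<bar>g k\<bar>"
        unfolding abs_mult[symmetric] by (rule abs_ge_self)
      also have "\<dots> \<le> b * \<bar>g k\<bar>"
        unfolding b_def using vel_drift_bound[OF ord k, of "w k"] w[OF k] by (intro mult_right_mono) auto
      finally show "(w k + real N / c * dpa_G W v c L N x k) * g k \<le> b * \<bar>g k\<bar>" .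
      show "real N / c * (g k)\<^sup>2 \<le> real N / c * (dpa_G W v c L N x k * g k)"
        using G c_pos by (intro mult_left_mono) auto
    qed
    also have "\<dots> \<le> b\<^sup>2 * c / (2 * real N) - real N / (2 * c) * (g k)\<^sup>2"
    proof -
      \<comment> \<open>Young's inequality for \<open>b \<bar>g k\<bar>\<close>\<close>
      have "0 \<le> (b * c - real N * \<bar>g k\<bar>)\<^sup>2 / (2 * c * real N)" using c_pos by simp
      also have "\<dots> = b\<^sup>2 * c / (2 * real N) + real N / (2 * c) * (g k)\<^sup>2 - b * \<bar>g k\<bar>"
        using c_pos N_pos by (simp add: field_simps power2_eq_square)
      finally show ?thesis by (simp add: field_simps)
    qed
    finally show ?thesis .
  qed
  have "(\<Sum>k<N. w k * g k) \<le> (\<Sum>k<N. b\<^sup>2 * c / (2 * real N) - real N / (2 * c) * (g k)\<^sup>2)"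
    using summand by (intro sum_mono) auto
  also have "\<dots> = b\<^sup>2 * c / 2 - real N / (2 * c) * (\<Sum>k<N. (g k)\<^sup>2)"
    using N_pos by (simp add: sum_subtractf sum_distrib_left)
  also have "\<dots> \<le> (v 0)\<^sup>2 * B\<^sup>2 / 2 - (\<psi> m)\<^sup>2 / 2"
  proof (rule diff_mono)
    have "b\<^sup>2 * c = c ^ 3 * ((v 0)\<^sup>2 * B\<^sup>2)"
      by (simp add: b_def power_mult_distrib power2_eq_square power3_eq_cube)
    also have "\<dots> \<le> 1 * ((v 0)\<^sup>2 * B\<^sup>2)"
      using c_pos c_le_1 by (intro mult_right_mono power_le_one) auto
    finally show "b\<^sup>2 * c / 2 \<le> (v 0)\<^sup>2 * B\<^sup>2 / 2" by simp
    obtain i where i: "i < N" "L / real N \<le> gap x i" using exists_large_spacing[OF N_pos(1)] by blast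
    have "dens x i \<le> c / L"
    proof -
      have "L \<le> real N * gap x i" using i(2) N_pos by (simp add: field_simps)
      then show ?thesis using c_pos L_pos unfolding dpa_density_spacing by (intro divide_left_mono) auto
    qed
    also have "\<dots> \<le> M" using M L_pos by (simp add: field_simps)
    finally have "\<psi> i = 0" using dens_pos[OF ord i(1)] by (simp add: \<psi>_def excess_eq_0)
    then have "\<psi> m \<le> (\<Sum>l<N. \<bar>g l\<bar>)"
      using cyclic_variation[OF i(1) m, of \<psi>] by (simp add: g_def)
    then have "(\<psi> m)\<^sup>2 \<le> (\<Sum>l<N. \<bar>g l\<bar>)\<^sup>2"
      using excess_nonneg by (intro power_mono) (auto simp: \<psi>_def)
    also have "\<dots> \<le> real N * (\<Sum>l<N. (g l)\<^sup>2)"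
      using sum_squared_le_sum_of_squares[of "\<lambda>l. \<bar>g l\<bar>" "{..<N}"] by (simp add: mult.commute)
    also have "\<dots> \<le> real N / c * (\<Sum>l<N. (g l)\<^sup>2)"
    proof (rule mult_right_mono)
      show "real N \<le> real N / c" using c_pos c_le_1 by (simp add: le_divide_eq mult_left_le)
    qed (simp add: sum_nonneg)
    finally show "(\<psi> m)\<^sup>2 / 2 \<le> real N / (2 * c) * (\<Sum>k<N. (g k)\<^sup>2)" by simp
  qed
  finally show ?thesis unfolding parts[symmetric] by (simp add: \<psi>_def)
qed

text \<open>How the force exerted by \<open>j\<close> differs at the two ends of gap \<open>k\<close>. Lifting \<open>x\<^sub>k - x\<^sub>j\<close> to
  \<open>z \<in> (0, L)\<close>, the interval \<open>[z, z + d\<^sub>k]\<close> stays inside \<open>(0, L)\<close> and so avoids the origin of the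
  circle. If it also avoids the antipode \<open>L / 2\<close>, then the mean value theorem applies; otherwise both
  forces are bounded by \<open>B\<close>.\<close>

lemma kernel_difference:
  assumes ord: "ordered L N x" and k: "k < N" and j: "j < N" "j \<noteq> k" "j \<noteq> nxt k"
  defines "z \<equiv> x k - x j + (if j < k then 0 else L)"
  shows "dK_hi L K (x (nxt k) - x j) - dK_lo L K (x k - x j)
    \<le> B * gap x k + (if z \<le> L / 2 \<and> L / 2 \<le> z + gap x k then 2 * B else 0)"
proof -
  define d where "d = gap x k"
  have d: "0 < d" using ord k by (simp add: d_def ordered_iff_spacing)
  have np: "next_pos L N x k = x k + d" by (simp add: d_def spacing_def)
  have z: "0 < z" "z + d < L"
  proof -
    have "0 < z \<and> z + d < L"
    proof (cases "j < k")
      case True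
      have "x j < x k" using ordered_less[OF ord True k] by simp
      moreover have "next_pos L N x k < x j + L"
      proof (cases "Suc k < N")
        case True
        then show ?thesis using ordered_less(2)[OF ord, of j "Suc k"] \<open>j < k\<close> by (simp add: next_pos_def)
      next
        case False
        then have "0 < j" using j(3) by (simp add: next_index_def)
        then show ?thesis using False ordered_less(1)[OF ord, of 0 j] j by (simp add: next_pos_def)
      qed
      ultimately show ?thesis using True np by (simp add: z_def)
    next
      case False
      then have "k < j" using j by simp
      then have "Suc k < N" "Suc k < j" using j by (auto simp: next_index_def split: if_splits)
      moreover have "x j < x k + L" using ordered_less(2)[OF ord \<open>k < j\<close> j(1)] .
      ultimately show ?thesis
        using ordered_less(1)[OF ord \<open>Suc k < j\<close> j(1)] False np by (simp add: z_def next_pos_def)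
    qed
    then show "0 < z" "z + d < L" by auto
  qed
  have set1: "dK_set L K (x k - x j) = dK_set L K z"
    using dK_set_shift[OF L_pos, of K "x k - x j"] by (simp add: z_def add.commute)
  have set2: "dK_set L K (x (nxt k) - x j) = dK_set L K (z + d)"
  proof -
    have e: "x k + d - x j = x (nxt k) - x j + (if Suc k < N then 0 else L)"
      using np next_pos_eq[OF k, of L x] by simp
    have "dK_set L K (x k + d - x j) = dK_set L K (x (nxt k) - x j)"
      unfolding e by (simp add: dK_set_shift[OF L_pos])
    moreover have "dK_set L K (z + d) = dK_set L K (x k + d - x j)"
      using dK_set_shift[OF L_pos, of K "x k + d - x j"] by (simp add: z_def algebra_simps)
    ultimately show ?thesis by simp
  qed
  have eq: "dK_hi L K (x (nxt k) - x j) - dK_lo L K (x k - x j) = dK_hi L K (z + d) - dK_lo L K z"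
    by (simp add: dK_hi_def dK_lo_def set1 set2)
  have single: "dK_lo L K y = deriv K (torus_rep L y) \<and> dK_hi L K y = deriv K (torus_rep L y)"
    if "torus_rep L y \<noteq> - L / 2" for y using that by (simp add: dK_lo_def dK_hi_def dK_set_def)
  note B0 = kernel_bound(1)[OF kernel]
  consider "z + d < L / 2" | "L / 2 < z" | "z \<le> L / 2" "L / 2 \<le> z + d" by linarith
  then have "dK_hi L K (z + d) - dK_lo L K z \<le> B * d + (if z \<le> L / 2 \<and> L / 2 \<le> z + d then 2 * B else 0)"
  proof cases
    case 1
    then have "torus_rep L z = z" "torus_rep L (z + d) = z + d"
      using z d L_pos by (auto intro!: torus_rep_eqI[of L _ _ 0])
    moreover have "\<bar>deriv K (z + d) - deriv K z\<bar> \<le> B * (z + d - z)"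
      using z d by (intro deriv_kernel_lipschitz[OF kernel]) auto
    ultimately show ?thesis using single[of z] single[of "z + d"] 1 z d by (auto simp: abs_le_iff)
  next
    case 2
    then have "torus_rep L z = z - L" "torus_rep L (z + d) = z + d - L"
      using z d L_pos by (auto intro!: torus_rep_eqI[of L _ _ 1])
    moreover have "\<bar>deriv K (z + d - L) - deriv K (z - L)\<bar> \<le> B * (z + d - L - (z - L))"
      using z d by (intro deriv_kernel_lipschitz[OF kernel]) auto
    ultimately show ?thesis using single[of z] single[of "z + d"] 2 z d by (auto simp: abs_le_iff)
  next
    case 3
    have nz: "torus_rep L y \<noteq> 0" if "0 < y" "y < L" for y
    proof (cases "y < L / 2")
      case True
      then have "torus_rep L y = y" using that L_pos by (intro torus_rep_eqI[of L _ _ 0]) auto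
      then show ?thesis using that by simp
    next
      case False
      then have "torus_rep L y = y - L" using that L_pos by (intro torus_rep_eqI[of L _ _ 1]) auto
      then show ?thesis using that by simp
    qed
    have "\<bar>dK_hi L K (z + d)\<bar> \<le> B"
      using z d dK_lo_le_hi by (intro dK_set_bound[OF kernel L_pos nz, of "z + d"]) (auto simp: dK_set_eq)
    moreover have "\<bar>dK_lo L K z\<bar> \<le> B"
      using z d dK_lo_le_hi by (intro dK_set_bound[OF kernel L_pos nz, of z]) (auto simp: dK_set_eq)
    ultimately show ?thesis using 3 d B0 by (auto simp: abs_le_iff intro: add_increasing)
  qed
  then show ?thesis unfolding eq d_def .
qed

text \<open>At the smallest gap both mobilities equal \<open>v(\<rho>\<^sub>k)\<close>, and the two diffusion terms have the sign that
  opens the gap. In the difference of the interaction sums the pair \<open>{k, k + 1}\<close> contributes at most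
  \<open>2 B\<close>, the at most two particles antipodal to the gap \<open>2 B\<close> each, and all others together
  \<open>N B d\<^sub>k\<close>.\<close>

lemma compression_at_min_gap:
  assumes ord: "ordered L N x" and M: "1 \<le> M"
    and w: "\<And>k. k < N \<Longrightarrow> vel_lo x k \<le> w k \<and> w k \<le> vel_hi x k"
    and k: "k < N" and min: "\<And>j. j < N \<Longrightarrow> gap x k \<le> gap x j"
  shows "- (w (nxt k) - w k) / gap x k \<le> 7 * M * v 0 * B + 6 * B * excess M (dens x k)"
proof -
  define d where "d = gap x k"
  define \<rho> where "\<rho> = dens x k"
  note k' = next_index_less[OF k]
  have d: "0 < d" using ord k by (simp add: d_def ordered_iff_spacing)
  have \<rho>: "0 < \<rho>" using dens_pos[OF ord k] by (simp add: \<rho>_def)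
  have \<rho>_max: "dens x j \<le> \<rho>" if "j < N" for j
    unfolding \<rho>_def dpa_density_spacing
    using min[OF that] d c_pos N_pos by (intro divide_left_mono) (auto simp: d_def)
  have V: "dpa_v v c L N x k = v \<rho>" "dpa_v v c L N x (nxt k) = v \<rho>"
    using \<rho>_max[OF k'] \<rho>_max[OF prev_index_less[OF k]] prev_next_index[OF k]
    by (simp_all add: dpa_v_def \<rho>_def max_absorb1 max_absorb2)
  have G: "0 \<le> dpa_G W v c L N x k" "dpa_G W v c L N x (nxt k) \<le> 0"
    using \<rho>_max[OF k'] \<rho>_max[OF prev_index_less[OF k]] prev_next_index[OF k]
      dens_pos[OF ord k'] dens_pos[OF ord prev_index_less[OF k]]
    by (auto simp: dpa_G_def \<rho>_def intro!: phi_mono[OF diffusion mobility])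
  define S1 where "S1 = (\<Sum>j\<in>{..<N} - {nxt k}. dK_hi L K (x (nxt k) - x j))"
  define S0 where "S0 = (\<Sum>j\<in>{..<N} - {k}. dK_lo L K (x k - x j))"
  define p where "p = c / real N * v \<rho>"
  have p: "0 \<le> p" using c_pos mobility_nonneg[OF mobility, of \<rho>] \<rho> by (simp add: p_def)
  have "- (p * S1) \<le> w (nxt k)"
  proof -
    have "real N / c * dpa_G W v c L N x (nxt k) \<le> 0" using G(2) c_pos by (simp add: mult_nonneg_nonpos divide_nonpos_pos)
    moreover have "vel_lo x (nxt k) = - (p * S1) - real N / c * dpa_G W v c L N x (nxt k)"
      by (simp add: vel_lo_def dpa_rhs_def V p_def S1_def)
    ultimately show ?thesis using w[OF k'] by simp
  qed
  moreover have "w k \<le> - (p * S0)"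
  proof -
    have "0 \<le> real N / c * dpa_G W v c L N x k" using G(1) c_pos by simp
    moreover have "vel_hi x k = - (p * S0) - real N / c * dpa_G W v c L N x k"
      by (simp add: vel_hi_def dpa_rhs_def V p_def S0_def)
    ultimately show ?thesis using w[OF k] by simp
  qed
  ultimately have comp: "- (w (nxt k) - w k) \<le> p * (S1 - S0)" by (simp add: algebra_simps)
  define A where "A = {..<N} - {k, nxt k}"
  define z where "z j = x k - x j + (if j < k then 0 else L)" for j
  define Cr where "Cr = {j \<in> A. z j \<le> L / 2 \<and> L / 2 \<le> z j + d}"
  note B0 = kernel_bound(1)[OF kernel]
  have "card Cr \<le> 2"
  proof (rule card_separated_le_2[of _ d z "L / 2 - d"])
    show "finite Cr" by (simp add: Cr_def A_def)
    have sep: "d \<le> \<bar>z i - z j\<bar>" if "i < j" "i \<in> Cr" "j \<in> Cr" for i j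
    proof -
      have ij: "x i + d \<le> x j" "x j + d \<le> x i + L"
        using spacing_separates[of N d L x i j] min d that by (auto simp: d_def Cr_def A_def)
      have "i \<noteq> k" "j \<noteq> k" using that by (auto simp: Cr_def A_def)
      then show ?thesis using ij d that(1) by (auto simp: z_def abs_if)
    qed
    show "d \<le> \<bar>z i - z j\<bar>" if "i \<in> Cr" "j \<in> Cr" "i \<noteq> j" for i j
      using sep[of i j] sep[of j i] that by (cases i j rule: linorder_cases) (auto simp: abs_minus_commute)
  qed (use d in \<open>auto simp: Cr_def\<close>)
  have split1: "{..<N} - {nxt k} = insert k A" "{..<N} - {k} = insert (nxt k) A"
    using k k' next_index_neq[OF N_ge k] by (auto simp: A_def)
  have fin: "finite A" "k \<notin> A" "nxt k \<notin> A" by (auto simp: A_def)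
  have "S1 - S0 = (dK_hi L K (x (nxt k) - x k) - dK_lo L K (x k - x (nxt k)))
     + (\<Sum>j\<in>A. dK_hi L K (x (nxt k) - x j) - dK_lo L K (x k - x j))"
    unfolding S1_def S0_def split1 using fin by (simp add: sum_subtractf)
  also have "\<dots> \<le> 2 * B + (\<Sum>j\<in>A. B * d + (if j \<in> Cr then 2 * B else 0))"
  proof (rule add_mono)
    have "dK_hi L K (x (nxt k) - x k) \<in> dK_set L K (x (nxt k) - x k)"
      "dK_lo L K (x k - x (nxt k)) \<in> dK_set L K (x k - x (nxt k))"
      using dK_lo_le_hi by (auto simp: dK_set_eq)
    then have "\<bar>dK_hi L K (x (nxt k) - x k)\<bar> \<le> B" "\<bar>dK_lo L K (x k - x (nxt k))\<bar> \<le> B"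
      using dK_set_bound[OF kernel L_pos torus_rep_nonzero[OF L_pos ord]] k k' next_index_neq[OF N_ge k]
      by metis+
    then show "dK_hi L K (x (nxt k) - x k) - dK_lo L K (x k - x (nxt k)) \<le> 2 * B" by linarith
    show "(\<Sum>j\<in>A. dK_hi L K (x (nxt k) - x j) - dK_lo L K (x k - x j)) \<le> (\<Sum>j\<in>A. B * d + (if j \<in> Cr then 2 * B else 0))"
    proof (rule sum_mono)
      fix j assume j: "j \<in> A"
      then have "j < N" "j \<noteq> k" "j \<noteq> nxt k" by (auto simp: A_def)
      from kernel_difference[OF ord k this] j
      show "dK_hi L K (x (nxt k) - x j) - dK_lo L K (x k - x j) \<le> B * d + (if j \<in> Cr then 2 * B else 0)"
        by (simp add: Cr_def z_def d_def)
    qed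
  qed
  also have "\<dots> = 2 * B + real (card A) * (B * d) + real (card Cr) * (2 * B)"
  proof -
    have "A \<inter> {j. j \<in> Cr} = Cr" by (auto simp: Cr_def)
    then show ?thesis using fin by (simp add: sum.distrib sum.If_cases)
  qed
  also have "\<dots> \<le> 2 * B + real N * (B * d) + 2 * (2 * B)"
  proof (intro add_mono order_refl mult_right_mono)
    have "card A \<le> card {..<N}" by (intro card_mono) (auto simp: A_def)
    then show "real (card A) \<le> real N" by simp
    show "real (card Cr) \<le> 2" using \<open>card Cr \<le> 2\<close> by simp
  qed (use B0 d in auto)
  finally have "S1 - S0 \<le> real N * (B * d) + 6 * B" by simp
  then have "p * (S1 - S0) / d \<le> p * (real N * (B * d) + 6 * B) / d"
    using p d by (intro divide_right_mono mult_left_mono) auto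
  also have "\<dots> = c * (v \<rho> * B) + 6 * B * (\<rho> * v \<rho>)"
    using d N_pos by (simp add: p_def \<rho>_def dpa_density_spacing d_def[symmetric] field_simps)
  also have "\<dots> \<le> M * (v 0 * B) + 6 * B * (excess M \<rho> + M * v 0)"
  proof (intro add_mono mult_mono mult_left_mono)
    show "v \<rho> \<le> v 0" using mobility_antimono[OF mobility, of 0 \<rho>] \<rho> by simp
    show "\<rho> * v \<rho> \<le> excess M \<rho> + M * v 0" by (rule mobility_flux_le_excess[OF M \<rho>])
  qed (use M c_pos c_le_1 B0 mobility_nonneg[OF mobility] \<rho> in auto)
  also have "\<dots> = 7 * M * v 0 * B + 6 * B * excess M \<rho>" by (simp add: algebra_simps)
  finally have "p * (S1 - S0) / d \<le> 7 * M * v 0 * B + 6 * B * excess M \<rho>" .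
  moreover have "- (w (nxt k) - w k) / d \<le> p * (S1 - S0) / d"
    using comp d by (intro divide_right_mono) auto
  ultimately show ?thesis by (simp add: d_def \<rho>_def)
qed


section \<open>The a priori bound\<close>

text \<open>No gap exceeds \<open>L\<close>; the upper limit \<open>L + 1\<close> makes all gaps interior points.\<close>

definition entropy :: "real \<Rightarrow> real \<Rightarrow> real" where
  "entropy M d = integral {d..L + 1} (\<lambda>s. excess M (c / (real N * s)))"

lemma excess_continuous: "0 < a \<Longrightarrow> continuous_on {a..} (\<lambda>s. excess M (c / (real N * s)))"
proof -
  assume a: "0 < a"
  have "continuous_on {a..} (\<lambda>s. \<phi> (c / (real N * s)))"
    using a c_pos N_pos
    by (intro continuous_on_compose2[OF phi_continuous[OF diffusion mobility]] continuous_intros) auto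
  then show ?thesis unfolding excess_def by (intro continuous_intros)
qed

lemma entropy_nonneg: "0 < d \<Longrightarrow> 0 \<le> entropy M d"
  unfolding entropy_def using excess_nonneg
  by (intro integral_nonneg integrable_continuous_real continuous_on_subset[OF excess_continuous]) auto

lemma entropy_eq_0:
  assumes "1 \<le> M" "c / (real N * M) \<le> d"
  shows "entropy M d = 0"
proof -
  have "0 < c / (real N * M)" using assms c_pos N_pos by simp
  have "excess M (c / (real N * s)) = 0" if "d \<le> s" for s
  proof (rule excess_eq_0)
    have "0 < s" "c / (real N * M) \<le> s" using that assms(2) \<open>0 < c / (real N * M)\<close> by auto
    then show "0 \<le> c / (real N * s)" "c / (real N * s) \<le> M"
      using c_pos N_pos assms(1) by (simp_all add: field_simps)
  qed
  then have "entropy M d = integral {d..L + 1} (\<lambda>s. 0)"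
    unfolding entropy_def by (intro integral_cong) auto
  then show ?thesis by simp
qed

lemma entropy_derivative:
  assumes "0 < d" "d < L + 1"
  shows "(entropy M has_real_derivative - excess M (c / (real N * d))) (at d)"
proof -
  let ?g = "\<lambda>s. excess M (c / (real N * s))"
  let ?a = "d / 2"
  have c: "continuous_on {?a..L + 1} ?g"
    using assms by (intro continuous_on_subset[OF excess_continuous[of ?a]]) auto
  have "((\<lambda>y. integral {?a..y} ?g) has_real_derivative ?g d) (at d within {?a..L + 1})"
    using assms by (intro integral_has_real_derivative c) auto
  then have "((\<lambda>y. integral {?a..y} ?g) has_real_derivative ?g d) (at d)"
    using assms by (subst (asm) at_within_interior) (auto simp: interior_atLeastAtMost_real)
  then have "((\<lambda>y. integral {?a..L + 1} ?g - integral {?a..y} ?g) has_real_derivative - ?g d) (at d)"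
    by (auto intro!: derivative_eq_intros)
  then show ?thesis
  proof (rule has_field_derivative_transform_within_open)
    fix y assume y: "y \<in> {?a<..<L + 1}"
    have "integral {?a..y} ?g + integral {y..L + 1} ?g = integral {?a..L + 1} ?g"
      using y by (intro Henstock_Kurzweil_Integration.integral_combine integrable_continuous_real c) auto
    then show "integral {?a..L + 1} ?g - integral {?a..y} ?g = entropy M y"
      by (simp add: entropy_def)
  qed (use assms in auto)
qed

text \<open>At time \<open>t\<close> all limits of right difference quotients of \<open>X k\<close> are velocities admissible for the
  configuration at time \<open>t\<close>.\<close>

definition follows :: "(nat \<Rightarrow> real \<Rightarrow> real) \<Rightarrow> real \<Rightarrow> bool" where
  "follows X t \<longleftrightarrow> (\<forall>k<N. \<forall>e>0. \<forall>\<^sub>F s in at_right t.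
     (vel_lo (\<lambda>i. X i t) k - e) * (s - t) \<le> X k s - X k t \<and>
     X k s - X k t \<le> (vel_hi (\<lambda>i. X i t) k + e) * (s - t))"

definition growth_rate :: "real \<Rightarrow> real" where
  "growth_rate M = 7 * M * v 0 * B + 18 * B\<^sup>2 + (v 0)\<^sup>2 * B\<^sup>2 / 2"

text \<open>Its maximum over \<open>k\<close>, attained at the smallest gap, is the quantity that grows at most
  linearly.\<close>

definition lyapunov :: "real \<Rightarrow> nat \<Rightarrow> (nat \<Rightarrow> real) \<Rightarrow> real" where
  "lyapunov M k x = - ln (gap x k) + (\<Sum>j<N. entropy M (gap x j))"

lemma vel_lo_le_hi: "ordered L N x \<Longrightarrow> k < N \<Longrightarrow> vel_lo x k \<le> vel_hi x k"
  using rhs_between(1)[of x k "\<lambda>k j. dK_lo L K (x k - x j)"] dK_lo_le_hi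
  by (simp add: vel_hi_def dK_set_eq)

text \<open>Difference quotients are within \<open>\<eta>\<close> of admissible velocities, for which \<open>dissipation\<close> and
  \<open>compression_at_min_gap\<close> apply. The linear term \<open>6 B \<psi>\<^sub>k\<close> of the latter is absorbed by the quadratic
  term \<open>- \<psi>\<^sub>k\<^sup>2 / 2\<close> of the former, at the price of \<open>18 B\<^sup>2\<close>.\<close>

lemma lyapunov_dini:
  assumes ord: "ordered L N (\<lambda>i. X i t)" and fol: "follows X t"
    and M: "1 \<le> M" "c \<le> M * L" and k: "k < N"
    and min: "\<And>j. j < N \<Longrightarrow> gap (\<lambda>i. X i t) k \<le> gap (\<lambda>i. X i t) j" and e: "0 < e"
  shows "\<forall>\<^sub>F s in at_right t.
    lyapunov M k (\<lambda>i. X i s) - lyapunov M k (\<lambda>i. X i t) \<le> (growth_rate M + e) * (s - t)"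
proof -
  define x where "x = (\<lambda>i. X i t)"
  note ord = ord[folded x_def] and min = min[folded x_def]
  define g where "g j s = gap (\<lambda>i. X i s) j" for j s
  define \<psi> where "\<psi> j = excess M (dens x j)" for j
  have gx: "g j t = gap x j" for j by (simp add: g_def x_def)
  have g_pos: "0 < g j t" if "j < N" for j using ord that by (simp add: gx ordered_iff_spacing)
  have \<psi>0: "0 \<le> \<psi> j" for j by (simp add: \<psi>_def excess_nonneg)
  \<comment> \<open>the factor by which errors of size \<open>\<eta>\<close> in velocities and in first-order expansions are amplified\<close>
  define Q where "Q = real N + 1 + 2 / g k t + 2 * (\<Sum>j<N. \<psi> j)"
  have Q: "0 < Q" using g_pos[OF k] \<psi>0 N_pos by (auto simp: Q_def intro!: add_pos_nonneg sum_nonneg)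
  define \<eta> where "\<eta> = e / Q"
  have \<eta>: "0 < \<eta>" "\<eta> * Q = e" using Q e by (simp_all add: \<eta>_def)
  define R where "R = (\<Sum>j<N. \<bar>vel_lo x j\<bar> + \<bar>vel_hi x j\<bar>) + \<eta>"
  have later: "\<forall>\<^sub>F s in at_right t. t < s" by (simp add: eventually_at_right_less)
  define q where "q j s = (X j s - X j t) / (s - t)" for j s
  have ev_q: "\<forall>\<^sub>F s in at_right t. \<forall>j\<in>{..<N}. vel_lo x j - \<eta> \<le> q j s \<and> q j s \<le> vel_hi x j + \<eta>"
  proof (intro eventually_ball_finite ballI)
    fix j assume "j \<in> {..<N}"
    then have "\<forall>\<^sub>F s in at_right t. (vel_lo x j - \<eta>) * (s - t) \<le> X j s - X j t \<and>
        X j s - X j t \<le> (vel_hi x j + \<eta>) * (s - t)"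
      using fol \<eta>(1) by (simp add: follows_def x_def)
    with later show "\<forall>\<^sub>F s in at_right t. vel_lo x j - \<eta> \<le> q j s \<and> q j s \<le> vel_hi x j + \<eta>"
      by eventually_elim (simp add: q_def field_simps)
  qed simp
  have g_incr: "g j s - g j t = (q (nxt j) s - q j s) * (s - t)" if "t < s" "j < N" for j s
  proof -
    have "q i s * (s - t) = X i s - X i t" for i using that by (simp add: q_def)
    then show ?thesis
      using that spacing_increment[of j N L "\<lambda>i. X i s" "\<lambda>i. X i t"]
      by (simp add: g_def left_diff_distrib)
  qed
  have ev_lip: "\<forall>\<^sub>F s in at_right t. \<bar>g j s - g j t\<bar> \<le> (2 * R) * (s - t)" if j: "j < N" for j
    using ev_q later
  proof eventually_elim
    case (elim s)
    have qR: "\<bar>q i s\<bar> \<le> R" if "i < N" for i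
    proof -
      have "\<bar>vel_lo x i\<bar> + \<bar>vel_hi x i\<bar> \<le> (\<Sum>j<N. \<bar>vel_lo x j\<bar> + \<bar>vel_hi x j\<bar>)"
        using that by (intro member_le_sum) auto
      then show ?thesis using elim(1) that \<eta>(1) by (force simp: R_def abs_le_iff)
    qed
    have "\<bar>q (nxt j) s - q j s\<bar> \<le> 2 * R" using qR[OF j] qR[OF next_index_less[OF j]] by linarith
    then show ?case using elim(2) by (simp add: g_incr[OF elim(2) j] abs_mult mult_right_mono)
  qed
  have ev_ent: "\<forall>\<^sub>F s in at_right t. \<forall>j\<in>{..<N}.
      \<bar>entropy M (g j s) - entropy M (g j t) - (- \<psi> j) * (g j s - g j t)\<bar> \<le> \<eta> * (s - t)"
  proof (intro eventually_ball_finite ballI)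
    fix j assume j: "j \<in> {..<N}"
    have "g j t < L + 1" using spacing_le_period[OF ord, of j] j by (simp add: gx)
    then have "(entropy M has_real_derivative - \<psi> j) (at (g j t))"
      using entropy_derivative[of "g j t" M] g_pos[of j] j by (simp add: \<psi>_def gx dpa_density_spacing)
    then show "\<forall>\<^sub>F s in at_right t.
      \<bar>entropy M (g j s) - entropy M (g j t) - (- \<psi> j) * (g j s - g j t)\<bar> \<le> \<eta> * (s - t)"
      using derivative_increment[OF _ ev_lip \<eta>(1)] j by blast
  qed simp
  have ev_ln: "\<forall>\<^sub>F s in at_right t. \<bar>ln (g k s) - ln (g k t) - (1 / g k t) * (g k s - g k t)\<bar> \<le> \<eta> * (s - t)"
    using g_pos[OF k] by (intro derivative_increment[OF _ ev_lip[OF k] \<eta>(1)]) (auto intro!: derivative_eq_intros)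
  show ?thesis using ev_q ev_ent ev_ln later
  proof eventually_elim
    case (elim s)
    \<comment> \<open>the admissible velocity closest to the difference quotient\<close>
    define w where "w j = max (vel_lo x j) (min (vel_hi x j) (q j s))" for j
    have w: "vel_lo x j \<le> w j \<and> w j \<le> vel_hi x j" "\<bar>q j s - w j\<bar> \<le> \<eta>" if "j < N" for j
      using vel_lo_le_hi[OF ord that] elim(1) that \<eta>(1) by (force simp: w_def max_def min_def abs_le_iff)+
    define \<Delta> where "\<Delta> j = (q (nxt j) s - q j s) - (w (nxt j) - w j)" for j
    have \<Delta>: "\<bar>\<Delta> j\<bar> \<le> 2 * \<eta>" if "j < N" for j
      using w(2)[OF that] w(2)[OF next_index_less[OF that]] by (simp add: \<Delta>_def abs_le_iff)
    have q\<Delta>: "q (nxt j) s - q j s = (w (nxt j) - w j) + \<Delta> j" for j by (simp add: \<Delta>_def)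
    have ent: "entropy M (g j s) - entropy M (g j t)
        \<le> (s - t) * (- (\<psi> j * (w (nxt j) - w j)) + 2 * \<eta> * \<psi> j + \<eta>)" if "j < N" for j
    proof -
      have "entropy M (g j s) - entropy M (g j t) \<le> - \<psi> j * (g j s - g j t) + \<eta> * (s - t)"
        using abs_le_D1[OF bspec[OF elim(2), of j]] that by (simp add: algebra_simps)
      also have "\<dots> = (s - t) * (- (\<psi> j * (w (nxt j) - w j)) + \<psi> j * (- \<Delta> j) + \<eta>)"
        unfolding g_incr[OF elim(4) that] q\<Delta> by (simp add: algebra_simps)
      also have "\<dots> \<le> (s - t) * (- (\<psi> j * (w (nxt j) - w j)) + \<psi> j * (2 * \<eta>) + \<eta>)"
        using \<Delta>[OF that] elim(4) \<psi>0 by (intro mult_left_mono add_mono) (auto simp: abs_le_iff)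
      finally show ?thesis by (simp add: mult_ac)
    qed
    have "- ln (g k s) + ln (g k t) \<le> - (1 / g k t) * (g k s - g k t) + \<eta> * (s - t)"
      using elim(3) by (auto simp: abs_le_iff)
    also have "\<dots> = (s - t) * (- (w (nxt k) - w k) / g k t + (- \<Delta> k) / g k t + \<eta>)"
      unfolding g_incr[OF elim(4) k] q\<Delta> by (simp add: algebra_simps add_divide_distrib diff_divide_distrib)
    also have "\<dots> \<le> (s - t) * (- (w (nxt k) - w k) / g k t + 2 * \<eta> / g k t + \<eta>)"
      using \<Delta>[OF k] elim(4) g_pos[OF k]
      by (intro mult_left_mono add_mono divide_right_mono) (auto simp: abs_le_iff)
    also have "\<dots> \<le> (s - t) * (7 * M * v 0 * B + 6 * B * \<psi> k + 2 * \<eta> / g k t + \<eta>)"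
      using compression_at_min_gap[OF ord M(1) w(1) k min] elim(4)
      by (intro mult_left_mono add_mono) (auto simp: gx \<psi>_def)
    finally have ln: "- ln (g k s) + ln (g k t) \<le> (s - t) * (7 * M * v 0 * B + 6 * B * \<psi> k + 2 * \<eta> / g k t + \<eta>)" .
    have "(\<Sum>j<N. entropy M (g j s)) - (\<Sum>j<N. entropy M (g j t))
        \<le> (\<Sum>j<N. (s - t) * (- (\<psi> j * (w (nxt j) - w j)) + 2 * \<eta> * \<psi> j + \<eta>))"
      unfolding sum_subtractf[symmetric] using ent by (intro sum_mono) auto
    also have "\<dots> = (s - t) * (- (\<Sum>j<N. \<psi> j * (w (nxt j) - w j)) + 2 * \<eta> * (\<Sum>j<N. \<psi> j) + real N * \<eta>)"
      by (simp add: sum_distrib_left[symmetric] sum.distrib sum_negf sum_subtractf)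
    also have "\<dots> \<le> (s - t) * ((v 0)\<^sup>2 * B\<^sup>2 / 2 - (\<psi> k)\<^sup>2 / 2 + 2 * \<eta> * (\<Sum>j<N. \<psi> j) + real N * \<eta>)"
      using dissipation[OF ord M(2) w(1) k] elim(4)
      by (intro mult_left_mono add_mono order_refl) (auto simp: \<psi>_def)
    finally have "lyapunov M k (\<lambda>i. X i s) - lyapunov M k (\<lambda>i. X i t)
       \<le> (s - t) * (7 * M * v 0 * B + 6 * B * \<psi> k + 2 * \<eta> / g k t + \<eta>) +
         (s - t) * ((v 0)\<^sup>2 * B\<^sup>2 / 2 - (\<psi> k)\<^sup>2 / 2 + 2 * \<eta> * (\<Sum>j<N. \<psi> j) + real N * \<eta>)"
      using ln by (simp add: lyapunov_def g_def)
    also have "\<dots> = (s - t) * (7 * M * v 0 * B + (v 0)\<^sup>2 * B\<^sup>2 / 2 + (6 * B * \<psi> k - (\<psi> k)\<^sup>2 / 2) + \<eta> * Q)"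
      by (simp add: Q_def algebra_simps)
    also have "\<dots> \<le> (s - t) * (7 * M * v 0 * B + (v 0)\<^sup>2 * B\<^sup>2 / 2 + 18 * B\<^sup>2 + \<eta> * Q)"
    proof -
      have "0 \<le> (\<psi> k - 6 * B)\<^sup>2 / 2" by simp
      then have "6 * B * \<psi> k - (\<psi> k)\<^sup>2 / 2 \<le> 18 * B\<^sup>2" by (simp add: power2_eq_square algebra_simps)
      then show ?thesis using elim(4) by (intro mult_left_mono) auto
    qed
    finally show ?case unfolding growth_rate_def \<eta>(2) by (simp add: algebra_simps)
  qed
qed

text \<open>The maximum principle for the Lyapunov functions. The entropy vanishes initially,
  since all initial densities are at most \<open>M\<close>, and it is nonnegative later.\<close>

lemma gap_lower_bound:
  assumes cont: "\<And>k. k < N \<Longrightarrow> continuous_on {0..\<tau>} (X k)"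
    and ord: "\<And>t. t \<in> {0..\<tau>} \<Longrightarrow> ordered L N (\<lambda>i. X i t)"
    and fol: "\<And>t. t \<in> {0..<\<tau>} \<Longrightarrow> follows X t"
    and M: "1 \<le> M" "c \<le> M * L"
    and init: "\<And>k. k < N \<Longrightarrow> c / (real N * M) \<le> gap (\<lambda>i. X i 0) k"
    and k: "k < N" and t: "t \<in> {0..\<tau>}"
  shows "c / (real N * M) * exp (- growth_rate M * t) \<le> gap (\<lambda>i. X i t) k"
proof -
  let ?m = "- ln (c / (real N * M))"
  have pos: "0 < c / (real N * M)" using c_pos N_pos M by simp
  have gpos: "0 < gap (\<lambda>i. X i t) k" if "k < N" "t \<in> {0..\<tau>}" for k t
    using ord[OF that(2)] that(1) by (simp add: ordered_iff_spacing)
  have gcont: "continuous_on {0..\<tau>} (\<lambda>s. gap (\<lambda>i. X i s) k)" if "k < N" for k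
    unfolding spacing_def next_pos_eq[OF that]
    by (intro continuous_intros cont that next_index_less)
  have "lyapunov M k (\<lambda>i. X i t) \<le> ?m + growth_rate M * t"
  proof (rule dini_growth_family[of "{..<N}" \<tau> "\<lambda>k s. lyapunov M k (\<lambda>i. X i s)"])
    show "continuous_on {0..\<tau>} (\<lambda>s. lyapunov M k (\<lambda>i. X i s))" if "k \<in> {..<N}" for k
    proof -
      have "continuous_on {0..\<tau>} (\<lambda>s. entropy M (gap (\<lambda>i. X i s) j))" if j: "j < N" for j
      proof (rule continuous_on_compose2[OF _ gcont[OF j]])
        show "continuous_on {0<..<L + 1} (entropy M)"
          by (intro continuous_at_imp_continuous_on ballI DERIV_isCont[OF entropy_derivative]) auto
        show "(\<lambda>s. gap (\<lambda>i. X i s) j) ` {0..\<tau>} \<subseteq> {0<..<L + 1}"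
          using gpos[OF j] spacing_le_period[OF ord j] by force
      qed
      then show ?thesis unfolding lyapunov_def
        using that gpos gcont by (intro continuous_intros) (auto simp: less_imp_neq[symmetric])
    qed
    show "lyapunov M k (\<lambda>i. X i 0) \<le> ?m" if "k \<in> {..<N}" for k
      using that init pos entropy_eq_0[OF M(1)] by (simp add: lyapunov_def ln_le_cancel_iff[THEN iffD2] order.strict_trans2)
    fix k t e assume "k \<in> {..<N}" "t \<in> {0..<\<tau>}" and e: "0 < (e::real)"
      and max: "\<And>j. j \<in> {..<N} \<Longrightarrow> lyapunov M j (\<lambda>i. X i t) \<le> lyapunov M k (\<lambda>i. X i t)"
    then have k: "k < N" and t: "t \<in> {0..\<tau>}" "t \<in> {0..<\<tau>}" by auto
    have "gap (\<lambda>i. X i t) k \<le> gap (\<lambda>i. X i t) j" if "j < N" for j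
      using max[of j] gpos[OF k t(1)] gpos[OF that t(1)] that by (simp add: lyapunov_def)
    then show "\<forall>\<^sub>F s in at_right t. lyapunov M k (\<lambda>i. X i s) - lyapunov M k (\<lambda>i. X i t)
        \<le> (growth_rate M + e) * (s - t)"
      using lyapunov_dini[OF ord fol M k _ e] t by blast
  qed (use k t in auto)
  moreover have "0 \<le> (\<Sum>j<N. entropy M (gap (\<lambda>i. X i t) j))"
    using gpos t by (intro sum_nonneg entropy_nonneg) auto
  ultimately have "ln (c / (real N * M)) - growth_rate M * t \<le> ln (gap (\<lambda>i. X i t) k)"
    by (simp add: lyapunov_def)
  then have "exp (ln (c / (real N * M)) - growth_rate M * t) \<le> gap (\<lambda>i. X i t) k"
    using gpos[OF k t] by (simp add: ln_ge_iff)
  then show ?thesis using pos by (simp add: exp_diff exp_minus divide_inverse mult.commute)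
qed


section \<open>Integrated solutions and difference quotients\<close>

text \<open>The two ingredients of an integrated solution, for forces \<open>\<kappa> k j t\<close>.\<close>

abbreviation admissible_forces :: "(nat \<Rightarrow> nat \<Rightarrow> real \<Rightarrow> real) \<Rightarrow> (nat \<Rightarrow> real \<Rightarrow> real) \<Rightarrow> real \<Rightarrow> bool" where
  "admissible_forces \<kappa> X t \<equiv> (\<forall>k<N. \<forall>j<N. j \<noteq> k \<longrightarrow> \<kappa> k j t \<in> dK_set L K (X k t - X j t))"

abbreviation moves_by :: "(nat \<Rightarrow> nat \<Rightarrow> real \<Rightarrow> real) \<Rightarrow> (nat \<Rightarrow> real \<Rightarrow> real) \<Rightarrow> real \<Rightarrow> bool" where
  "moves_by \<kappa> X t \<equiv> (\<forall>k<N.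
     ((\<lambda>s. dpa_rhs W v c L N (\<lambda>k j. \<kappa> k j s) (\<lambda>i. X i s) k) has_integral (X k t - X k 0)) {0..t})"

lemma integral_solution_continuous:
  assumes "\<And>t. t \<in> {0..u} \<Longrightarrow> moves_by \<kappa> X t" "0 \<le> u" "k < N"
  shows "continuous_on {0..u} (X k)"
proof -
  let ?f = "\<lambda>s. dpa_rhs W v c L N (\<lambda>k j. \<kappa> k j s) (\<lambda>i. X i s) k"
  have int: "(?f has_integral (X k t - X k 0)) {0..t}" if "t \<in> {0..u}" for t
    by (rule assms(1)[OF that, rule_format, OF assms(3)])
  have "continuous_on {0..u} (\<lambda>t. X k 0 + integral {0..t} ?f)"
    using int[of u] \<open>0 \<le> u\<close>
    by (intro continuous_intros indefinite_integral_continuous_1) (auto simp: integrable_on_def)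
  then show ?thesis
  proof (rule continuous_on_eq)
    show "X k 0 + integral {0..t} ?f = X k t" if "t \<in> {0..u}" for t
      using integral_unique[OF int[OF that]] by simp
  qed
qed

text \<open>A difference quotient is an average of velocities admissible for nearby configurations; by
  semicontinuity these are almost admissible for the present one.\<close>

lemma integral_solution_follows:
  assumes ord: "\<And>t. t \<in> {0..u} \<Longrightarrow> ordered L N (\<lambda>i. X i t)"
    and \<kappa>: "\<And>t. t \<in> {0..u} \<Longrightarrow> admissible_forces \<kappa> X t"
    and int: "\<And>t. t \<in> {0..u} \<Longrightarrow> moves_by \<kappa> X t"
    and t: "t \<in> {0..<u}"
  shows "follows X t"
  unfolding follows_def
proof (intro allI impI)
  fix k e assume k: "k < N" and e: "0 < (e::real)"
  define x where "x = (\<lambda>i. X i t)"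
  have "t < u" using t by simp
  let ?f = "\<lambda>s. dpa_rhs W v c L N (\<lambda>k j. \<kappa> k j s) (\<lambda>i. X i s) k"
  have lim: "(X i \<longlongrightarrow> x i) (at_right t)" if "i < N" for i
  proof -
    have "continuous_on {t..u} (X i)"
      using t by (intro continuous_on_subset[OF integral_solution_continuous[OF int _ that]]) auto
    then have "(X i \<longlongrightarrow> X i t) (at t within {t..u})" using t by (auto simp: continuous_on_def)
    then show ?thesis using t by (simp add: x_def at_within_Icc_at_right)
  qed
  have "filterlim (\<lambda>s i. X i s) (near N x) (at_right t)" by (intro filterlim_near lim)
  from eventually_compose_filterlim[OF vel_usc[OF _ k e] this]
  have "\<forall>\<^sub>F s in at_right t. vel_lo x k - e \<le> vel_lo (\<lambda>i. X i s) k \<and> vel_hi (\<lambda>i. X i s) k \<le> vel_hi x k + e"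
    using ord[of t] t by (simp add: x_def)
  then obtain b where b: "t < b" "\<And>s. t < s \<Longrightarrow> s < b \<Longrightarrow>
      vel_lo x k - e \<le> vel_lo (\<lambda>i. X i s) k \<and> vel_hi (\<lambda>i. X i s) k \<le> vel_hi x k + e"
    unfolding eventually_at_right[OF \<open>t < u\<close>] by blast
  have "(vel_lo x k - e) * (s - t) \<le> X k s - X k t \<and> X k s - X k t \<le> (vel_hi x k + e) * (s - t)"
    if s: "t < s" "s < min b u" for s
  proof -
    have i: "(?f has_integral (X k s - X k t)) {t..s}"
    proof (rule indefinite_integral_increment)
      show "(?f has_integral (X k r - X k 0)) {0..r}" if "r \<in> {0..u}" for r
        by (rule int[OF that, rule_format, OF k])
    qed (use s t in auto)
    have f: "vel_lo x k - e \<le> ?f r \<and> ?f r \<le> vel_hi x k + e" if r: "r \<in> {t..s}" for r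
    proof -
      have ru: "r \<in> {0..u}" using r s t by auto
      have "vel_lo (\<lambda>i. X i r) k \<le> ?f r" "?f r \<le> vel_hi (\<lambda>i. X i r) k"
        using \<kappa>[OF ru] k by (auto intro!: rhs_between[OF ord[OF ru] k])
      moreover have "vel_lo x k - e \<le> vel_lo (\<lambda>i. X i r) k \<and> vel_hi (\<lambda>i. X i r) k \<le> vel_hi x k + e"
        using b(2)[of r] r s e by (cases "r = t") (auto simp: x_def)
      ultimately show ?thesis by linarith
    qed
    have cst: "((\<lambda>r. a) has_integral a * (s - t)) {t..s}" for a :: real
      using has_integral_const_real[of a t s] s by (simp add: mult.commute)
    show ?thesis
      using has_integral_le[OF cst i] has_integral_le[OF i cst] f by auto
  qed
  then show "\<forall>\<^sub>F s in at_right t. (vel_lo (\<lambda>i. X i t) k - e) * (s - t) \<le> X k s - X k t \<and>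
      X k s - X k t \<le> (vel_hi (\<lambda>i. X i t) k + e) * (s - t)"
    using b(1) t unfolding x_def
    by (auto simp: eventually_at_right[of t "min b u"] intro!: exI[of _ "min b u"])
qed

text \<open>Large velocities need large densities, that is, small gaps.\<close>

lemma vel_bound:
  assumes "0 < \<eta>"
  obtains R where "0 \<le> R" "\<And>x k w. \<lbrakk>\<And>j. j < N \<Longrightarrow> \<eta> \<le> gap x j; k < N; vel_lo x k \<le> w; w \<le> vel_hi x k\<rbrakk> \<Longrightarrow> \<bar>w\<bar> \<le> R"
proof -
  define r where "r = c / (real N * \<eta>)"
  define R where "R = c * v 0 * B + real N / c * \<phi> r"
  have r0: "0 < r" using c_pos N_pos assms by (simp add: r_def)
  have "\<phi> 0 = 0" by (simp add: phi_def)
  then have \<phi>0: "0 \<le> \<phi> s" if "0 \<le> s" for s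
    using phi_mono[OF diffusion mobility order_refl that] by simp
  have R0: "0 \<le> R"
    unfolding R_def using c_pos mobility_nonneg[OF mobility, of 0] kernel_bound(1)[OF kernel] \<phi>0[OF less_imp_le[OF r0]]
    by simp
  show thesis
  proof (rule that[OF R0])
    fix x k w assume gap: "\<And>j. j < N \<Longrightarrow> \<eta> \<le> gap x j" and k: "k < N" and w: "vel_lo x k \<le> w" "w \<le> vel_hi x k"
    have ord: "ordered L N x"
      unfolding ordered_iff_spacing using gap assms order.strict_trans2 by blast
    have d: "0 \<le> \<phi> (dens x j)" "\<phi> (dens x j) \<le> \<phi> r" if "j < N" for j
    proof -
      have "dens x j \<le> r" unfolding dpa_density_spacing r_def
        using gap[OF that] assms c_pos N_pos ord that
        by (intro divide_left_mono mult_left_mono) (simp_all add: ordered_iff_spacing)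
      then show "0 \<le> \<phi> (dens x j)" "\<phi> (dens x j) \<le> \<phi> r"
        using dens_pos[OF ord that] by (simp_all add: \<phi>0 phi_mono[OF diffusion mobility])
    qed
    have "\<bar>dpa_G W v c L N x k\<bar> \<le> \<phi> r"
      using d[OF k] d[OF prev_index_less[OF k]] unfolding dpa_G_def by linarith
    then have "real N / c * \<bar>dpa_G W v c L N x k\<bar> \<le> real N / c * \<phi> r"
      using c_pos by (intro mult_left_mono) simp_all
    then have G: "\<bar>real N / c * dpa_G W v c L N x k\<bar> \<le> real N / c * \<phi> r"
      using c_pos by (simp add: abs_mult)
    have "\<bar>w\<bar> \<le> \<bar>w + g\<bar> + \<bar>g\<bar>" for g by linarith
    from order_trans[OF this add_mono[OF vel_drift_bound[OF ord k w] G]]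
    show "\<bar>w\<bar> \<le> R" unfolding R_def .
  qed
qed

lemma follows_lipschitz:
  assumes cont: "continuous_on {0..\<tau>} (X k)" and k: "k < N"
    and fol: "\<And>t. t \<in> {0..<\<tau>} \<Longrightarrow> follows X t"
    and R: "\<And>t. t \<in> {0..<\<tau>} \<Longrightarrow> - R \<le> vel_lo (\<lambda>i. X i t) k \<and> vel_hi (\<lambda>i. X i t) k \<le> R"
    and st: "s \<in> {0..\<tau>}" "t \<in> {0..\<tau>}"
  shows "\<bar>X k s - X k t\<bar> \<le> R * \<bar>s - t\<bar>"
proof -
  have *: "\<bar>X k t - X k s\<bar> \<le> R * (t - s)" if st: "0 \<le> s" "s \<le> t" "t \<le> \<tau>" for s t
  proof -
    have dini: "\<forall>\<^sub>F r in at_right q. - ((R + e) * (r - q)) \<le> X k r - X k q \<and> X k r - X k q \<le> (R + e) * (r - q)"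
      if q: "q \<in> {0..<\<tau>}" and e: "0 < e" for q e
    proof -
      have "\<forall>\<^sub>F r in at_right q. (vel_lo (\<lambda>i. X i q) k - e) * (r - q) \<le> X k r - X k q \<and>
          X k r - X k q \<le> (vel_hi (\<lambda>i. X i q) k + e) * (r - q)"
        using fol[OF q] k e by (simp add: follows_def)
      moreover have "\<forall>\<^sub>F r in at_right q. q < r" by (simp add: eventually_at_right_less)
      ultimately show ?thesis
      proof eventually_elim
        case (elim r)
        have "(- (R + e)) * (r - q) \<le> (vel_lo (\<lambda>i. X i q) k - e) * (r - q)"
          "(vel_hi (\<lambda>i. X i q) k + e) * (r - q) \<le> (R + e) * (r - q)"
          using R[OF q] elim by (intro mult_right_mono; simp)+
        then show ?case using elim by (simp only: mult_minus_left) linarith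
      qed
    qed
    have "X k t - X k s \<le> R * (t - s)"
    proof (rule dini_increment_le[OF cont _ st])
      show "\<forall>\<^sub>F r in at_right q. X k r - X k q \<le> (R + e) * (r - q)" if "q \<in> {0..<\<tau>}" "0 < e" for q e
        using dini[OF that] by (rule eventually_mono) simp
    qed
    moreover have "(- X k t) - (- X k s) \<le> R * (t - s)"
    proof (rule dini_increment_le[of 0 \<tau> "\<lambda>t. - X k t", OF continuous_on_minus[OF cont] _ st])
      show "\<forall>\<^sub>F r in at_right q. - X k r - - X k q \<le> (R + e) * (r - q)" if "q \<in> {0..<\<tau>}" "0 < e" for q e
        using dini[OF that] by (rule eventually_mono) simp
    qed
    ultimately show ?thesis by (simp add: abs_le_iff)
  qed
  show ?thesis using *[of s t] *[of t s] st by (cases "s \<le> t") (auto simp: abs_minus_commute)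
qed

text \<open>The velocities are bounded, so \<open>X\<close> is Lipschitz and has a density \<open>f\<close>, which almost everywhere
  is its right derivative and hence an admissible velocity. On the exceptional null set
  the velocity is chosen arbitrarily among the admissible ones, as forces have to be
  supplied at every time.\<close>

lemma follows_integral_solution:
  assumes "0 < T" and gap: "\<And>t k. t \<in> {0..T} \<Longrightarrow> k < N \<Longrightarrow> \<eta> \<le> gap (\<lambda>i. X i t) k" and \<eta>: "0 < \<eta>"
    and cont: "\<And>k. k < N \<Longrightarrow> continuous_on {0..T} (X k)"
    and fol: "\<And>t. t \<in> {0..<T} \<Longrightarrow> follows X t"
  obtains \<kappa> where "\<And>t. t \<in> {0..T} \<Longrightarrow> admissible_forces \<kappa> X t" "\<And>t. t \<in> {0..T} \<Longrightarrow> moves_by \<kappa> X t"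
proof -
  obtain R where R: "0 \<le> R" "\<And>x k w. \<lbrakk>\<And>j. j < N \<Longrightarrow> \<eta> \<le> gap x j; k < N; vel_lo x k \<le> w; w \<le> vel_hi x k\<rbrakk> \<Longrightarrow> \<bar>w\<bar> \<le> R"
    using vel_bound[OF \<eta>] by blast
  have ord: "ordered L N (\<lambda>i. X i t)" if "t \<in> {0..T}" for t
    using gap[OF that] \<eta> by (force simp: ordered_iff_spacing)
  have lo_hi: "vel_lo (\<lambda>i. X i t) k \<le> vel_hi (\<lambda>i. X i t) k" if "t \<in> {0..T}" "k < N" for t k
    using vel_lo_le_hi[OF ord] that by blast
  have lip: "\<bar>X k s - X k t\<bar> \<le> R * \<bar>s - t\<bar>" if k: "k < N" and st: "s \<in> {0..T}" "t \<in> {0..T}" for k s t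
  proof (rule follows_lipschitz[OF cont[OF k] k fol _ st])
    fix t assume "t \<in> {0..<T}"
    then have t: "t \<in> {0..T}" by simp
    show "- R \<le> vel_lo (\<lambda>i. X i t) k \<and> vel_hi (\<lambda>i. X i t) k \<le> R"
      using R(2)[of "\<lambda>i. X i t" k, OF gap[OF t] k order_refl lo_hi[OF t k]]
        R(2)[of "\<lambda>i. X i t" k, OF gap[OF t] k lo_hi[OF t k] order_refl] by linarith
  qed
  have "\<forall>k\<in>{..<N}. \<exists>f Z. negligible Z \<and> (\<forall>t\<in>{0..T}. (f has_integral (X k t - X k 0)) {0..t}) \<and>
      (\<forall>t\<in>{0..<T} - Z. ((\<lambda>s. (X k s - X k t) / (s - t)) \<longlongrightarrow> f t) (at_right t))"
  proof
    fix k assume "k \<in> {..<N}"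
    then have k: "k < N" by simp
    show "\<exists>f Z. negligible Z \<and> (\<forall>t\<in>{0..T}. (f has_integral (X k t - X k 0)) {0..t}) \<and>
      (\<forall>t\<in>{0..<T} - Z. ((\<lambda>s. (X k s - X k t) / (s - t)) \<longlongrightarrow> f t) (at_right t))"
    proof -
      obtain f Z where "negligible Z" "\<And>t. t \<in> {0..T} \<Longrightarrow> (f has_integral (X k t - X k 0)) {0..t}"
        "\<And>t. t \<in> {0..<T} - Z \<Longrightarrow> ((\<lambda>s. (X k s - X k t) / (s - t)) \<longlongrightarrow> f t) (at_right t)"
        by (rule lipschitz_density_on[OF lip[OF k] \<open>0 < T\<close>]) (assumption | rule that)+
      then show ?thesis by (intro exI[of _ f] exI[of _ Z] conjI ballI)
    qed
  qed
  then obtain f Z where fZ: "\<forall>k\<in>{..<N}. negligible (Z k) \<and>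
      (\<forall>t\<in>{0..T}. (f k has_integral (X k t - X k 0)) {0..t}) \<and>
      (\<forall>t\<in>{0..<T} - Z k. ((\<lambda>s. (X k s - X k t) / (s - t)) \<longlongrightarrow> f k t) (at_right t))"
    unfolding bchoice_iff by blast
  then have Z: "\<And>k. k < N \<Longrightarrow> negligible (Z k)"
    and fi: "\<And>k t. k < N \<Longrightarrow> t \<in> {0..T} \<Longrightarrow> (f k has_integral (X k t - X k 0)) {0..t}"
    and fd: "\<And>k t. k < N \<Longrightarrow> t \<in> {0..<T} - Z k \<Longrightarrow> ((\<lambda>s. (X k s - X k t) / (s - t)) \<longlongrightarrow> f k t) (at_right t)"
    by blast+
  define a where "a k t = (if t \<in> {0..<T} - Z k then f k t else vel_lo (\<lambda>i. X i t) k)" for k t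
  have a: "vel_lo (\<lambda>i. X i t) k \<le> a k t \<and> a k t \<le> vel_hi (\<lambda>i. X i t) k" if k: "k < N" and t: "t \<in> {0..T}" for k t
  proof (cases "t \<in> {0..<T} - Z k")
    case True
    have ev: "\<forall>\<^sub>F s in at_right t. vel_lo (\<lambda>i. X i t) k - e \<le> (X k s - X k t) / (s - t) \<and>
        (X k s - X k t) / (s - t) \<le> vel_hi (\<lambda>i. X i t) k + e" if e: "0 < e" for e
    proof -
      have "\<forall>\<^sub>F s in at_right t. (vel_lo (\<lambda>i. X i t) k - e) * (s - t) \<le> X k s - X k t \<and>
          X k s - X k t \<le> (vel_hi (\<lambda>i. X i t) k + e) * (s - t)"
        using fol[of t] True k e by (simp add: follows_def)
      moreover have "\<forall>\<^sub>F s in at_right t. t < s" by (simp add: eventually_at_right_less)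
      ultimately show ?thesis
        by eventually_elim (simp add: pos_le_divide_eq pos_divide_le_eq)
    qed
    have "vel_lo (\<lambda>i. X i t) k \<le> f k t + e" "f k t \<le> vel_hi (\<lambda>i. X i t) k + e" if "0 < e" for e
      using tendsto_lowerbound[OF fd[OF k True], of "vel_lo (\<lambda>i. X i t) k - e"]
        tendsto_upperbound[OF fd[OF k True], of "vel_hi (\<lambda>i. X i t) k + e"] ev[OF that]
      by (auto elim!: eventually_mono simp: eventually_conj_iff)
    then show ?thesis using True unfolding a_def by (auto intro: field_le_epsilon)
  qed (use lo_hi[OF t k] in \<open>auto simp: a_def\<close>)
  define P where "P k t \<kappa> \<longleftrightarrow> (\<forall>j. \<kappa> j \<in> dK_set L K (X k t - X j t)) \<and>
      dpa_rhs W v c L N (\<lambda>_. \<kappa>) (\<lambda>i. X i t) k = a k t" for k t \<kappa>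
  define \<kappa> where "\<kappa> k t = (SOME \<kappa>. P k t \<kappa>)" for k t
  have "P k t (\<kappa> k t)" if "k < N" "t \<in> {0..T}" for k t
  proof -
    have "\<exists>\<kappa>. P k t \<kappa>"
      unfolding P_def
      by (rule between_rhs[of "\<lambda>i. X i t" k "a k t"]) (use a[OF that] in blast)+
    then show ?thesis unfolding \<kappa>_def by (rule someI_ex)
  qed
  then have \<kappa>: "\<And>k t j. k < N \<Longrightarrow> t \<in> {0..T} \<Longrightarrow> \<kappa> k t j \<in> dK_set L K (X k t - X j t)"
    "\<And>k t. k < N \<Longrightarrow> t \<in> {0..T} \<Longrightarrow> dpa_rhs W v c L N (\<lambda>_. \<kappa> k t) (\<lambda>i. X i t) k = a k t"
    unfolding P_def by blast+
  show thesis
  proof (rule that[of "\<lambda>k j t. \<kappa> k t j"])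
    show "admissible_forces (\<lambda>k j t. \<kappa> k t j) X t" if "t \<in> {0..T}" for t using \<kappa>(1) that by blast
    show "moves_by (\<lambda>k j t. \<kappa> k t j) X t" if t: "t \<in> {0..T}" for t
    proof (intro allI impI)
      fix k assume k: "k < N"
      show "((\<lambda>s. dpa_rhs W v c L N (\<lambda>k j. \<kappa> k s j) (\<lambda>i. X i s) k) has_integral X k t - X k 0) {0..t}"
      proof (rule has_integral_spike[OF _ _ fi[OF k t]])
        show "negligible (Z k \<union> {T})" using Z[OF k] by simp
        fix s assume s: "s \<in> {0..t} - (Z k \<union> {T})"
        have "dpa_rhs W v c L N (\<lambda>k j. \<kappa> k s j) (\<lambda>i. X i s) k = a k s"
          using \<kappa>(2)[OF k, of s] s t by (simp add: dpa_rhs_def)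
        then show "dpa_rhs W v c L N (\<lambda>k j. \<kappa> k s j) (\<lambda>i. X i s) k = f k s"
          using s t by (auto simp: a_def)
      qed
    qed
  qed
qed

lemma growth_rate_nonneg: "1 \<le> M \<Longrightarrow> 0 \<le> growth_rate M"
  using mobility_nonneg[OF mobility, of 0] kernel_bound(1)[OF kernel] by (simp add: growth_rate_def)

section \<open>Existence and continuation\<close>

text \<open>The lower bound of \<open>gap_lower_bound\<close> at the final time.\<close>

definition min_gap :: "real \<Rightarrow> real \<Rightarrow> real" where
  "min_gap M T = c / (real N * M) * exp (- growth_rate M * T)"

lemma min_gap_pos: "1 \<le> M \<Longrightarrow> 0 < min_gap M T"
  using c_pos N_pos by (simp add: min_gap_def)

lemma min_gap_antimono: "1 \<le> M \<Longrightarrow> s \<le> t \<Longrightarrow> min_gap M t \<le> min_gap M s"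
  using c_pos N_pos growth_rate_nonneg[of M] unfolding min_gap_def
  by (intro mult_left_mono) (simp_all add: mult_left_mono)

lemma follows_cong:
  assumes fol: "follows X t" and b: "t < b" and eq: "\<And>s i. i < N \<Longrightarrow> t \<le> s \<Longrightarrow> s < b \<Longrightarrow> Y i s = X i s"
  shows "follows Y t"
proof -
  have Yt: "Y i t = X i t" if "i < N" for i using eq[OF that, of t] b by simp
  have gap_eq: "gap (\<lambda>i. Y i t) k = gap (\<lambda>i. X i t) k" if "k < N" for k
    using that next_index_less[OF that] by (simp add: spacing_def next_pos_eq Yt)
  have rhs_eq: "dpa_rhs W v c L N (\<lambda>k j. D L K (Y k t - Y j t)) (\<lambda>i. Y i t) k
      = dpa_rhs W v c L N (\<lambda>k j. D L K (X k t - X j t)) (\<lambda>i. X i t) k" if "k < N" for k and D :: "real \<Rightarrow> (real \<Rightarrow> real) \<Rightarrow> real \<Rightarrow> real"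
  proof -
    have "(\<Sum>j\<in>{..<N} - {k}. D L K (Y k t - Y j t)) = (\<Sum>j\<in>{..<N} - {k}. D L K (X k t - X j t))"
      using that by (intro sum.cong) (auto simp: Yt)
    moreover have "dens (\<lambda>i. Y i t) k = dens (\<lambda>i. X i t) k" "dens (\<lambda>i. Y i t) (prv k) = dens (\<lambda>i. X i t) (prv k)"
      using that prev_index_less[OF that] by (simp_all add: dpa_density_spacing gap_eq)
    ultimately show ?thesis by (simp add: dpa_rhs_def dpa_v_def dpa_G_def)
  qed
  have vel_eq: "vel_lo (\<lambda>i. Y i t) k = vel_lo (\<lambda>i. X i t) k" "vel_hi (\<lambda>i. Y i t) k = vel_hi (\<lambda>i. X i t) k"
    if "k < N" for k unfolding vel_lo_def vel_hi_def by (rule rhs_eq[OF that])+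
  show ?thesis
    unfolding follows_def
  proof (intro allI impI)
    fix k e assume k: "k < N" and e: "0 < (e::real)"
    have "\<forall>\<^sub>F s in at_right t. (vel_lo (\<lambda>i. X i t) k - e) * (s - t) \<le> X k s - X k t \<and>
        X k s - X k t \<le> (vel_hi (\<lambda>i. X i t) k + e) * (s - t)"
      using fol k e by (simp add: follows_def)
    moreover have "\<forall>\<^sub>F s in at_right t. t < s \<and> s < b"
      using b by (auto simp: eventually_at_right[of t b])
    ultimately show "\<forall>\<^sub>F s in at_right t. (vel_lo (\<lambda>i. Y i t) k - e) * (s - t) \<le> Y k s - Y k t \<and>
        Y k s - Y k t \<le> (vel_hi (\<lambda>i. Y i t) k + e) * (s - t)"
    proof eventually_elim
      case (elim s)
      then show ?case using eq[OF k, of s] Yt[OF k] by (simp add: vel_eq[OF k])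
    qed
  qed
qed

text \<open>The field switched off where some gap is below \<open>\<eta>\<close> is bounded, so it has Euler limits for all
  times; they are trajectories of the system as long as all gaps exceed \<open>\<eta>\<close>.\<close>

lemma local_following:
  assumes \<eta>: "0 < \<eta>"
  obtains Z where "\<And>k. Z k 0 = x0 k" "\<And>k. continuous_on {0..} (Z k)"
    "\<And>t. \<lbrakk>0 \<le> t; \<And>k. k < N \<Longrightarrow> \<eta> < gap (\<lambda>i. Z i t) k\<rbrakk> \<Longrightarrow> follows Z t"
proof -
  obtain R where R: "0 \<le> R" "\<And>x k w. \<lbrakk>\<And>j. j < N \<Longrightarrow> \<eta> \<le> gap x j; k < N; vel_lo x k \<le> w; w \<le> vel_hi x k\<rbrakk> \<Longrightarrow> \<bar>w\<bar> \<le> R"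
    using vel_bound[OF \<eta>] by blast
  define F where "F y k = dpa_rhs W v c L N (\<lambda>k j. deriv K (torus_rep L (y k - y j))) y k" for y k
  define f where "f y k = (if k < N \<and> (\<forall>j<N. \<eta> \<le> gap y j) then F y k else 0)" for y k
  have F: "vel_lo y k \<le> F y k" "F y k \<le> vel_hi y k" if "k < N" "\<And>j. j < N \<Longrightarrow> \<eta> \<le> gap y j" for y k
  proof -
    have "ordered L N y" using that(2) \<eta> by (force simp: ordered_iff_spacing)
    then show "vel_lo y k \<le> F y k" "F y k \<le> vel_hi y k"
      unfolding F_def using that(1) by (auto intro!: rhs_between deriv_in_dK_set)
  qed
  have "\<bar>f y k\<bar> \<le> R" for y k
    using R F[of k y] by (auto simp: f_def)
  then obtain Z where Z: "\<And>k. Z k 0 = x0 k"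
    "\<And>k s t. 0 \<le> s \<Longrightarrow> 0 \<le> t \<Longrightarrow> \<bar>Z k s - Z k t\<bar> \<le> R * \<bar>s - t\<bar>"
    "\<And>k t a b. \<lbrakk>0 \<le> t; \<forall>\<^sub>F y in near N (\<lambda>i. Z i t). a \<le> f y k \<and> f y k \<le> b\<rbrakk> \<Longrightarrow>
       \<forall>\<^sub>F s in at_right t. a * (s - t) \<le> Z k s - Z k t \<and> Z k s - Z k t \<le> b * (s - t)"
    by (rule euler_limit[of f R x0 N]) (rule that)
  show thesis
  proof (rule that[of Z, OF Z(1)])
    show "continuous_on {0..} (Z k)" for k
    proof (rule lipschitz_on_continuous_on)
      show "R-lipschitz_on {0..} (Z k)"
        using Z(2) R(1) by (intro lipschitz_onI) (auto simp: dist_real_def)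
    qed
    fix t assume t: "0 \<le> t" and gap: "\<And>k. k < N \<Longrightarrow> \<eta> < gap (\<lambda>i. Z i t) k"
    have ord: "ordered L N (\<lambda>i. Z i t)" using gap \<eta> by (force simp: ordered_iff_spacing)
    have near_gap: "\<forall>\<^sub>F y in near N (\<lambda>i. Z i t). \<forall>k<N. \<eta> < gap y k"
      using gap by (rule eventually_spacing_ge)
    show "follows Z t"
      unfolding follows_def
    proof (intro allI impI)
      fix k e assume k: "k < N" and e: "0 < (e::real)"
      show "\<forall>\<^sub>F s in at_right t. (vel_lo (\<lambda>i. Z i t) k - e) * (s - t) \<le> Z k s - Z k t \<and>
          Z k s - Z k t \<le> (vel_hi (\<lambda>i. Z i t) k + e) * (s - t)"
      proof (rule Z(3)[OF t])
        show "\<forall>\<^sub>F y in near N (\<lambda>i. Z i t). vel_lo (\<lambda>i. Z i t) k - e \<le> f y k \<and> f y k \<le> vel_hi (\<lambda>i. Z i t) k + e"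
          using vel_usc[OF ord k e] near_gap
        proof eventually_elim
          case (elim y)
          then show ?case using F[OF k, of y] k by (auto simp: f_def less_imp_le)
        qed
      qed
    qed
  qed
qed

text \<open>Append an Euler limit with threshold \<open>\<eta> = min_gap M T / 2\<close> to the given trajectory. Up to the
  first time at which some gap is at most \<open>\<eta>\<close> the result is a trajectory of the system, so
  at that time the a priori bound yields a gap of at least \<open>2 \<eta>\<close>: there is no such time. The case
  \<open>\<tau> = 0\<close> is the existence of trajectories with given initial positions.\<close>

lemma extend_following:
  assumes M: "1 \<le> M" "c \<le> M * L" and \<tau>: "0 \<le> \<tau>" "\<tau> \<le> T"
    and cont: "\<And>k. k < N \<Longrightarrow> continuous_on {0..\<tau>} (X k)"
    and ord: "\<And>t. t \<in> {0..\<tau>} \<Longrightarrow> ordered L N (\<lambda>i. X i t)"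
    and fol: "\<And>t. t \<in> {0..<\<tau>} \<Longrightarrow> follows X t"
    and init: "\<And>k. k < N \<Longrightarrow> c / (real N * M) \<le> gap (\<lambda>i. X i 0) k"
  obtains Y where "\<And>k t. t \<in> {0..\<tau>} \<Longrightarrow> Y k t = X k t"
    "\<And>k. k < N \<Longrightarrow> continuous_on {0..T} (Y k)"
    "\<And>t k. t \<in> {0..T} \<Longrightarrow> k < N \<Longrightarrow> min_gap M T \<le> gap (\<lambda>i. Y i t) k"
    "\<And>t. t \<in> {0..<T} \<Longrightarrow> follows Y t"
proof -
  define \<eta> where "\<eta> = min_gap M T / 2"
  have \<eta>: "0 < \<eta>" "\<eta> < min_gap M T" using min_gap_pos[OF M(1)] by (simp_all add: \<eta>_def)
  obtain Z where Z0: "\<And>k. Z k 0 = X k \<tau>" and Zc: "\<And>k. continuous_on {0..} (Z k)"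
    and Zf: "\<And>t. \<lbrakk>0 \<le> t; \<And>k. k < N \<Longrightarrow> \<eta> < gap (\<lambda>i. Z i t) k\<rbrakk> \<Longrightarrow> follows Z t"
    using local_following[OF \<eta>(1), of "\<lambda>k. X k \<tau>"] by blast
  define Y where "Y k t = (if t \<le> \<tau> then X k t else Z k (t - \<tau>))" for k t
  have Y_late: "Y k t = Z k (t - \<tau>)" if "\<tau> \<le> t" for k t
    using that Z0 by (cases "t = \<tau>") (auto simp: Y_def)
  have Yc: "continuous_on {0..T} (Y k)" if k: "k < N" for k
  proof -
    have "continuous_on {\<tau>..T} (\<lambda>t. Z k (t - \<tau>))"
      by (intro continuous_on_compose2[OF Zc] continuous_intros) auto
    then have "continuous_on ({0..\<tau>} \<union> {\<tau>..T}) (\<lambda>t. if t \<le> \<tau> then X k t else Z k (t - \<tau>))"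
      using cont[OF k] Z0 by (intro continuous_on_If) (auto intro!: closed_atLeastAtMost)
    moreover have "{0..\<tau>} \<union> {\<tau>..T} = {0..T}" using \<tau> by auto
    ultimately show ?thesis by (simp add: Y_def[abs_def])
  qed
  have Yf: "follows Y t" if t: "t \<in> {0..<T}" and gap: "\<And>k. k < N \<Longrightarrow> \<eta> < gap (\<lambda>i. Y i t) k" for t
  proof (cases "t < \<tau>")
    case True
    show ?thesis
      by (rule follows_cong[of X t \<tau>]) (use fol True t in \<open>auto simp: Y_def\<close>)
  next
    case False
    then have t\<tau>: "\<tau> \<le> t" by simp
    have Zt: "follows Z (t - \<tau>)"
      using gap t\<tau> by (intro Zf) (simp_all add: Y_late)
    show ?thesis unfolding follows_def
    proof (intro allI impI)
      fix k e assume "k < N" "0 < (e::real)"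
      then have "\<forall>\<^sub>F s in at_right (t - \<tau>). (vel_lo (\<lambda>i. Y i t) k - e) * (s - (t - \<tau>)) \<le> Z k s - Z k (t - \<tau>) \<and>
        Z k s - Z k (t - \<tau>) \<le> (vel_hi (\<lambda>i. Y i t) k + e) * (s - (t - \<tau>))"
        using Zt by (simp add: follows_def Y_late[OF t\<tau>])
      then have "\<forall>\<^sub>F s in at_right t. (vel_lo (\<lambda>i. Y i t) k - e) * (s - \<tau> - (t - \<tau>)) \<le> Z k (s - \<tau>) - Z k (t - \<tau>) \<and>
        Z k (s - \<tau>) - Z k (t - \<tau>) \<le> (vel_hi (\<lambda>i. Y i t) k + e) * (s - \<tau> - (t - \<tau>))"
        by (simp only: eventually_at_right_shift)
      moreover have "\<forall>\<^sub>F s in at_right t. t < s" by (simp add: eventually_at_right_less)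
      ultimately show "\<forall>\<^sub>F s in at_right t. (vel_lo (\<lambda>i. Y i t) k - e) * (s - t) \<le> Y k s - Y k t \<and>
          Y k s - Y k t \<le> (vel_hi (\<lambda>i. Y i t) k + e) * (s - t)"
        by eventually_elim (use t\<tau> in \<open>simp add: Y_late\<close>)
    qed
  qed
  have gapc: "continuous_on {0..T} (\<lambda>t. gap (\<lambda>i. Y i t) k)" if "k < N" for k
    unfolding spacing_def next_pos_eq[OF that]
    by (intro continuous_intros Yc that next_index_less)
  have init': "c / (real N * M) \<le> gap (\<lambda>i. Y i 0) k" if "k < N" for k
    using init[OF that] \<tau> by (simp add: Y_def)
  have bound: "min_gap M T \<le> gap (\<lambda>i. Y i t1) k"
    if t1: "t1 \<in> {0..T}" and early: "\<And>t k. t \<in> {0..<t1} \<Longrightarrow> k < N \<Longrightarrow> \<eta> < gap (\<lambda>i. Y i t) k"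
      and k: "k < N" for t1 k
  proof -
    have ge: "\<eta> \<le> gap (\<lambda>i. Y i t) k" if t: "t \<in> {0..t1}" and k: "k < N" for t k
    proof (cases "t1 = 0")
      case True
      have "min_gap M T \<le> min_gap M 0" using t1 by (intro min_gap_antimono M) auto
      then show ?thesis using init'[OF k] \<eta> t True by (simp add: min_gap_def)
    next
      case False
      have "continuous_on {0..t1} (\<lambda>t. gap (\<lambda>i. Y i t) k)"
        using t1 by (intro continuous_on_subset[OF gapc[OF k]]) auto
      then show ?thesis
      proof (rule continuous_ge_on_Icc)
        show "0 < t1" using False t1 by simp
        show "\<eta> \<le> gap (\<lambda>i. Y i r) k" if "r \<in> {0..<t1}" for r
          using early[OF that k] by simp
      qed (rule t)
    qed
    have "c / (real N * M) * exp (- growth_rate M * t1) \<le> gap (\<lambda>i. Y i t1) k"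
    proof (rule gap_lower_bound[of t1 Y M k t1])
      show "continuous_on {0..t1} (Y k)" if "k < N" for k
        using t1 by (intro continuous_on_subset[OF Yc[OF that]]) auto
      show "ordered L N (\<lambda>i. Y i t)" if "t \<in> {0..t1}" for t
        using ge[OF that] \<eta>(1) by (force simp: ordered_iff_spacing)
      show "follows Y t" if "t \<in> {0..<t1}" for t
        using that t1 early[OF that] by (intro Yf) auto
    qed (use M init' k t1 in auto)
    then show ?thesis using min_gap_antimono[OF M(1), of t1 T] t1 by (simp add: min_gap_def)
  qed
  have good: "\<eta> < gap (\<lambda>i. Y i t) k" if tk: "t \<in> {0..T}" "k < N" for t k
  proof (rule ccontr)
    assume contr: "\<not> \<eta> < gap (\<lambda>i. Y i t) k"
    define bad where "bad = (\<Union>k\<in>{..<N}. {t \<in> {0..T}. gap (\<lambda>i. Y i t) k \<le> \<eta>})"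
    have "closed bad" unfolding bad_def
      by (intro closed_UN ballI continuous_on_closed_Collect_le gapc continuous_intros) auto
    moreover have "bounded bad" by (rule bounded_subset[of "{0..T}"]) (auto simp: bad_def)
    ultimately have "compact bad" by (simp add: compact_eq_bounded_closed)
    moreover have "t \<in> bad" using tk contr by (auto simp: bad_def not_less)
    ultimately obtain t1 where t1: "t1 \<in> bad" "\<And>t. t \<in> bad \<Longrightarrow> t1 \<le> t"
      using compact_attains_inf[of bad] by blast
    then obtain j where j: "j < N" "t1 \<in> {0..T}" "gap (\<lambda>i. Y i t1) j \<le> \<eta>" by (auto simp: bad_def)
    have "min_gap M T \<le> gap (\<lambda>i. Y i t1) j"
    proof (rule bound[OF j(2) _ j(1)])
      fix r i assume r: "r \<in> {0..<t1}" and i: "i < N"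
      show "\<eta> < gap (\<lambda>l. Y l r) i"
      proof (rule ccontr)
        assume "\<not> \<eta> < gap (\<lambda>l. Y l r) i"
        then have "r \<in> bad" using r i j(2) by (auto simp: bad_def not_less)
        then show False using t1(2)[of r] r by simp
      qed
    qed
    then show False using j(3) \<eta>(2) by simp
  qed
  show thesis
  proof (rule that[of Y])
    show "Y k t = X k t" if "t \<in> {0..\<tau>}" for k t using that by (simp add: Y_def)
    show "min_gap M T \<le> gap (\<lambda>i. Y i t) k" if "t \<in> {0..T}" "k < N" for t k
      using that good by (intro bound) auto
    show "follows Y t" if "t \<in> {0..<T}" for t using that good by (intro Yf) auto
  qed (rule Yc)
qed


section \<open>Well-posedness for given initial gaps\<close>

lemma solution_follows:
  assumes sol: "dpa_solution K v W L \<rho>0 N I X" and c: "c = mass L \<rho>0" and u: "{0..u} \<subseteq> I" "0 \<le> u"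
  shows "\<And>k. k < N \<Longrightarrow> continuous_on {0..u} (X k)"
    and "\<And>t. t \<in> {0..u} \<Longrightarrow> ordered L N (\<lambda>i. X i t)"
    and "\<And>t. t \<in> {0..<u} \<Longrightarrow> follows X t"
proof -
  obtain \<kappa> where \<kappa>: "\<And>t. t \<in> I \<Longrightarrow> admissible_forces \<kappa> X t" "\<And>t. t \<in> I \<Longrightarrow> moves_by \<kappa> X t"
    and ord: "\<And>t. t \<in> I \<Longrightarrow> ordered L N (\<lambda>i. X i t)"
    using sol unfolding dpa_solution_def c[symmetric] by blast
  have sub: "t \<in> I" if "t \<in> {0..u}" for t using u that by blast
  show "continuous_on {0..u} (X k)" if "k < N" for k
    by (rule integral_solution_continuous[OF \<kappa>(2)[OF sub] u(2) that])
  show "ordered L N (\<lambda>i. X i t)" if "t \<in> {0..u}" for t by (rule ord[OF sub[OF that]])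
  show "follows X t" if "t \<in> {0..<u}" for t
    by (rule integral_solution_follows[OF ord[OF sub] \<kappa>(1)[OF sub] \<kappa>(2)[OF sub] that])
qed

lemma solution_gap:
  assumes sol: "dpa_solution K v W L \<rho>0 N I X" and c: "c = mass L \<rho>0" and t: "{0..t} \<subseteq> I" "0 \<le> t" "t \<le> T"
    and M: "1 \<le> M" "c \<le> M * L" and init: "\<And>k. k < N \<Longrightarrow> c / (real N * M) \<le> gap (init_pos L \<rho>0 N) k"
    and k: "k < N"
  shows "min_gap M T \<le> gap (\<lambda>i. X i t) k"
proof -
  have "X i 0 = init_pos L \<rho>0 N i" if "i < N" for i using sol that by (simp add: dpa_solution_def)
  then have init': "c / (real N * M) \<le> gap (\<lambda>i. X i 0) k" if "k < N" for k
    using init[OF that] that next_index_less[OF that] by (simp add: spacing_def next_pos_eq)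
  have "min_gap M t \<le> gap (\<lambda>i. X i t) k"
    unfolding min_gap_def
    by (rule gap_lower_bound[OF solution_follows[OF sol c t(1,2)] M init' k]) (use t in auto)
  then show ?thesis using min_gap_antimono[OF M(1) t(3)] by linarith
qed

lemma extension_solution:
  assumes c: "c = mass L \<rho>0" and M: "1 \<le> M" "c \<le> M * L"
    and init: "\<And>k. k < N \<Longrightarrow> c / (real N * M) \<le> gap (init_pos L \<rho>0 N) k"
    and \<tau>: "0 \<le> \<tau>" "\<tau> \<le> T" "0 < T"
    and X0: "\<And>k. k < N \<Longrightarrow> X k 0 = init_pos L \<rho>0 N k"
    and cont: "\<And>k. k < N \<Longrightarrow> continuous_on {0..\<tau>} (X k)"
    and ord: "\<And>t. t \<in> {0..\<tau>} \<Longrightarrow> ordered L N (\<lambda>i. X i t)"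
    and fol: "\<And>t. t \<in> {0..<\<tau>} \<Longrightarrow> follows X t"
  obtains Y where "dpa_solution K v W L \<rho>0 N {0..T} Y" "\<And>k t. t \<in> {0..\<tau>} \<Longrightarrow> Y k t = X k t"
proof -
  have init': "c / (real N * M) \<le> gap (\<lambda>i. X i 0) k" if "k < N" for k
    using init[OF that] that next_index_less[OF that] by (simp add: spacing_def next_pos_eq X0)
  obtain Y where Y: "\<And>k t. t \<in> {0..\<tau>} \<Longrightarrow> Y k t = X k t"
    "\<And>k. k < N \<Longrightarrow> continuous_on {0..T} (Y k)"
    "\<And>t k. t \<in> {0..T} \<Longrightarrow> k < N \<Longrightarrow> min_gap M T \<le> gap (\<lambda>i. Y i t) k"
    "\<And>t. t \<in> {0..<T} \<Longrightarrow> follows Y t"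
    by (rule extend_following[OF M \<tau>(1,2) cont ord fol init']) (assumption | rule that)+
  obtain \<kappa> where \<kappa>: "\<And>t. t \<in> {0..T} \<Longrightarrow> admissible_forces \<kappa> Y t" "\<And>t. t \<in> {0..T} \<Longrightarrow> moves_by \<kappa> Y t"
    by (rule follows_integral_solution[OF \<tau>(3) Y(3) min_gap_pos[OF M(1)] Y(2) Y(4)]) (assumption | rule that)+
  have "ordered L N (\<lambda>i. Y i t)" if "t \<in> {0..T}" for t
    unfolding ordered_iff_spacing using Y(3)[OF that] min_gap_pos[OF M(1), of T] by (auto intro: less_le_trans)
  moreover have "Y k 0 = init_pos L \<rho>0 N k" if "k < N" for k using Y(1)[of 0 k] X0[OF that] \<tau> by simp
  ultimately have "dpa_solution K v W L \<rho>0 N {0..T} Y"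
    unfolding dpa_solution_def c[symmetric] using \<kappa> by blast
  then show thesis using Y(1) by (rule that)
qed

text \<open>Existence is the extension of the initial positions. A solution on \<open>[0, \<tau>)\<close> is Lipschitz because
  its gaps are bounded below, so it extends continuously to \<open>\<tau>\<close> with the same bound on the gaps and can
  be continued from there.\<close>

lemma well_defined:
  assumes c: "c = mass L \<rho>0" and M: "1 \<le> M" "c \<le> M * L"
    and init: "\<And>k. k < N \<Longrightarrow> c / (real N * M) \<le> gap (init_pos L \<rho>0 N) k" and T: "0 < T"
  shows "dpa_well_defined K v W L \<rho>0 N T"
  unfolding dpa_well_defined_def
proof (intro conjI ballI allI impI)
  have "0 < c / (real N * M)" using c_pos N_pos M(1) by simp
  then have "ordered L N (init_pos L \<rho>0 N)"
    unfolding ordered_iff_spacing using init by (auto intro: less_le_trans)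
  then have ord: "ordered L N (\<lambda>i. init_pos L \<rho>0 N i)" by simp
  show "\<exists>X. dpa_solution K v W L \<rho>0 N {0..T} X"
  proof (rule extension_solution[OF c M init order_refl, of T "\<lambda>k _. init_pos L \<rho>0 N k"])
    show "dpa_solution K v W L \<rho>0 N {0..T} Y \<Longrightarrow> ?thesis" for Y by blast
  qed (use T ord in auto)
next
  fix \<tau> X assume \<tau>: "\<tau> \<in> {0<..T}" and sol: "dpa_solution K v W L \<rho>0 N {0..<\<tau>} X"
  define \<eta> where "\<eta> = min_gap M T"
  have \<eta>: "0 < \<eta>" using min_gap_pos[OF M(1)] by (simp add: \<eta>_def)
  have gap: "\<eta> \<le> gap (\<lambda>i. X i t) k" if "t \<in> {0..<\<tau>}" "k < N" for t k
    unfolding \<eta>_def using that \<tau> by (intro solution_gap[OF sol c _ _ _ M init]) auto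
  have ordX: "ordered L N (\<lambda>i. X i t)" if "t \<in> {0..<\<tau>}" for t
    using sol that by (simp add: dpa_solution_def)
  have folX: "follows X t" if "t \<in> {0..<\<tau>}" for t
    using that by (intro solution_follows(3)[OF sol c, of "(t + \<tau>) / 2"]) auto
  obtain R where R: "0 \<le> R" "\<And>x k w. \<lbrakk>\<And>j. j < N \<Longrightarrow> \<eta> \<le> gap x j; k < N; vel_lo x k \<le> w; w \<le> vel_hi x k\<rbrakk> \<Longrightarrow> \<bar>w\<bar> \<le> R"
    using vel_bound[OF \<eta>] by blast
  have vel: "- R \<le> vel_lo (\<lambda>i. X i t) k \<and> vel_hi (\<lambda>i. X i t) k \<le> R" if t: "t \<in> {0..<\<tau>}" and k: "k < N" for t k
    using R(2)[of "\<lambda>i. X i t" k, OF gap[OF t] k order_refl vel_lo_le_hi[OF ordX[OF t] k]]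
      R(2)[of "\<lambda>i. X i t" k, OF gap[OF t] k vel_lo_le_hi[OF ordX[OF t] k] order_refl] by linarith
  have lip: "R-lipschitz_on {0..<\<tau>} (X k)" if k: "k < N" for k
  proof (rule lipschitz_onI[OF _ R(1)])
    fix s t assume st: "s \<in> {0..<\<tau>}" "t \<in> {0..<\<tau>}"
    define u where "u = max s t"
    have u: "{0..u} \<subseteq> {0..<\<tau>}" "0 \<le> u" using st by (auto simp: u_def)
    have "\<bar>X k s - X k t\<bar> \<le> R * \<bar>s - t\<bar>"
      by (rule follows_lipschitz[OF solution_follows(1)[OF sol c u k] k folX vel[OF _ k]])
         (use st u in \<open>auto simp: u_def\<close>)
    then show "dist (X k s) (X k t) \<le> R * dist s t" by (simp add: dist_real_def)
  qed
  have "\<forall>k\<in>{..<N}. \<exists>g. continuous_on {0..\<tau>} g \<and> (\<forall>t\<in>{0..<\<tau>}. g t = X k t)"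
  proof
    fix k assume "k \<in> {..<N}"
    then obtain g where "R-lipschitz_on (closure {0..<\<tau>}) g" "\<And>t. t \<in> {0..<\<tau>} \<Longrightarrow> g t = X k t"
      using lipschitz_extend_closure[OF lip[of k]] by blast
    then show "\<exists>g. continuous_on {0..\<tau>} g \<and> (\<forall>t\<in>{0..<\<tau>}. g t = X k t)"
      using \<tau> lipschitz_on_continuous_on by (intro exI[of _ g]) auto
  qed
  then obtain X' where "\<forall>k\<in>{..<N}. continuous_on {0..\<tau>} (X' k) \<and> (\<forall>t\<in>{0..<\<tau>}. X' k t = X k t)"
    unfolding bchoice_iff by blast
  then have X': "\<And>k. k < N \<Longrightarrow> continuous_on {0..\<tau>} (X' k)" "\<And>k t. k < N \<Longrightarrow> t \<in> {0..<\<tau>} \<Longrightarrow> X' k t = X k t"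
    by blast+
  have gapc: "continuous_on {0..\<tau>} (\<lambda>t. gap (\<lambda>i. X' i t) k)" if "k < N" for k
    unfolding spacing_def next_pos_eq[OF that]
    by (intro continuous_intros X' that next_index_less)
  have gap': "\<eta> \<le> gap (\<lambda>i. X' i t) k" if t: "t \<in> {0..\<tau>}" and k: "k < N" for t k
  proof -
    have eq: "gap (\<lambda>i. X' i r) k = gap (\<lambda>i. X i r) k" if "r \<in> {0..<\<tau>}" for r
      using X'(2) k that next_index_less[OF k] by (simp add: spacing_def next_pos_eq)
    show ?thesis
    proof (rule continuous_ge_on_Icc[OF gapc[OF k] _ _ t])
      show "0 < \<tau>" using \<tau> by simp
      show "\<eta> \<le> gap (\<lambda>i. X' i r) k" if "r \<in> {0..<\<tau>}" for r
        using gap[OF that k] eq[OF that] by simp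
    qed
  qed
  have ord': "ordered L N (\<lambda>i. X' i t)" if "t \<in> {0..\<tau>}" for t
    unfolding ordered_iff_spacing using gap'[OF that] \<eta> by (auto intro: less_le_trans)
  have fol': "follows X' t" if "t \<in> {0..<\<tau>}" for t
    by (rule follows_cong[OF folX[OF that], of \<tau>]) (use X'(2) that in auto)
  have X'0: "X' k 0 = init_pos L \<rho>0 N k" if "k < N" for k
    using X'(2)[OF that, of 0] sol \<tau> that by (simp add: dpa_solution_def)
  have T': "0 \<le> \<tau>" "\<tau> \<le> T" using \<tau> by auto
  obtain Y where Y: "dpa_solution K v W L \<rho>0 N {0..T} Y" "\<And>k t. t \<in> {0..\<tau>} \<Longrightarrow> Y k t = X' k t"
    by (rule extension_solution[OF c M init T' T X'0 X'(1) ord' fol']) (assumption | rule that)+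
  show "\<exists>Y. dpa_solution K v W L \<rho>0 N {0..T} Y \<and> (\<forall>k<N. \<forall>t\<in>{0..<\<tau>}. Y k t = X k t)"
    using Y X'(2) by (intro exI[of _ Y]) auto
qed

end

section \<open>Initial positions\<close>

text \<open>An interval of mass \<open>c / N\<close> has length at least \<open>c / (N R)\<close>. By induction the mass to the left of
  particle \<open>k\<close> is at most \<open>k c / N\<close>, so at least \<open>c / N\<close> remains to its right: the
  supremum in the definition is not cut off at \<open>L / 2\<close> too early, and the last gap is large as
  well.\<close>

lemma init_gap:
  fixes \<rho>0 :: "real \<Rightarrow> real"
  assumes L: "0 < L" and R: "0 < R" and N: "0 < N"
    and bd: "AE x in torus L. 0 \<le> \<rho>0 x \<and> \<rho>0 x \<le> R"
    and mass: "0 < mass L \<rho>0" and k: "k < N"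
  shows "mass L \<rho>0 / (real N * R) \<le> spacing L N (init_pos L \<rho>0 N) k"
proof -
  define c where "c = mass L \<rho>0"
  define I where "I a b = set_lebesgue_integral lebesgue {a..<b} \<rho>0" for a b
  define x where "x = init_pos L \<rho>0 N"
  have I0: "I a a = 0" for a by (simp add: I_def set_lebesgue_integral_def)
  have tot: "c = I (- L / 2) (L / 2)"
    by (simp add: c_def mass_def torus_def I_def set_lebesgue_integral_def integral_restrict_space)
  have "integrable (torus L) \<rho>0"
    using mass not_integrable_integral_eq[of "torus L" \<rho>0] by (auto simp: mass_def)
  then have int: "set_integrable lebesgue {- L / 2..<L / 2} \<rho>0"
    by (simp add: torus_def set_integrable_def integrable_restrict_space)
  have int': "set_integrable lebesgue {a..<b} \<rho>0" if "- L / 2 \<le> a" "b \<le> L / 2" for a b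
    using that by (intro set_integrable_subset[OF int]) auto
  have ae: "AE x in lebesgue. x \<in> {- L / 2..<L / 2} \<longrightarrow> 0 \<le> \<rho>0 x \<and> \<rho>0 x \<le> R"
    using bd unfolding torus_def by (subst (asm) AE_restrict_space_iff) simp_all
  have split: "I a d = I a b + I b d" if "- L / 2 \<le> a" "a \<le> b" "b \<le> d" "d \<le> L / 2" for a b d
  proof -
    have "{a..<d} = {a..<b} \<union> {b..<d}" using that by auto
    then show ?thesis unfolding I_def
      using that by (simp add: set_integral_Un[OF _ int' int'])
  qed
  have I_le: "I a b \<le> R * (b - a)" if ab: "- L / 2 \<le> a" "a \<le> b" "b \<le> L / 2" for a b
  proof -
    have "{a..<b} \<in> lmeasurable" by (intro bounded_set_imp_lmeasurable) auto
    then have "integrable lebesgue (indicat_real {a..<b})"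
      by (intro integrable_real_indicator) (auto simp: fmeasurable_def)
    then have "set_integrable lebesgue {a..<b} (\<lambda>_. R)"
      unfolding set_integrable_def by simp
    have "I a b \<le> set_lebesgue_integral lebesgue {a..<b} (\<lambda>_. R)"
      unfolding I_def set_lebesgue_integral_def
    proof (rule integral_mono_AE)
      show "integrable lebesgue (\<lambda>x. indicat_real {a..<b} x *\<^sub>R \<rho>0 x)"
        using int'[of a b] ab by (simp add: set_integrable_def)
      show "AE x in lebesgue. indicat_real {a..<b} x *\<^sub>R \<rho>0 x \<le> indicat_real {a..<b} x *\<^sub>R R"
        using ae by eventually_elim (use ab in \<open>auto simp: indicator_def\<close>)
    qed (use \<open>set_integrable lebesgue {a..<b} (\<lambda>_. R)\<close> in \<open>simp add: set_integrable_def\<close>)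
    also have "\<dots> = R * (b - a)" using ab by (simp add: set_lebesgue_integral_def)
    finally show ?thesis .
  qed
  have room: "c / (real N * R) \<le> L / 2 - x k" if "k < N" "- L / 2 \<le> x k" "x k \<le> L / 2" "I (- L / 2) (x k) \<le> real k * c / real N" for k
  proof -
    have "c - real k * c / real N \<le> I (x k) (L / 2)"
      using split[of "- L / 2" "x k" "L / 2"] tot that by simp
    also have "\<dots> \<le> R * (L / 2 - x k)" using that by (intro I_le) auto
    finally have 1: "c - real k * c / real N \<le> R * (L / 2 - x k)" .
    have "real (Suc k) * c \<le> real N * c" using that(1) mass by (intro mult_right_mono) (auto simp: c_def)
    then have "c / real N \<le> c - real k * c / real N" using N by (simp add: field_simps)
    then have "c / real N \<le> R * (L / 2 - x k)" using 1 by simp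
    then show ?thesis using R N by (simp add: field_simps)
  qed
  have step: "- L / 2 \<le> x (Suc k) \<and> x (Suc k) \<le> L / 2 \<and> I (- L / 2) (x (Suc k)) \<le> real (Suc k) * c / real N
      \<and> c / (real N * R) \<le> x (Suc k) - x k"
    if k: "Suc k < N" and ih: "- L / 2 \<le> x k" "x k \<le> L / 2" "I (- L / 2) (x k) \<le> real k * c / real N" for k
  proof -
    define S where "S = {y \<in> {x k..L / 2}. I (x k) y < c / real N}"
    have xS: "x (Suc k) = Sup S" by (simp add: x_def S_def I_def c_def)
    have "x k \<in> S" using ih mass N by (simp add: S_def I0 c_def)
    have bdd: "bdd_above S" by (rule bdd_aboveI[of _ "L / 2"]) (simp add: S_def)
    have lo: "x k \<le> x (Suc k)" unfolding xS by (rule cSup_upper[OF \<open>x k \<in> S\<close> bdd])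
    have hi: "x (Suc k) \<le> L / 2" unfolding xS
      by (rule cSup_least) (use \<open>x k \<in> S\<close> in \<open>auto simp: S_def\<close>)
    \<comment> \<open>the supremum need not belong to \<open>S\<close>; approximate it from within \<open>S\<close>\<close>
    have "I (x k) (x (Suc k)) \<le> c / real N"
    proof (rule field_le_epsilon)
      fix e :: real assume "0 < e"
      then have "x (Suc k) - e / R < Sup S" using R by (simp add: xS)
      then obtain y where y: "y \<in> S" "x (Suc k) - e / R < y"
        using less_cSup_iff[OF _ bdd, of "x (Suc k) - e / R"] \<open>x k \<in> S\<close> by blast
      have yx: "y \<le> x (Suc k)" unfolding xS by (rule cSup_upper[OF y(1) bdd])
      have "I (x k) (x (Suc k)) = I (x k) y + I y (x (Suc k))"
        using y yx ih hi by (intro split) (auto simp: S_def)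
      also have "I y (x (Suc k)) \<le> R * (x (Suc k) - y)"
        using y yx ih hi by (intro I_le) (auto simp: S_def)
      also have "R * (x (Suc k) - y) \<le> R * (e / R)" using y R by (intro mult_left_mono) auto
      finally show "I (x k) (x (Suc k)) \<le> c / real N + e" using y(1) R by (simp add: S_def)
    qed
    moreover have "I (- L / 2) (x (Suc k)) = I (- L / 2) (x k) + I (x k) (x (Suc k))"
      using ih lo hi by (intro split) auto
    ultimately have mass_le: "I (- L / 2) (x (Suc k)) \<le> real (Suc k) * c / real N"
      using ih(3) by (simp add: add_divide_distrib distrib_right)
    have "x k + c / (real N * R) \<le> x (Suc k)"
    proof (rule dense_le)
      fix y assume y: "y < x k + c / (real N * R)"
      show "y \<le> x (Suc k)"
      proof (cases "y \<le> x k")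
        case False
        have "R * (y - x k) < R * (c / (real N * R))" using y R by (intro mult_strict_left_mono) auto
        then have "R * (y - x k) < c / real N" using R by simp
        moreover have "y \<le> L / 2" using room[of k] ih k y by simp
        moreover have "I (x k) y \<le> R * (y - x k)" using ih False \<open>y \<le> L / 2\<close> by (intro I_le) auto
        ultimately have "y \<in> S" using False by (simp add: S_def)
        then show ?thesis unfolding xS by (rule cSup_upper[OF _ bdd])
      qed (use lo in simp)
    qed
    then show ?thesis using lo hi ih mass_le by simp
  qed
  have inv: "- L / 2 \<le> x k \<and> x k \<le> L / 2 \<and> I (- L / 2) (x k) \<le> real k * c / real N" if "k < N" for k
    using that
  proof (induction k)
    case 0
    then show ?case using L by (simp add: x_def I0)
  next
    case (Suc k)
    then show ?case using step[of k] by simp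
  qed
  show ?thesis
  proof (cases "Suc k < N")
    case True
    then show ?thesis using step[of k] inv[OF k] by (simp add: spacing_def next_pos_def x_def c_def)
  next
    case False
    then show ?thesis using room[OF k] inv[OF k] by (simp add: spacing_def next_pos_def x_def c_def)
  qed
qed

section \<open>The density profile\<close>

lemma cell_unique:
  assumes ord: "ordered L N x" and L: "0 < L" and kj: "k < j" "j < N"
    and k: "y + of_int n * L \<in> {x k..<next_pos L N x k}" and j: "y + of_int m * L \<in> {x j..<next_pos L N x j}"
  shows False
proof -
  have "next_pos L N x k \<le> x j"
    using kj ordered_less(1)[OF ord, of "Suc k" j] by (cases "Suc k = j") (auto simp: next_pos_def)
  moreover have "next_pos L N x j \<le> x 0 + L"
    using kj ordered_less(2)[OF ord, of 0 "Suc j"] by (auto simp: next_pos_def)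
  moreover have "x 0 \<le> x k" using ordered_less(1)[OF ord, of 0 k] kj by (cases "k = 0") auto
  ultimately have "of_int n * L < of_int m * L" "of_int m * L < of_int n * L + L"
    using k j by (simp only: atLeastLessThan_iff; linarith)+
  then have "of_int n * L < of_int m * L" "of_int m * L < of_int (n + 1) * L"
    by (simp_all add: distrib_right)
  then have "real_of_int n < of_int m" "real_of_int m < of_int (n + 1)"
    using L by (simp_all only: mult_less_cancel_right_pos)
  then have "n < m" "m < n + 1" by (simp_all only: of_int_less_iff)
  then show False by simp
qed

lemma profile_bound:
  assumes ord: "ordered L N x" and L: "0 < L" and c: "0 < c" and C: "\<And>k. k < N \<Longrightarrow> dpa_density c L N x k \<le> C" and "0 \<le> C"
  shows "Linf_norm (torus L) (dpa_profile c L N x) \<le> ereal C"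
proof -
  let ?A = "\<lambda>k. {z. \<exists>n::int. z + of_int n * L \<in> {x k..<next_pos L N x k}}"
  have A: "?A k \<in> sets borel" for k
  proof -
    have "?A k = (\<Union>n::int. {x k - of_int n * L..<next_pos L N x k - of_int n * L})" by (auto simp: algebra_simps)
    then show ?thesis by simp
  qed
  have "(\<lambda>y. ereal \<bar>dpa_profile c L N x y\<bar>) \<in> borel_measurable borel"
    unfolding dpa_profile_def using A by measurable
  then have meas: "(\<lambda>y. ereal \<bar>dpa_profile c L N x y\<bar>) \<in> borel_measurable (torus L)"
    unfolding torus_def by (intro measurable_restrict_space1 measurable_completion) simp
  have "\<bar>dpa_profile c L N x y\<bar> \<le> C" for y
  proof (cases "\<exists>k<N. y \<in> ?A k")
    case True
    then obtain k where k: "k < N" "y \<in> ?A k" by blast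
    have "y \<notin> ?A j" if "j < N" "j \<noteq> k" for j
      using cell_unique[OF ord L, of j k y] cell_unique[OF ord L, of k j y] that k
      by (cases j k rule: linorder_cases) auto
    then have "dpa_profile c L N x y = (\<Sum>j<N. if j = k then dpa_density c L N x k else 0)"
      unfolding dpa_profile_def using k by (intro sum.cong) (auto simp: indicator_def)
    also have "\<dots> = dpa_density c L N x k" using k by simp
    finally show ?thesis
      using C[OF k(1)] ord c k(1)
      by (simp add: dpa_density_spacing ordered_iff_spacing abs_of_pos)
  next
    case False
    then have "dpa_profile c L N x y = 0" unfolding dpa_profile_def by (intro sum.neutral) (auto simp: indicator_def)
    then show ?thesis using \<open>0 \<le> C\<close> by simp
  qed
  then show ?thesis unfolding Linf_norm_def by (intro esssup_I meas) auto
qed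

text \<open>\<open>M exp (growth_rate M T)\<close> for \<open>M = max 1 R\<close>, with the growth rate expressed through \<open>V = v(0)\<close>.\<close>

definition density_bound :: "(real \<Rightarrow> real) \<Rightarrow> real \<Rightarrow> real \<Rightarrow> real \<Rightarrow> real" where
  "density_bound K R V T = max 1 R * exp ((7 * max 1 R * V * kernel_bound K + 18 * (kernel_bound K)\<^sup>2
      + V\<^sup>2 * (kernel_bound K)\<^sup>2 / 2) * T)"

lemma dpa_bounded:
  assumes K: "admissible_kernel K" and v: "admissible_mobility v" and W: "admissible_diffusion W"
    and L: "0 < L" and T: "0 < T" and \<rho>0: "Linf (torus L) \<rho>0" "AE x in torus L. 0 \<le> \<rho>0 x"
    and mass: "0 < mass L \<rho>0" "mass L \<rho>0 \<le> 1" and N: "2 \<le> N"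
  defines "C \<equiv> density_bound K (real_of_ereal (Linf_norm (torus L) \<rho>0)) (v 0) T"
  shows "dpa_well_defined K v W L \<rho>0 N T"
    and "\<And>X t. \<lbrakk>dpa_solution K v W L \<rho>0 N {0..T} X; t \<in> {0..<T}\<rbrakk> \<Longrightarrow>
      Linf_norm (torus L) (dpa_profile (mass L \<rho>0) L N (\<lambda>k. X k t)) \<le> ereal C"
proof -
  define c where "c = mass L \<rho>0"
  define R where "R = real_of_ereal (Linf_norm (torus L) \<rho>0)"
  define M where "M = max 1 R"
  interpret dpa K v W L c N
    using K v W L mass N by unfold_locales (simp_all add: c_def)
  have M: "1 \<le> M" "R \<le> M" by (simp_all add: M_def)
  have ae: "AE x in torus L. ereal \<bar>\<rho>0 x\<bar> \<le> Linf_norm (torus L) \<rho>0"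
    unfolding Linf_norm_def by (rule esssup_AE)
  have bd: "AE x in torus L. 0 \<le> \<rho>0 x \<and> \<rho>0 x \<le> M"
    using ae \<rho>0(2)
  proof eventually_elim
    case (elim x)
    have "Linf_norm (torus L) \<rho>0 < \<infinity>" using \<rho>0(1) by (simp add: Linf_def)
    then have "\<bar>\<rho>0 x\<bar> \<le> R" using elim(1) by (cases "Linf_norm (torus L) \<rho>0") (auto simp: R_def)
    then show ?case using elim(2) M(2) by simp
  qed
  have init: "c / (real N * M) \<le> spacing L N (init_pos L \<rho>0 N) k" if "k < N" for k
    using M init_gap[OF L _ _ bd mass(1) that] N by (simp add: c_def)
  have cM: "c \<le> M * L"
  proof -
    have "real N * (c / (real N * M)) \<le> (\<Sum>k<N. spacing L N (init_pos L \<rho>0 N) k)"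
      using sum_mono[of "{..<N}" "\<lambda>_. c / (real N * M)" "spacing L N (init_pos L \<rho>0 N)"] init by simp
    then have "c / M \<le> L" using sum_spacing[OF N_pos(1)] N_pos by simp
    then show ?thesis using M(1) by (simp add: field_simps)
  qed
  show "dpa_well_defined K v W L \<rho>0 N T"
    by (rule well_defined[OF c_def M(1) cM init T])
  fix X t assume sol: "dpa_solution K v W L \<rho>0 N {0..T} X" and t: "t \<in> {0..<T}"
  have C: "C = M * exp (growth_rate M * T)"
    by (simp add: C_def density_bound_def growth_rate_def M_def R_def)
  show "Linf_norm (torus L) (dpa_profile (mass L \<rho>0) L N (\<lambda>k. X k t)) \<le> ereal C"
    unfolding c_def[symmetric]
  proof (rule profile_bound[OF _ L_pos c_pos])
    show ord: "ordered L N (\<lambda>k. X k t)" using sol t by (simp add: dpa_solution_def)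
    show "0 \<le> C" using M(1) by (simp add: C)
    fix k assume k: "k < N"
    have "min_gap M T \<le> spacing L N (\<lambda>i. X i t) k"
      using t by (intro solution_gap[OF sol c_def _ _ _ M(1) cM init k]) auto
    then have "dpa_density c L N (\<lambda>k. X k t) k \<le> c / (real N * min_gap M T)"
      unfolding dpa_density_spacing using c_pos N_pos min_gap_pos[OF M(1), of T]
      by (intro divide_left_mono mult_left_mono) auto
    also have "\<dots> = C"
      using c_pos N_pos M(1) by (simp add: C min_gap_def exp_minus field_simps)
    finally show "dpa_density c L N (\<lambda>k. X k t) k \<le> C" .
  qed
qed

text \<open>The value \<open>v(0)\<close> is the \<open>L\<^sup>\<infinity>\<close> norm of the mobility, and two particles are enough.\<close>

theorem theorem1p1:
  shows "\<exists>(Cbar :: real \<Rightarrow> (real \<Rightarrow> real) \<Rightarrow> real \<Rightarrow> real \<Rightarrow> real \<Rightarrow> real)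
          (Nbar :: real \<Rightarrow> real \<Rightarrow> real \<Rightarrow> real \<Rightarrow> nat).
    \<forall>(K :: real \<Rightarrow> real) (v :: real \<Rightarrow> real) (W :: real \<Rightarrow> real) (Wv :: real \<Rightarrow> real)
      (L :: real) (T :: real) (\<rho>0 :: real \<Rightarrow> real).
      admissible_kernel K \<and> admissible_mobility v \<and> admissible_diffusion W \<and> is_Wv W v Wv \<and>
      L > 0 \<and> T > 0 \<and>
      Linf (torus L) \<rho>0 \<and> (AE x in torus L. \<rho>0 x \<ge> 0) \<and>
      0 < mass L \<rho>0 \<and> mass L \<rho>0 \<le> 1 \<longrightarrow>
      (let F = energy K Wv L \<rho>0;
           vnorm = real_of_ereal (Linf_norm (lebesgue_on {0..}) v);
           C = Cbar F K (real_of_ereal (Linf_norm (torus L) \<rho>0)) vnorm T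
       in \<forall>N \<ge> Nbar L T F vnorm.
            dpa_well_defined K v W L \<rho>0 N T \<and>
            (\<forall>X. dpa_solution K v W L \<rho>0 N {0..T} X \<longrightarrow>
               (\<forall>t\<in>{0..<T}.
                  Linf_norm (torus L) (dpa_profile (mass L \<rho>0) L N (\<lambda>k. X k t)) \<le> ereal C)))"
proof (intro exI[of _ "\<lambda>F K R V T. density_bound K R V T"] exI[of _ "\<lambda>L T F V. 2"] allI impI, elim conjE)
  fix K v W Wv :: "real \<Rightarrow> real" and L T :: real and \<rho>0 :: "real \<Rightarrow> real"
  assume *: "admissible_kernel K" "admissible_mobility v" "admissible_diffusion W" "0 < L" "0 < T"
    "Linf (torus L) \<rho>0" "AE x in torus L. 0 \<le> \<rho>0 x" "0 < mass L \<rho>0" "mass L \<rho>0 \<le> 1"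
  have v0: "real_of_ereal (Linf_norm (lebesgue_on {0..}) v) = v 0"
    using *(2) by (simp add: admissible_mobility_def)
  show "let F = energy K Wv L \<rho>0;
           vnorm = real_of_ereal (Linf_norm (lebesgue_on {0..}) v);
           C = density_bound K (real_of_ereal (Linf_norm (torus L) \<rho>0)) vnorm T
       in \<forall>N \<ge> 2. dpa_well_defined K v W L \<rho>0 N T \<and>
            (\<forall>X. dpa_solution K v W L \<rho>0 N {0..T} X \<longrightarrow>
               (\<forall>t\<in>{0..<T}.
                  Linf_norm (torus L) (dpa_profile (mass L \<rho>0) L N (\<lambda>k. X k t)) \<le> ereal C))"
    unfolding Let_def v0 using dpa_bounded[OF *] by blast
qed

end
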